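(* Let $0<\alpha<2$, $\beta\in(1,2]$ and $H'\in(0,1)$. Let $\{A_t\}_{t\ge 0}$ be a non-degenerate symmetric $\beta$-stable process with stationary increments, self-similar with exponent $H'$, defined on a probability space $(\Omega',\mathcal F',\mathbf P')$. Let $M$ be a symmetric $\alpha$-stable random measure with control measure $\mathbf P'\times\lambda$ on $\Omega'\times\mathbb R$, living on another probability space $(\Omega,\mathcal F,\mathbf P)$, where $\lambda$ is Lebesgue measure on $\mathbb R$. Suppose that $\mathbf P'$-almost surely $$\limsup_{n\to\infty}A_n=+\infty\quad\text{and}\quad\liminf_{n\to\infty}A_n=-\infty,\qquad\text{where } n\in\mathbb N.$$ Let $\{Z_A(n)\}_{n\in\mathbb Z}$ be the indicator fractional stable noise, i.e. the stationary symmetric $\alpha$-stable process given for $n\in\mathbb N=\{1,2,\dots\}$ by $$Z_A(n)=\int_{\Omega'}\int_{\mathbb R}\left(1_{[0,A_n(\omega')]}(x)-1_{[0,A_{n-1}(\omega')]}(x)\right)M(d\omega',dx)$$ and extended in law to a two-sided stationary process indexed by $\mathbb Z$. Then $\{Z_A(n)\}_{n\in\mathbb Z}$ is generated by a conservative null flow.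
   Context: Interval convention: for real $a,b$ with $b<a$, $[a,b]$ denotes $[b,a]$; so $[0,A_t]$ means $[A_t,0]$ when $A_t<0$. A process is symmetric $\alpha$-stable (S$\alpha$S) if all finite linear combinations of its values are S$\alpha$S random variables; $S_\alpha(\sigma)$ denotes the S$\alpha$S law with scale parameter $\sigma$, i.e. with characteristic function $\theta\mapsto\exp(-\sigma^\alpha|\theta|^\alpha)$. (The same applies with $\beta$ in place of $\alpha$; $\beta=2$ is the centered Gaussian case.) A process $\{X(t)\}_{t\ge0}$ is self-similar with exponent $H$ if for every $c>0$ the processes $\{X(ct)\}_{t\ge 0}$ and $\{c^{H}X(t)\}_{t\ge 0}$ have the same finite-dimensional distributions. It has stationary increments if for every $h\ge 0$ the processes $\{X(t+h)-X(h)\}_{t\ge0}$ and $\{X(t)-X(0)\}_{t\ge 0}$ have the same finite-dimensional distributions. By self-similarity, $A_0=0$ almost surely. Given a $\sigma$-finite measure $m$ on a measurable space $(B,\mathcal B)$, put $\mathcal B_0=\{A\in\mathcal B:m(A)<\infty\}$. An S$\alpha$S random measure $M$ with control measure $m$ is a $\sigma$-additive random set function on $\mathcal B_0$ such that $M(A)\sim S_\alpha(m(A)^{1/\alpha})$ for $A\in\mathcal B_0$, and such that $M$ is independently scattered: its values on disjoint sets are independent. The stable integral $\int f\,dM$ is defined for $f\in L^\alpha(B,m)$ and is S$\alpha$S with $\mathbf E\exp(i\theta\int f\,dM)=\exp(-|\theta|^\alpha\int|f|^\alpha\,dm)$. Flows. Let $m$ be a $\sigma$-finite measure on a measurable space $E$.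 A nonsingular flow (indexed by $\mathbb Z$) is a family $\{\phi_n\}_{n\in\mathbb Z}$ of measurable maps of $E$ onto itself with $\phi_{n+k}(x)=\phi_n(\phi_k(x))$ for all $n,k\in\mathbb Z$ and $x\in E$, $\phi_0(x)=x$ for all $x\in E$, and $m\circ\phi_n^{-1}\sim m$ (mutual absolute continuity) for all $n$. A $\{-1,1\}$-valued cocycle for $\{\phi_n\}$ is a family of measurable functions $a_n:E\to\{-1,1\}$ with $a_{n+k}(x)=a_k(x)\,a_n(\phi_k(x))$ for $m$-a.e. $x$, for all $n,k\in\mathbb Z$. A stationary S$\alpha$S process $\{X(n)\}_{n\in\mathbb Z}$ is generated by the flow $\{\phi_n\}$ if it has the same finite-dimensional distributions as $\{\int_E f_n\,dM'\}_{n\in\mathbb Z}$, where $M'$ is an S$\alpha$S random measure on $E$ with control measure $m$ and $$f_n(x)=a_n(x)\left(\frac{d(m\circ\phi_n)}{dm}(x)\right)^{1/\alpha}f_0(\phi_n(x))$$ for some $f_0\in L^\alpha(E,m)$ and some $\{-1,1\}$-valued cocycle $\{a_n\}$ for $\{\phi_n\}$, with the full support condition $\mathrm{supp}\{f_n:n\in\mathbb Z\}=E$ (i.e. for $m$-a.e. $x\in E$ there is $n$ with $f_n(x)\neq0$). A measurable set $B\subset E$ is wandering if the sets $\{\phi_n(B)\}_{n\in\mathbb Z}$ are pairwise disjoint modulo $m$-null sets. It is weakly wandering if there is a sequence of distinct integers $(n_k)_{k\ge0}$ with $n_0=0$ such that the sets $\{\phi_{n_k}(B)\}_{k\ge 0}$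 are pairwise disjoint modulo $m$-null sets. Modulo $m$-null sets, $E=C\cup D$ (disjoint union), where the dissipative part $D$ is the (measurable) union of all wandering sets and the conservative part $C$ contains no wandering set of positive measure; and $E=P\cup N$ (disjoint union), where the null part $N$ is the (measurable) union of all weakly wandering sets and the positive part $P$ contains no weakly wandering set of positive measure. The flow is conservative if $m(D)=0$, null if $m(P)=0$, and conservative null if both hold. *)

theory Defs
  imports "HOL-Probability.Probability"
begin

section \<open>Processes and stable laws\<close>

definition random_process :: "'i set \<Rightarrow> 'w measure \<Rightarrow> ('i \<Rightarrow> 'w \<Rightarrow> real) \<Rightarrow> bool" where
  "random_process T W X \<longleftrightarrow> prob_space W \<and> (\<forall>t\<in>T. X t \<in> borel_measurable W)"

definition same_fdds ::
  "'i set \<Rightarrow> 'w measure \<Rightarrow> ('i \<Rightarrow> 'w \<Rightarrow> real) \<Rightarrow> 'v measure \<Rightarrow> ('i \<Rightarrow> 'v \<Rightarrow> real) \<Rightarrow> bool" where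
  "same_fdds T W X V Y \<longleftrightarrow>
     (\<forall>J. finite J \<and> J \<subseteq> T \<longrightarrow>
        distr W (\<Pi>\<^sub>M j\<in>J. borel) (\<lambda>w. \<lambda>j\<in>J. X j w) =
        distr V (\<Pi>\<^sub>M j\<in>J. borel) (\<lambda>v. \<lambda>j\<in>J. Y j v))"

definition has_SaS_law :: "real \<Rightarrow> real \<Rightarrow> 'w measure \<Rightarrow> ('w \<Rightarrow> real) \<Rightarrow> bool" where
  "has_SaS_law \<alpha> \<sigma> W X \<longleftrightarrow> X \<in> borel_measurable W \<and> 0 \<le> \<sigma> \<and>
     (\<forall>\<theta>. char (distr W borel X) \<theta> =
        complex_of_real (exp (- ((\<sigma> powr \<alpha>) * (\<bar>\<theta>\<bar> powr \<alpha>)))))"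

definition SaS_process :: "real \<Rightarrow> 'i set \<Rightarrow> 'w measure \<Rightarrow> ('i \<Rightarrow> 'w \<Rightarrow> real) \<Rightarrow> bool" where
  "SaS_process \<alpha> T W X \<longleftrightarrow> random_process T W X \<and>
     (\<forall>J c. finite J \<and> J \<subseteq> T \<longrightarrow>
        (\<exists>\<sigma>. has_SaS_law \<alpha> \<sigma> W (\<lambda>w. \<Sum>j\<in>J. c j * X j w)))"

definition self_similar :: "real \<Rightarrow> 'w measure \<Rightarrow> (real \<Rightarrow> 'w \<Rightarrow> real) \<Rightarrow> bool" where
  "self_similar H W X \<longleftrightarrow>
     (\<forall>c>0. same_fdds {0..} W (\<lambda>t. X (c * t)) W (\<lambda>t w. (c powr H) * X t w))"

definition stationary_increments :: "'w measure \<Rightarrow> (real \<Rightarrow> 'w \<Rightarrow> real) \<Rightarrow> bool" where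
  "stationary_increments W X \<longleftrightarrow>
     (\<forall>h\<ge>0. same_fdds {0..} W (\<lambda>t w. X (t + h) w - X h w) W (\<lambda>t w. X t w - X 0 w))"

text \<open>Some value of the process is not almost surely constant.\<close>

definition nondegenerate_process :: "'w measure \<Rightarrow> (real \<Rightarrow> 'w \<Rightarrow> real) \<Rightarrow> bool" where
  "nondegenerate_process W X \<longleftrightarrow> (\<exists>t\<ge>0. \<forall>c. \<not> (AE w in W. X t w = c))"

definition stationary_process :: "'w measure \<Rightarrow> (int \<Rightarrow> 'w \<Rightarrow> real) \<Rightarrow> bool" where
  "stationary_process W X \<longleftrightarrow> (\<forall>h. same_fdds UNIV W (\<lambda>n. X (n + h)) W X)"


section \<open>Stable random measures and stable integrals\<close>

definition finite_measure_sets :: "'b measure \<Rightarrow> 'b set set" where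
  "finite_measure_sets m = {A \<in> sets m. emeasure m A < \<infinity>}"

text \<open>The random measure is a random set function on the sets of finite control measure; its
  values on all other sets are irrelevant.\<close>

definition SaS_random_measure ::
  "real \<Rightarrow> 'w measure \<Rightarrow> 'b measure \<Rightarrow> ('b set \<Rightarrow> 'w \<Rightarrow> real) \<Rightarrow> bool" where
  "SaS_random_measure \<alpha> W m M \<longleftrightarrow>
     prob_space W \<and> sigma_finite_measure m \<and>
     (\<forall>A\<in>finite_measure_sets m. has_SaS_law \<alpha> (measure m A powr (1 / \<alpha>)) W (M A)) \<and>
     (\<forall>A::nat \<Rightarrow> 'b set.
        range A \<subseteq> finite_measure_sets m \<and> disjoint_family A \<and>
        (\<Union>i. A i) \<in> finite_measure_sets m \<longrightarrow>
        (AE w in W. (\<lambda>i. M (A i) w) sums M (\<Union>i. A i) w)) \<and>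
     (\<forall>(n::nat) A.
        A ` {..<n} \<subseteq> finite_measure_sets m \<and> disjoint_family_on A {..<n} \<longrightarrow>
        prob_space.indep_vars W (\<lambda>_. borel) (\<lambda>i. M (A i)) {..<n})"

definition in_Lp :: "real \<Rightarrow> 'b measure \<Rightarrow> ('b \<Rightarrow> real) \<Rightarrow> bool" where
  "in_Lp p m f \<longleftrightarrow> f \<in> borel_measurable m \<and> (\<integral>\<^sup>+ x. ennreal (\<bar>f x\<bar> powr p) \<partial>m) < \<infinity>"

definition simple_stable_integral ::
  "'b measure \<Rightarrow> ('b set \<Rightarrow> 'w \<Rightarrow> real) \<Rightarrow> ('b \<Rightarrow> real) \<Rightarrow> 'w \<Rightarrow> real" where
  "simple_stable_integral m M g w = (\<Sum>y\<in>g ` space m - {0}. y * M (g -` {y} \<inter> space m) w)"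

text \<open>The random variable \<open>Y\<close> is a version of the integral of \<open>f\<close> with respect to \<open>M\<close>: the integral
  is the limit in probability of the integrals of simple functions tending to \<open>f\<close> in
  \<open>L\<^sup>\<alpha>\<close>, hence determined up to almost sure equality.\<close>

definition has_stable_integral ::
  "real \<Rightarrow> 'w measure \<Rightarrow> 'b measure \<Rightarrow> ('b set \<Rightarrow> 'w \<Rightarrow> real) \<Rightarrow> ('b \<Rightarrow> real) \<Rightarrow> ('w \<Rightarrow> real) \<Rightarrow> bool"
  where
  "has_stable_integral \<alpha> W m M f Y \<longleftrightarrow>
     in_Lp \<alpha> m f \<and> Y \<in> borel_measurable W \<and>
     (\<exists>g :: nat \<Rightarrow> 'b \<Rightarrow> real.
        (\<forall>k. simple_function m (g k) \<and> emeasure m {x \<in> space m. g k x \<noteq> 0} < \<infinity>) \<and>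
        (\<lambda>k. \<integral>\<^sup>+ x. ennreal (\<bar>g k x - f x\<bar> powr \<alpha>) \<partial>m) \<longlonglongrightarrow> 0 \<and>
        (\<forall>\<epsilon>>0. (\<lambda>k. measure W {w \<in> space W. \<epsilon> < \<bar>simple_stable_integral m M (g k) w - Y w\<bar>})
                  \<longlonglongrightarrow> 0))"


section \<open>Nonsingular flows\<close>

definition nonsingular_flow :: "'e measure \<Rightarrow> (int \<Rightarrow> 'e \<Rightarrow> 'e) \<Rightarrow> bool" where
  "nonsingular_flow m \<phi> \<longleftrightarrow>
     sigma_finite_measure m \<and>
     (\<forall>n. \<phi> n \<in> measurable m m \<and> \<phi> n ` space m = space m) \<and>
     (\<forall>n k. \<forall>x\<in>space m. \<phi> (n + k) x = \<phi> n (\<phi> k x)) \<and>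
     (\<forall>x\<in>space m. \<phi> 0 x = x) \<and>
     (\<forall>n. absolutely_continuous m (distr m m (\<phi> n)) \<and>
          absolutely_continuous (distr m m (\<phi> n)) m)"

definition sign_cocycle :: "'e measure \<Rightarrow> (int \<Rightarrow> 'e \<Rightarrow> 'e) \<Rightarrow> (int \<Rightarrow> 'e \<Rightarrow> real) \<Rightarrow> bool" where
  "sign_cocycle m \<phi> a \<longleftrightarrow>
     (\<forall>n. a n \<in> borel_measurable m \<and> a n ` space m \<subseteq> {-1, 1}) \<and>
     (\<forall>n k. AE x in m. a (n + k) x = a k x * a n (\<phi> k x))"

text \<open>For a flow, the measure \<open>A \<mapsto> m (\<phi> n ` A)\<close> is the image of \<open>m\<close> under
  \<open>\<phi> (- n)\<close>, the inverse of \<open>\<phi> n\<close>.\<close>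

definition flow_kernel ::
  "real \<Rightarrow> 'e measure \<Rightarrow> (int \<Rightarrow> 'e \<Rightarrow> 'e) \<Rightarrow> (int \<Rightarrow> 'e \<Rightarrow> real) \<Rightarrow> ('e \<Rightarrow> real) \<Rightarrow> int \<Rightarrow> 'e \<Rightarrow> real"
  where
  "flow_kernel \<alpha> m \<phi> a f0 n x =
     a n x * (enn2real (RN_deriv m (distr m m (\<phi> (- n))) x) powr (1 / \<alpha>)) * f0 (\<phi> n x)"

text \<open>The random measure in the representation lives on the path space of random set functions,
  which carries a copy of (the law of) every random measure on \<open>m\<close>.\<close>

definition generated_by_flow ::
  "real \<Rightarrow> 'v measure \<Rightarrow> (int \<Rightarrow> 'v \<Rightarrow> real) \<Rightarrow> 'e measure \<Rightarrow> (int \<Rightarrow> 'e \<Rightarrow> 'e) \<Rightarrow> bool" where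
  "generated_by_flow \<alpha> V X m \<phi> \<longleftrightarrow>
     nonsingular_flow m \<phi> \<and>
     (\<exists>a f0. sign_cocycle m \<phi> a \<and> in_Lp \<alpha> m f0 \<and>
        (AE x in m. \<exists>n. flow_kernel \<alpha> m \<phi> a f0 n x \<noteq> 0) \<and>
        (\<exists>(W :: ('e set \<Rightarrow> real) measure) M I.
           SaS_random_measure \<alpha> W m M \<and>
           (\<forall>n. has_stable_integral \<alpha> W m M (flow_kernel \<alpha> m \<phi> a f0 n) (I n)) \<and>
           same_fdds UNIV V X W I))"

definition wandering :: "'e measure \<Rightarrow> (int \<Rightarrow> 'e \<Rightarrow> 'e) \<Rightarrow> 'e set \<Rightarrow> bool" where
  "wandering m \<phi> B \<longleftrightarrow> B \<in> sets m \<and>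
     (\<forall>i j. i \<noteq> j \<longrightarrow> \<phi> i ` B \<inter> \<phi> j ` B \<in> null_sets m)"

definition weakly_wandering :: "'e measure \<Rightarrow> (int \<Rightarrow> 'e \<Rightarrow> 'e) \<Rightarrow> 'e set \<Rightarrow> bool" where
  "weakly_wandering m \<phi> B \<longleftrightarrow> B \<in> sets m \<and>
     (\<exists>s :: nat \<Rightarrow> int. inj s \<and> s 0 = 0 \<and>
        (\<forall>i j. i \<noteq> j \<longrightarrow> \<phi> (s i) ` B \<inter> \<phi> (s j) ` B \<in> null_sets m))"

text \<open>The measurable union of a family of measurable sets is its essential supremum: the smallest
  measurable set, modulo null sets, containing every member of the family modulo null sets.\<close>

definition measurable_union :: "'e measure \<Rightarrow> ('e set \<Rightarrow> bool) \<Rightarrow> 'e set \<Rightarrow> bool" where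
  "measurable_union m P U \<longleftrightarrow>
     U \<in> sets m \<and> (\<forall>B. P B \<longrightarrow> B - U \<in> null_sets m) \<and>
     (\<forall>U'\<in>sets m. (\<forall>B. P B \<longrightarrow> B - U' \<in> null_sets m) \<longrightarrow> U - U' \<in> null_sets m)"

definition flow_decomposition ::
  "'e measure \<Rightarrow> ('e set \<Rightarrow> bool) \<Rightarrow> 'e set \<Rightarrow> 'e set \<Rightarrow> bool" where
  "flow_decomposition m P Q R \<longleftrightarrow>
     Q \<in> sets m \<and> Q \<union> R = space m \<and> Q \<inter> R = {} \<and> measurable_union m P R \<and>
     (\<forall>B. P B \<and> B \<subseteq> Q \<longrightarrow> B \<in> null_sets m)"

definition conservative_flow :: "'e measure \<Rightarrow> (int \<Rightarrow> 'e \<Rightarrow> 'e) \<Rightarrow> bool" where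
  "conservative_flow m \<phi> \<longleftrightarrow>
     (\<exists>C D. flow_decomposition m (wandering m \<phi>) C D \<and> emeasure m D = 0)"

definition null_flow :: "'e measure \<Rightarrow> (int \<Rightarrow> 'e \<Rightarrow> 'e) \<Rightarrow> bool" where
  "null_flow m \<phi> \<longleftrightarrow>
     (\<exists>P N. flow_decomposition m (weakly_wandering m \<phi>) P N \<and> emeasure m P = 0)"


section \<open>Indicator fractional stable noise\<close>

definition unordered_ivl :: "real \<Rightarrow> real \<Rightarrow> real set" where
  "unordered_ivl a b = (if b < a then {b..a} else {a..b})"

definition noise_kernel :: "(real \<Rightarrow> 'w \<Rightarrow> real) \<Rightarrow> nat \<Rightarrow> 'w \<times> real \<Rightarrow> real" where
  "noise_kernel A n = (\<lambda>(w, x).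
     indicator (unordered_ivl 0 (A (real n) w)) x - indicator (unordered_ivl 0 (A (real n - 1) w)) x)"

text \<open>The one-sided noise is defined by the stable integrals only for positive times; a two-sided
  noise is any stationary stable process, on any probability space, that has the same
  finite-dimensional distributions at positive times.\<close>

definition indicator_fractional_stable_noise ::
  "real \<Rightarrow> 'w measure \<Rightarrow> (real \<Rightarrow> 'w \<Rightarrow> real) \<Rightarrow> 'u measure \<Rightarrow> (('w \<times> real) set \<Rightarrow> 'u \<Rightarrow> real) \<Rightarrow>
   'v measure \<Rightarrow> (int \<Rightarrow> 'v \<Rightarrow> real) \<Rightarrow> bool" where
  "indicator_fractional_stable_noise \<alpha> W' A W M V Z \<longleftrightarrow>
     SaS_process \<alpha> UNIV V Z \<and> stationary_process V Z \<and>
     (\<exists>Y. (\<forall>n\<ge>1. has_stable_integral \<alpha> W (W' \<Otimes>\<^sub>M lborel) M (noise_kernel A n) (Y n)) \<and>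
          same_fdds {1..} V (\<lambda>n. Z (int n)) W Y)"

end

theory Submission
  imports Defs
begin

text \<open>
  Almost everywhere and up to the sign of \<open>x\<close>, the kernel of the noise at time \<open>n + 1\<close> is
  \<open>1 {x \<le> A (n + 1)} - 1 {x \<le> A n}\<close>: it records whether the path crosses the level \<open>x\<close> between the times
  \<open>n\<close> and \<open>n + 1\<close>. It depends on \<open>(\<omega>, x)\<close> only through the translated path \<open>x - A\<close>. Extend \<open>A\<close> to a
  path \<open>a\<close> over all integer times with stationary increments, and let \<open>E\<close> be the image of
  \<open>P' \<times> \<lambda>\<close> under \<open>(\<omega>, x) \<mapsto> x - a \<omega>\<close>. A shift of the path changes \<open>a\<close>, in law, only by a random
  translation, and Lebesgue measure is translation invariant; so the shift preserves \<open>E\<close>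
  (\<open>translated_law_cong\<close>, \<open>shift_preserves\<close>). The kernels are the translates of a single function by this
  flow, with trivial cocycle and Radon-Nikodym derivative 1.

  The flow is conservative because almost every path crosses its level infinitely often, while the
  set of paths with a crossing between the times 0 and 1 has finite mass
  (\<open>conservative_if_recurrent\<close>). It is null because by self-similarity the increments of \<open>A\<close> diverge in
  probability: the set of paths with \<open>\<bar>x - a 0\<bar> \<le> K\<close> has finite mass and becomes asymptotically disjoint
  from its translates, so weakly wandering subsets exhaust it, for every \<open>K\<close> (\<open>weakly_wandering_subset\<close>,
  \<open>null_if_mixing\<close>).

  The path \<open>a\<close> is constructed on the probability space of \<open>A\<close> itself (\<open>two_sided_process\<close>): its law is a
  Kolmogorov extension, every law on a countable power of the line is the law of a function of a
  uniform variable, and \<open>A 1\<close>, having no atoms, yields a uniform variable. So \<open>E\<close> is by construction an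
  image of the control measure of \<open>M\<close>, and \<open>M\<close> itself pulls back to a stable random measure on \<open>E\<close>
  (\<open>pullback\<close>, \<open>on_path_space\<close>).

  It remains to compare finite-dimensional laws. All kernels are simple functions with values in
  \<open>{-1, 0, 1}\<close>, so their integrals are finite linear combinations of values of the random measure on
  disjoint cells. These values are independent with laws determined by the measures of the cells, and
  symmetric, so that signs which are constant on cells do not matter (\<open>disjoint_values_same_law\<close>,
  \<open>crossing_integrals_same_law\<close>). The given integrals, defined as limits in probability, agree with
  these elementary ones by \<open>stable_integral_of_simple\<close>.
\<close>

section \<open>Coding real sequences by one uniform variable\<close>

text \<open>A base 3 expansion with digits 0 and 1 only; unlike a binary expansion it determines its digits.\<close>

definition bits_val :: "(nat \<Rightarrow> bool) \<Rightarrow> real" where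
  "bits_val b = (\<Sum>j. of_bool (b j) * (1/3) ^ j)"

text \<open>What is left of an expansion after its first \<open>k\<close> digits, rescaled so that the next digit leads.\<close>

primrec bit_rest :: "nat \<Rightarrow> real \<Rightarrow> real" where
  "bit_rest 0 y = y"
| "bit_rest (Suc k) y = 3 * (bit_rest k y - of_bool (1 \<le> bit_rest k y))"

lemma bits_summable: "summable (\<lambda>j. of_bool (b j) * (1/3::real) ^ j)"
  by (rule summable_comparison_test'[of "\<lambda>j. (1/3::real) ^ j" 0]) (auto simp: abs_mult)

lemma bits_val_split: "bits_val b = of_bool (b 0) + bits_val (\<lambda>j. b (Suc j)) / 3"
proof -
  have "bits_val b = of_bool (b 0) + (\<Sum>j. of_bool (b (Suc j)) * (1/3) ^ Suc j)"
    unfolding bits_val_def using suminf_split_head[OF bits_summable[of b]] by simp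
  also have "(\<Sum>j. of_bool (b (Suc j)) * (1/3::real) ^ Suc j) = (\<Sum>j. (1/3) * (of_bool (b (Suc j)) * (1/3) ^ j))"
    by (simp add: mult_ac)
  also have "\<dots> = (1/3) * bits_val (\<lambda>j. b (Suc j))"
    unfolding bits_val_def by (rule suminf_mult[OF bits_summable])
  finally show ?thesis by simp
qed

lemma bits_val_bounds: "0 \<le> bits_val b" "bits_val b \<le> 3/2"
proof -
  show "0 \<le> bits_val b" unfolding bits_val_def by (intro suminf_nonneg bits_summable) simp
  have "bits_val b \<le> (\<Sum>j. (1/3::real) ^ j)"
    unfolding bits_val_def by (intro suminf_le bits_summable) auto
  then show "bits_val b \<le> 3/2" by (simp add: suminf_geometric)
qed

text \<open>In base 3 the digits 0 and 1 leave a gap: the remaining digits contribute at most one half,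
  so the leading digit is read off by comparison with 1.\<close>

lemma bits_val_ge_1_iff: "1 \<le> bits_val b \<longleftrightarrow> b 0"
  using bits_val_split[of b] bits_val_bounds[of "\<lambda>j. b (Suc j)"] by (cases "b 0") auto

lemma bit_rest_bits_val: "bit_rest k (bits_val b) = bits_val (\<lambda>j. b (j + k))"
proof (induction k)
  case (Suc k)
  then show ?case
    using bits_val_split[of "\<lambda>j. b (j + k)"] bits_val_ge_1_iff[of "\<lambda>j. b (j + k)"] by simp
qed simp

lemma measurable_bit_rest [measurable]: "bit_rest k \<in> borel_measurable borel"
proof (induction k)
  case (Suc k)
  note Suc [measurable]
  show ?case unfolding bit_rest.simps by measurable
qed simp

text \<open>A family of reals is determined by the countably many bits \<open>q < s i\<close> with \<open>q\<close> rational.\<close>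

definition encode_family :: "('i::countable \<Rightarrow> real) \<Rightarrow> real" where
  "encode_family s = bits_val (\<lambda>k. case from_nat k of (i, q) \<Rightarrow> of_rat q < s i)"

text \<open>Each coordinate is the supremum of the rationals below it; on numbers that are not codes the
  values carry no meaning.\<close>

definition decode_family :: "real \<Rightarrow> 'i::countable \<Rightarrow> real" where
  "decode_family y i =
     real_of_ereal (SUP q::rat. if 1 \<le> bit_rest (to_nat (i, q)) y then ereal (of_rat q) else - \<infinity>)"

lemma decode_encode: "decode_family (encode_family s) = s"
proof
  fix i
  have "(SUP q::rat. if of_rat q < s i then ereal (of_rat q) else - \<infinity>) = ereal (s i)"
  proof (rule SUP_eqI)
    fix y assume y: "\<And>q::rat. q \<in> UNIV \<Longrightarrow> (if of_rat q < s i then ereal (of_rat q) else - \<infinity>) \<le> y"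
    show "ereal (s i) \<le> y"
    proof (rule dense_le)
      fix z assume "z < ereal (s i)"
      then obtain r where r: "z < ereal r" "r < s i"
        by (metis ereal_dense2 ereal_less_eq(3) less_ereal.simps(1))
      obtain q where q: "r < of_rat q" "of_rat q < s i" using of_rat_dense[OF r(2)] by auto
      have "z \<le> ereal (of_rat q)" using r q by (meson ereal_less_eq(3) less_imp_le order_trans)
      also have "\<dots> \<le> y" using y[of q] q by simp
      finally show "z \<le> y" .
    qed
  qed (auto intro: less_imp_le)
  then show "decode_family (encode_family s) i = s i"
    unfolding decode_family_def encode_family_def by (simp add: bit_rest_bits_val bits_val_ge_1_iff)
qed

lemma measurable_encode_family [measurable]:
  "encode_family \<in> borel_measurable (\<Pi>\<^sub>M i\<in>(UNIV::'i::countable set). borel)"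
  unfolding encode_family_def bits_val_def by (simp add: split_beta) measurable

lemma measurable_decode_family [measurable]:
  "decode_family \<in> measurable borel (\<Pi>\<^sub>M i\<in>(UNIV::'i::countable set). borel)"
proof (rule measurable_PiM_single')
  fix i :: 'i
  show "(\<lambda>y. decode_family y i) \<in> borel_measurable borel"
    unfolding decode_family_def by measurable
qed (auto simp: space_PiM)

abbreviation uniform01 :: "real measure" where
  "uniform01 \<equiv> restrict_space lborel {0<..<1}"

text \<open>Every law on a countable power of the line is the image of the uniform law: code the family
  by one real number, realise that number by its quantile function, and decode.\<close>

lemma family_law_from_uniform:
  fixes \<nu> :: "('i::countable \<Rightarrow> real) measure"
  assumes "prob_space \<nu>" and sets [measurable_cong]: "sets \<nu> = sets (\<Pi>\<^sub>M i\<in>UNIV. borel)"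
  obtains g where "g \<in> measurable borel (\<Pi>\<^sub>M i\<in>UNIV. borel)"
    "distr uniform01 (\<Pi>\<^sub>M i\<in>UNIV. borel) g = \<nu>"
proof -
  interpret prob_space \<nu> by fact
  define \<rho> where "\<rho> = distr \<nu> borel encode_family"
  have [measurable]: "encode_family \<in> borel_measurable \<nu>"
    using measurable_encode_family sets by (metis measurable_cong_sets)
  interpret R: cdf_distribution \<rho>
    unfolding \<rho>_def cdf_distribution_def real_distribution_def real_distribution_axioms_def
    by (auto intro: prob_space_distr)
  define q where "q u = (if u \<in> {0<..<1} then R.I u else 0)" for u
  have q [measurable]: "q \<in> borel_measurable borel"
    unfolding q_def by (subst measurable_restrict_space_iff[symmetric]) auto
  have q01: "q \<in> borel_measurable uniform01"
    using q by (simp add: measurable_restrict_space1)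
  have "distr uniform01 borel q = distr uniform01 borel R.I"
    by (intro distr_cong) (auto simp: q_def space_restrict_space)
  then have law: "distr uniform01 borel q = \<rho>" using R.distr_I_eq_M by simp
  have "distr uniform01 (\<Pi>\<^sub>M i\<in>UNIV. borel) (decode_family \<circ> q) =
    distr \<rho> (\<Pi>\<^sub>M i\<in>UNIV. borel) decode_family"
    by (subst law[symmetric], subst distr_distr) (use q01 in auto)
  also have "\<dots> = distr \<nu> (\<Pi>\<^sub>M i\<in>UNIV. borel) (\<lambda>s. s)"
    unfolding \<rho>_def by (subst distr_distr) (auto simp: o_def decode_encode)
  also have "\<dots> = \<nu>" using sets by (intro distr_id2) simp
  finally show ?thesis using that[of "decode_family \<circ> q"] q by (auto intro: measurable_comp)
qed

text \<open>For an atomless law the distribution function \<open>F\<close> is continuous, so composing it with the quantile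
  function gives the identity on the open unit interval. As the quantile function has the law of
  \<open>X\<close>, the variable \<open>F X\<close> is uniform.\<close>

lemma cdf_transform_uniform:
  fixes X :: "'w \<Rightarrow> real"
  assumes "prob_space W" and X [measurable]: "X \<in> borel_measurable W"
    and atomless: "\<And>x. measure W {w \<in> space W. X w = x} = 0"
  obtains U where "U \<in> borel_measurable W" "distr W borel U = distr uniform01 borel (\<lambda>u. u)"
proof -
  interpret prob_space W by fact
  define \<rho> where "\<rho> = distr W borel X"
  interpret R: cdf_distribution \<rho>
    unfolding \<rho>_def cdf_distribution_def real_distribution_def real_distribution_axioms_def
    by (auto intro: prob_space_distr)
  have cont: "isCont R.C x" for x
  proof -
    have "measure \<rho> {x} = measure W {w \<in> space W. X w = x}"
      unfolding \<rho>_def by (subst measure_distr) (auto intro!: arg_cong[where f="measure W"])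
    then show ?thesis using R.isCont_cdf atomless by simp
  qed
  have CI: "R.C (R.I u) = u" if u: "u \<in> {0<..<1}" for u
  proof (rule antisym)
    show "u \<le> R.C (R.I u)" using R.pseudoinverse' u by blast
    have "R.C y \<le> u" if "y < R.I u" for y
      using R.pseudoinverse' u that by (meson linorder_not_less nle_le)
    then have "eventually (\<lambda>y. R.C y \<le> u) (at_left (R.I u))"
      by (auto simp: eventually_at_filter)
    moreover have "(R.C \<longlongrightarrow> R.C (R.I u)) (at_left (R.I u))"
      using filterlim_at_split[THEN iffD1, OF cont[unfolded isCont_def]] by (rule conjunct1)
    ultimately show "R.C (R.I u) \<le> u"
      by (intro tendsto_upperbound) auto
  qed
  have I [measurable]: "R.I \<in> borel_measurable uniform01"
    by (subst measurable_cong_sets[of _ "restrict_space borel {0<..<1}" borel borel])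
      (rule sets_restrict_space_cong R.measurable_CI sets_lborel refl)+
  have C [measurable]: "R.C \<in> borel_measurable borel" by (rule R.measurable_C)
  have "distr W borel (R.C \<circ> X) = distr (distr W borel X) borel R.C"
    by (subst distr_distr) auto
  also have "\<dots> = distr \<rho> borel R.C" by (simp only: \<rho>_def)
  also have "\<dots> = distr (distr uniform01 borel R.I) borel R.C"
    by (simp only: R.distr_I_eq_M)
  also have "\<dots> = distr uniform01 borel (R.C \<circ> R.I)"
    by (rule distr_distr[OF C I])
  also have "\<dots> = distr uniform01 borel (\<lambda>u. u)"
    by (intro distr_cong) (auto simp: space_restrict_space CI)
  finally show ?thesis using that[of "R.C \<circ> X"] measurable_comp[OF X C] by simp
qed

text \<open>One atomless variable carries enough randomness for a whole random sequence. This is what allows the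
  two-sided process, and with it the space of the flow, to be built over the given probability space.\<close>

lemma family_law_realised:
  fixes \<nu> :: "('i::countable \<Rightarrow> real) measure" and X :: "'w \<Rightarrow> real"
  assumes W: "prob_space W" and X: "X \<in> borel_measurable W"
    and atomless: "\<And>x. measure W {w \<in> space W. X w = x} = 0"
    and \<nu>: "prob_space \<nu>" "sets \<nu> = sets (\<Pi>\<^sub>M i\<in>UNIV. borel)"
  obtains g where "g \<in> measurable W (\<Pi>\<^sub>M i\<in>UNIV. borel)"
    "distr W (\<Pi>\<^sub>M i\<in>UNIV. borel) g = \<nu>"
proof -
  obtain U where U [measurable]: "U \<in> borel_measurable W"
    and lawU: "distr W borel U = distr uniform01 borel (\<lambda>u. u)"
    using cdf_transform_uniform[OF W X atomless] by blast
  obtain g where g [measurable]: "g \<in> measurable borel (\<Pi>\<^sub>M i\<in>UNIV. borel)"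
    and law: "distr uniform01 (\<Pi>\<^sub>M i\<in>UNIV. borel) g = \<nu>"
    using family_law_from_uniform[OF \<nu>] by blast
  have [measurable]: "(\<lambda>u. u) \<in> borel_measurable uniform01"
    by (simp add: measurable_restrict_space1)
  have "distr W (\<Pi>\<^sub>M i\<in>UNIV. borel) (g \<circ> U) = distr (distr W borel U) (\<Pi>\<^sub>M i\<in>UNIV. borel) g"
    by (subst distr_distr) auto
  also have "\<dots> = \<nu>"
    unfolding lawU by (subst distr_distr) (auto simp: o_def law)
  finally show ?thesis using that[of "g \<circ> U"] by (auto intro: measurable_comp)
qed

section \<open>Stable laws\<close>

text \<open>The Gaussian density is the characteristic function of an independent normal variable \<open>g\<close>; Fubini
  then turns an average of a bump at \<open>a\<close> into an average of the characteristic function of \<open>X\<close>. The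
  identity gives local information on the law of \<open>X\<close>.\<close>

lemma gaussian_smoothing:
  fixes X :: "'w \<Rightarrow> real"
  assumes "prob_space W" and X [measurable]: "X \<in> borel_measurable W"
  shows "complex_of_real (\<integral>w. exp (- ((s * (X w - a))\<^sup>2) / 2) \<partial>W) =
    (\<integral>g. iexp (- (s * g * a)) * char (distr W borel X) (s * g) \<partial>std_normal_distribution)"
proof -
  interpret W: prob_space W by fact
  interpret N: prob_space std_normal_distribution
    by (rule prob_space_normal_density) simp
  have [measurable_cong]: "sets std_normal_distribution = sets borel" by simp
  interpret P: pair_prob_space std_normal_distribution W ..
  have int: "integrable (std_normal_distribution \<Otimes>\<^sub>M W) (\<lambda>(g, w). iexp (s * (X w - a) * g))"
    by (intro P.integrable_const_bound[where B=1]) (auto simp: split_beta norm_exp_i_times simp del: of_real_mult)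
  have "complex_of_real (\<integral>w. exp (- ((s * (X w - a))\<^sup>2) / 2) \<partial>W) =
    (\<integral>w. char std_normal_distribution (s * (X w - a)) \<partial>W)"
    by (subst integral_complex_of_real[symmetric]) (simp add: char_std_normal_distribution)
  also have "\<dots> = (\<integral>w. (\<integral>g. iexp (s * (X w - a) * g) \<partial>std_normal_distribution) \<partial>W)"
    by (simp add: char_def)
  also have "\<dots> = (\<integral>g. (\<integral>w. iexp (s * (X w - a) * g) \<partial>W) \<partial>std_normal_distribution)"
    by (rule P.Fubini_integral) (use int in simp)
  also have "\<dots> = (\<integral>g. iexp (- (s * g * a)) * char (distr W borel X) (s * g) \<partial>std_normal_distribution)"
  proof (intro Bochner_Integration.integral_cong refl)
    fix g
    have "(\<integral>w. iexp (s * (X w - a) * g) \<partial>W) = (\<integral>w. iexp (- (s * g * a)) * iexp (s * g * X w) \<partial>W)"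
      by (simp add: exp_add[symmetric] algebra_simps)
    also have "\<dots> = iexp (- (s * g * a)) * (\<integral>w. iexp (s * g * X w) \<partial>W)"
      by simp
    also have "(\<integral>w. iexp (s * g * X w) \<partial>W) = char (distr W borel X) (s * g)"
      unfolding char_def by (subst integral_distr) auto
    finally show "(\<integral>w. iexp (s * (X w - a) * g) \<partial>W) =
      iexp (- (s * g * a)) * char (distr W borel X) (s * g)" .
  qed
  finally show ?thesis .
qed

lemma powr_at_top:
  assumes "0 < p"
  shows "filterlim (\<lambda>x::real. x powr p) at_top at_top"
  unfolding filterlim_at_top_gt[where c=0]
proof (intro allI impI)
  fix z :: real assume "0 < z"
  show "\<forall>\<^sub>F x in at_top. z \<le> x powr p"
    using eventually_ge_at_top[of "z powr (1 / p)"]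
  proof eventually_elim
    case (elim x)
    have "z = (z powr (1 / p)) powr p" using \<open>0 < z\<close> assms by (simp add: powr_powr)
    also have "\<dots> \<le> x powr p" using elim assms by (intro powr_mono2) auto
    finally show ?case .
  qed
qed

text \<open>Narrow bumps at \<open>a\<close> dominate the mass of the atom, and their averages tend to 0 because the
  characteristic function vanishes at infinity.\<close>

lemma SaS_law_atomless:
  assumes W: "prob_space W" and law: "has_SaS_law \<alpha> \<sigma> W X" and pos: "0 < \<sigma>" "0 < \<alpha>"
  shows "measure W {w \<in> space W. X w = a} = 0"
proof -
  interpret W: prob_space W by fact
  have X [measurable]: "X \<in> borel_measurable W" using law by (simp add: has_SaS_law_def)
  interpret N: prob_space std_normal_distribution
    by (rule prob_space_normal_density) simp
  have [measurable_cong]: "sets std_normal_distribution = sets borel" by simp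
  let ?f = "\<lambda>(n::nat) g::real. exp (- ((\<sigma> powr \<alpha>) * (\<bar>real n * g\<bar> powr \<alpha>)))"
  have le: "measure W {w \<in> space W. X w = a} \<le> (\<integral>g. ?f n g \<partial>std_normal_distribution)" for n
  proof -
    have "measure W {w \<in> space W. X w = a} = (\<integral>w. indicator {w \<in> space W. X w = a} w \<partial>W)"
      by simp
    also have "\<dots> \<le> (\<integral>w. exp (- ((real n * (X w - a))\<^sup>2) / 2) \<partial>W)"
      by (intro integral_mono W.integrable_const_bound[where B=1]) (auto split: split_indicator)
    also have "\<dots> \<le> norm (complex_of_real (\<integral>w. exp (- ((real n * (X w - a))\<^sup>2) / 2) \<partial>W))"
      by (simp del: of_real_exp)
    also have "\<dots> \<le> (\<integral>g. norm (iexp (- (real n * g * a)) * char (distr W borel X) (real n * g)) \<partial>std_normal_distribution)"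
      unfolding gaussian_smoothing[OF W X] by (rule integral_norm_bound)
    also have "\<dots> = (\<integral>g. ?f n g \<partial>std_normal_distribution)"
      using law by (intro Bochner_Integration.integral_cong refl)
        (simp add: has_SaS_law_def norm_mult norm_exp_i_times del: of_real_mult of_real_minus)
    finally show ?thesis .
  qed
  have "(\<lambda>n. \<integral>g. ?f n g \<partial>std_normal_distribution) \<longlonglongrightarrow> (\<integral>g. 0 \<partial>std_normal_distribution)"
  proof (rule integral_dominated_convergence[where w="\<lambda>_. 1"])
    have "AE g in lborel. g \<noteq> (0::real)" by (rule AE_lborel_singleton)
    then have "AE g in std_normal_distribution. g \<noteq> 0"
      by (subst AE_density) auto
    then show "AE g in std_normal_distribution. (\<lambda>n. ?f n g) \<longlonglongrightarrow> 0"
    proof eventually_elim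
      case (elim g)
      have "filterlim (\<lambda>n. real n * \<bar>g\<bar>) at_top sequentially"
        using elim by (intro filterlim_at_top_mult_tendsto_pos[OF tendsto_const _ filterlim_real_sequentially]) auto
      then have "filterlim (\<lambda>n. (real n * \<bar>g\<bar>) powr \<alpha>) at_top sequentially"
        by (rule filterlim_compose[OF powr_at_top[OF pos(2)]])
      then have "filterlim (\<lambda>n. (\<sigma> powr \<alpha>) * (\<bar>real n * g\<bar> powr \<alpha>)) at_top sequentially"
        using pos by (intro filterlim_tendsto_pos_mult_at_top[OF tendsto_const]) (auto simp: abs_mult)
      then have "filterlim (\<lambda>n. - ((\<sigma> powr \<alpha>) * (\<bar>real n * g\<bar> powr \<alpha>))) at_bot sequentially"
        by (simp add: filterlim_uminus_at_bot)
      then show ?case by (rule filterlim_compose[OF exp_at_bot])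
    qed
  qed (auto intro!: AE_I2)
  then have "measure W {w \<in> space W. X w = a} \<le> 0"
    using le by (intro LIMSEQ_le_const) auto
  then show ?thesis using measure_nonneg[of W] by (simp add: antisym)
qed

text \<open>The mean of \<open>1 - exp (- X\<^sup>2 / 2)\<close> is an average of one minus the characteristic function, and it
  controls the probability of large values as in Chebyshev's inequality.\<close>

lemma char_tendsto_1_imp_small:
  assumes W: "prob_space W" and X [measurable]: "\<And>k. X k \<in> borel_measurable W"
    and lim: "\<And>\<theta>. (\<lambda>k. char (distr W borel (X k)) \<theta>) \<longlonglongrightarrow> 1" and "0 < \<epsilon>"
  shows "(\<lambda>k. measure W {w \<in> space W. \<epsilon> < \<bar>X k w\<bar>}) \<longlonglongrightarrow> 0"
proof -
  interpret W: prob_space W by fact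
  interpret N: prob_space std_normal_distribution
    by (rule prob_space_normal_density) simp
  have [measurable_cong]: "sets std_normal_distribution = sets borel" by simp
  interpret D: real_distribution "distr W borel (X k)" for k
    by (auto simp: real_distribution_def real_distribution_axioms_def intro: W.prob_space_distr)
  define e where "e k = (\<integral>w. exp (- ((X k w)\<^sup>2) / 2) \<partial>W)" for k
  have "(\<lambda>k. \<integral>g. char (distr W borel (X k)) g \<partial>std_normal_distribution) \<longlonglongrightarrow> (\<integral>g. 1 \<partial>std_normal_distribution)"
    using lim by (intro integral_dominated_convergence[where w="\<lambda>_. 1"]) (auto intro!: AE_I2 D.cmod_char_le_1)
  moreover have "complex_of_real (e k) = (\<integral>g. char (distr W borel (X k)) g \<partial>std_normal_distribution)" for k
    unfolding e_def using gaussian_smoothing[OF W X, of 1 k 0] by simp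
  ultimately have "(\<lambda>k. complex_of_real (e k)) \<longlonglongrightarrow> complex_of_real 1"
    using N.prob_space by simp
  then have e: "e \<longlonglongrightarrow> 1" unfolding tendsto_of_real_iff .
  define c where "c = 1 - exp (- (\<epsilon>\<^sup>2) / 2)"
  have c: "0 < c" using \<open>0 < \<epsilon>\<close> by (simp add: c_def)
  have le: "measure W {w \<in> space W. \<epsilon> < \<bar>X k w\<bar>} \<le> (1 - e k) / c" for k
  proof -
    have int: "integrable W (\<lambda>w. exp (- ((X k w)\<^sup>2) / 2))"
      by (intro W.integrable_const_bound[where B=1]) auto
    have "c * measure W {w \<in> space W. \<epsilon> < \<bar>X k w\<bar>} = (\<integral>w. c * indicator {w \<in> space W. \<epsilon> < \<bar>X k w\<bar>} w \<partial>W)"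
      by simp
    also have "\<dots> \<le> (\<integral>w. 1 - exp (- ((X k w)\<^sup>2) / 2) \<partial>W)"
    proof (rule integral_mono)
      fix w
      have "exp (- ((X k w)\<^sup>2) / 2) \<le> exp (- (\<epsilon>\<^sup>2) / 2)" if "\<epsilon> < \<bar>X k w\<bar>"
        using that \<open>0 < \<epsilon>\<close> abs_le_square_iff[of \<epsilon> "X k w"] by simp
      then show "c * indicator {w \<in> space W. \<epsilon> < \<bar>X k w\<bar>} w \<le> 1 - exp (- ((X k w)\<^sup>2) / 2)"
        by (auto simp: c_def split: split_indicator)
    qed (use int in \<open>auto intro!: integrable_mult_right W.integrable_const_bound[where B=1]
        split: split_indicator\<close>)
    also have "\<dots> = 1 - e k" using int by (simp add: e_def W.prob_space)
    finally show ?thesis using c by (simp add: field_simps)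
  qed
  show ?thesis
  proof (rule tendsto_sandwich[OF _ _ tendsto_const])
    show "(\<lambda>k. (1 - e k) / c) \<longlonglongrightarrow> 0"
      using tendsto_divide[OF tendsto_diff[OF tendsto_const[of 1] e] tendsto_const[of c]] c by simp
  qed (use le in auto)
qed

lemma char_1_imp_AE_zero:
  assumes W: "prob_space W" and X [measurable]: "X \<in> borel_measurable W"
    and ch: "\<And>\<theta>. char (distr W borel X) \<theta> = 1"
  shows "AE w in W. X w = 0"
proof -
  interpret W: prob_space W by fact
  have "AE w in W. \<not> 1 / real (Suc n) < \<bar>X w\<bar>" for n
  proof -
    have "(\<lambda>k::nat. measure W {w \<in> space W. 1 / real (Suc n) < \<bar>X w\<bar>}) \<longlonglongrightarrow> 0"
      by (intro char_tendsto_1_imp_small[OF W]) (auto simp: ch)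
    then have "measure W {w \<in> space W. 1 / real (Suc n) < \<bar>X w\<bar>} = 0"
      by (simp only: LIMSEQ_const_iff)
    then show ?thesis by (subst (asm) W.prob_eq_0) auto
  qed
  then have "AE w in W. \<forall>n. \<not> 1 / real (Suc n) < \<bar>X w\<bar>" by (simp add: AE_all_countable)
  then show ?thesis
  proof eventually_elim
    case (elim w)
    then show ?case using nat_approx_posE[of "\<bar>X w\<bar>"] by fastforce
  qed
qed

lemma SaS_law_scale_0:
  "prob_space W \<Longrightarrow> has_SaS_law \<alpha> 0 W X \<Longrightarrow> AE w in W. X w = 0"
  by (rule char_1_imp_AE_zero) (auto simp: has_SaS_law_def)

lemma SaS_law_unique:
  assumes "prob_space W" "prob_space V" "has_SaS_law \<alpha> \<sigma> W X" "has_SaS_law \<alpha> \<sigma> V Y"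
  shows "distr W borel X = distr V borel Y"
  by (intro Levy_uniqueness)
    (use assms in \<open>auto simp: has_SaS_law_def real_distribution_def real_distribution_axioms_def fun_eq_iff
       intro: prob_space.prob_space_distr\<close>)

lemma SaS_law_char_scale:
  assumes "prob_space W" "has_SaS_law \<alpha> \<sigma> W X"
  shows "char (distr W borel (\<lambda>w. c * X w)) \<theta> =
    complex_of_real (exp (- ((\<bar>c\<bar> powr \<alpha> * \<sigma> powr \<alpha>) * (\<bar>\<theta>\<bar> powr \<alpha>))))"
proof -
  have [measurable]: "X \<in> borel_measurable W" using assms by (simp add: has_SaS_law_def)
  have "char (distr W borel (\<lambda>w. c * X w)) \<theta> = char (distr W borel X) (\<theta> * c)"
    unfolding char_def by (subst (1 2) integral_distr) (auto simp: mult_ac)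
  then show ?thesis using assms by (simp add: has_SaS_law_def abs_mult powr_mult mult_ac)
qed

lemma SaS_law_uminus:
  assumes "prob_space W" "has_SaS_law \<alpha> \<sigma> W X" "\<bar>c\<bar> = 1"
  shows "has_SaS_law \<alpha> \<sigma> W (\<lambda>w. c * X w)"
  using assms SaS_law_char_scale[OF assms(1,2), of c] by (auto simp: has_SaS_law_def)

lemma SaS_char_indep_sum:
  assumes W: "prob_space W" and ind: "prob_space.indep_vars W (\<lambda>_. borel) X K" and "finite K"
    and law: "\<And>k. k \<in> K \<Longrightarrow> has_SaS_law \<alpha> (\<sigma> k) W (X k)"
  shows "char (distr W borel (\<lambda>w. \<Sum>k\<in>K. c k * X k w)) \<theta> =
    complex_of_real (exp (- ((\<Sum>k\<in>K. \<bar>c k\<bar> powr \<alpha> * \<sigma> k powr \<alpha>) * (\<bar>\<theta>\<bar> powr \<alpha>))))"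
proof -
  interpret prob_space W by fact
  have "indep_vars (\<lambda>_. borel) (\<lambda>k w. c k * X k w) K"
    by (rule indep_vars_compose2[OF ind]) auto
  then have "char (distr W borel (\<lambda>w. \<Sum>k\<in>K. c k * X k w)) \<theta> =
    (\<Prod>k\<in>K. char (distr W borel (\<lambda>w. c k * X k w)) \<theta>)"
    by (rule char_distr_sum)
  also have "\<dots> = (\<Prod>k\<in>K. complex_of_real (exp (- ((\<bar>c k\<bar> powr \<alpha> * \<sigma> k powr \<alpha>) * (\<bar>\<theta>\<bar> powr \<alpha>)))))"
    by (intro prod.cong refl SaS_law_char_scale[OF W law])
  also have "\<dots> = complex_of_real (exp (- ((\<Sum>k\<in>K. \<bar>c k\<bar> powr \<alpha> * \<sigma> k powr \<alpha>) * (\<bar>\<theta>\<bar> powr \<alpha>))))"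
    using \<open>finite K\<close> by (simp only: of_real_prod[symmetric] exp_sum[symmetric] sum_negf sum_distrib_right)
  finally show ?thesis .
qed

section \<open>The two-sided process\<close>

definition increment_law :: "'w measure \<Rightarrow> (real \<Rightarrow> 'w \<Rightarrow> real) \<Rightarrow> int set \<Rightarrow> int \<Rightarrow> (int \<Rightarrow> real) measure" where
  "increment_law W A J h = distr W (\<Pi>\<^sub>M j\<in>J. borel)
     (\<lambda>w. \<lambda>j\<in>J. A (real_of_int (j + h)) w - A (real_of_int h) w)"

text \<open>Stationarity compares increments from one fixed time; the increments from time \<open>h\<close> are differences
  of two of these.\<close>

lemma increment_law_shift:
  assumes A [measurable]: "\<And>t. 0 \<le> t \<Longrightarrow> A t \<in> borel_measurable W"
    and si: "stationary_increments W A"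
    and J: "finite J" "\<And>j. j \<in> J \<Longrightarrow> 0 \<le> j + h" and h: "0 \<le> h" "0 \<le> k"
  shows "increment_law W A J h = increment_law W A J (h + k)"
proof -
  define T where "T = (\<lambda>j. real_of_int (j + h)) ` J \<union> {real_of_int h}"
  have T: "finite T" "T \<subseteq> {0..}" using J h by (auto simp: T_def simp del: of_int_add)
  have T_J: "real_of_int (j + h) \<in> T" if "j \<in> J" for j using that by (auto simp: T_def)
  have T_h: "real_of_int h \<in> T" by (simp add: T_def)
  define \<Psi> where "\<Psi> p = (\<lambda>j\<in>J. p (real_of_int (j + h)) - p (real_of_int h))" for p :: "real \<Rightarrow> real"
  have \<Psi> [measurable]: "\<Psi> \<in> measurable (\<Pi>\<^sub>M t\<in>T. borel) (\<Pi>\<^sub>M j\<in>J. borel)"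
    unfolding \<Psi>_def
    by (intro measurable_restrict borel_measurable_diff measurable_component_singleton T_J T_h)
  have m: "(\<lambda>w. \<lambda>t\<in>T. A (t + real_of_int i) w - A (real_of_int i) w) \<in> measurable W (\<Pi>\<^sub>M t\<in>T. borel)"
    if "0 \<le> i" for i
    using T that by (intro measurable_restrict borel_measurable_diff A) (auto intro: add_nonneg_nonneg)
  have image: "increment_law W A J (h + i) = distr (distr W (\<Pi>\<^sub>M t\<in>T. borel)
      (\<lambda>w. \<lambda>t\<in>T. A (t + real_of_int i) w - A (real_of_int i) w)) (\<Pi>\<^sub>M j\<in>J. borel) \<Psi>" if "0 \<le> i" for i
    unfolding increment_law_def
    by (subst distr_distr[OF \<Psi> m[OF that]], rule distr_cong)
      (use T_J T_h in \<open>auto simp: \<Psi>_def o_def fun_eq_iff add_ac\<close>)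
  have "distr W (\<Pi>\<^sub>M t\<in>T. borel) (\<lambda>w. \<lambda>t\<in>T. A (t + real_of_int k) w - A (real_of_int k) w) =
    distr W (\<Pi>\<^sub>M t\<in>T. borel) (\<lambda>w. \<lambda>t\<in>T. A (t + real_of_int 0) w - A (real_of_int 0) w)"
    using si T h unfolding stationary_increments_def same_fdds_def by simp
  then show ?thesis using image[of 0] image[of k] h by simp
qed

text \<open>Reading the increments from a late enough time on gives a consistent family of laws indexed
  by the finite sets of integers; the Kolmogorov extension is the law of the two-sided process. It
  is realised on the same probability space, as a function of one atomless variable.\<close>

lemma two_sided_process:
  fixes X :: "'w \<Rightarrow> real"
  assumes W: "prob_space W"
    and A [measurable]: "\<And>t. 0 \<le> t \<Longrightarrow> A t \<in> borel_measurable W"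
    and si: "stationary_increments W A"
    and X: "X \<in> borel_measurable W" "\<And>x. measure W {w \<in> space W. X w = x} = 0"
  obtains a :: "int \<Rightarrow> 'w \<Rightarrow> real" where "\<And>j. a j \<in> borel_measurable W"
    "\<And>J h. finite J \<Longrightarrow> 0 \<le> h \<Longrightarrow> (\<And>j. j \<in> J \<Longrightarrow> 0 \<le> j + h) \<Longrightarrow>
       distr W (\<Pi>\<^sub>M j\<in>J. borel) (\<lambda>w. \<lambda>j\<in>J. a j w) = increment_law W A J h"
proof -
  interpret prob_space W by fact
  define late where "late J = (\<Sum>j\<in>J. \<bar>j\<bar>)" for J :: "int set"
  have late: "0 \<le> late J" for J by (auto simp: late_def intro: sum_nonneg)
  have late_mem: "0 \<le> j + late J" if "finite J" "j \<in> J" for j J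
    using member_le_sum[of j J abs] that by (simp add: late_def)
  define P where "P J = increment_law W A J (late J)" for J
  have incr: "increment_law W A J h = P J"
    if "finite J" "0 \<le> h" "\<And>j. j \<in> J \<Longrightarrow> 0 \<le> j + h" for J h
    using increment_law_shift[OF A si that(1) that(3) that(2) late[of J]]
      increment_law_shift[OF A si that(1) late_mem[OF that(1)] late[of J] that(2)]
    by (simp add: P_def add_ac)
  have meas: "(\<lambda>w. \<lambda>j\<in>J. A (real_of_int (j + h)) w - A (real_of_int h) w) \<in> measurable W (\<Pi>\<^sub>M j\<in>J. borel)"
    if "0 \<le> h" "\<And>j. j \<in> J \<Longrightarrow> 0 \<le> j + h" for J h
    using that by (intro measurable_restrict borel_measurable_diff A) (auto simp del: of_int_add)
  interpret K: polish_projective UNIV P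
    unfolding polish_projective_def
  proof (rule projective_family.intro)
    fix J H :: "int set" assume JH: "J \<subseteq> H" "finite H"
    have "distr (P H) (\<Pi>\<^sub>M j\<in>J. borel) (\<lambda>f. restrict f J) = increment_law W A J (late H)"
      unfolding P_def increment_law_def
      using JH by (subst distr_distr[OF measurable_restrict_subset meas])
        (auto intro!: distr_cong late late_mem simp: o_def fun_eq_iff)
    also have "\<dots> = P J"
      using JH late late_mem[OF JH(2)] by (intro incr) (auto dest: finite_subset)
    finally show "P J = distr (P H) (\<Pi>\<^sub>M j\<in>J. borel) (\<lambda>f. restrict f J)" ..
  next
    fix J :: "int set" assume "finite J"
    then show "prob_space (P J)"
      unfolding P_def increment_law_def by (intro prob_space_distr meas late late_mem)
  qed
  obtain g where g: "g \<in> measurable W (\<Pi>\<^sub>M i\<in>UNIV. borel)"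
    and law: "distr W (\<Pi>\<^sub>M i\<in>UNIV. borel) g = K.lim"
    using family_law_realised[OF W X K.P.prob_space_axioms K.sets_lim] by blast
  have a: "(\<lambda>w. g w j) \<in> borel_measurable W" for j
    using measurable_compose[OF g measurable_component_singleton[of j UNIV]] by simp
  show ?thesis
  proof
    fix J :: "int set" and h assume J: "finite J" and h: "0 \<le> h" "\<And>j. j \<in> J \<Longrightarrow> 0 \<le> j + h"
    have r: "(\<lambda>f. restrict f J) \<in> measurable (\<Pi>\<^sub>M i\<in>UNIV. borel) (\<Pi>\<^sub>M j\<in>J. borel)"
      by (intro measurable_restrict_subset) simp
    have "distr W (\<Pi>\<^sub>M j\<in>J. borel) (\<lambda>w. \<lambda>j\<in>J. g w j) =
      distr (distr W (\<Pi>\<^sub>M i\<in>UNIV. borel) g) (\<Pi>\<^sub>M j\<in>J. borel) (\<lambda>f. restrict f J)"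
      by (subst distr_distr[OF r g]) (simp add: o_def)
    also have "\<dots> = P J"
      unfolding law
    proof (rule measure_eqI)
      fix B assume "B \<in> sets (distr K.lim (\<Pi>\<^sub>M j\<in>J. borel) (\<lambda>f. restrict f J))"
      then have B: "B \<in> sets (\<Pi>\<^sub>M j\<in>J. borel)" by simp
      have "emeasure (distr K.lim (\<Pi>\<^sub>M j\<in>J. borel) (\<lambda>f. restrict f J)) B =
        emeasure K.lim (prod_emb UNIV (\<lambda>_. borel) J B)"
        using B r by (subst emeasure_distr)
          (auto simp: prod_emb_def space_PiM K.sets_lim cong: measurable_cong_sets)
      also have "\<dots> = emeasure (P J) B"
        using J B by (intro K.emeasure_lim_emb) auto
      finally show "emeasure (distr K.lim (\<Pi>\<^sub>M j\<in>J. borel) (\<lambda>f. restrict f J)) B = emeasure (P J) B" .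
    qed (simp add: P_def increment_law_def)
    finally show "distr W (\<Pi>\<^sub>M j\<in>J. borel) (\<lambda>w. \<lambda>j\<in>J. g w j) = increment_law W A J h"
      using incr[OF J h] by simp
  qed (rule a)
qed

section \<open>Stable random measures and the integral of simple functions\<close>

lemma (in prob_space) indep_vars_image:
  assumes inj: "inj_on f L" and ind: "indep_vars (\<lambda>_. N) (\<lambda>i. X (f i)) L"
  shows "indep_vars (\<lambda>_. N) X (f ` L)"
proof -
  let ?F = "\<lambda>k. {X k -` A \<inter> space M | A. A \<in> sets N}"
  have rv: "\<forall>k\<in>f ` L. random_variable N (X k)"
    and ev: "\<And>i. i \<in> L \<Longrightarrow> ?F (f i) \<subseteq> events"
    and pr: "\<And>J A. J \<subseteq> L \<Longrightarrow> J \<noteq> {} \<Longrightarrow> finite J \<Longrightarrow> A \<in> (\<Pi> j\<in>J. ?F (f j)) \<Longrightarrow>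
      prob (\<Inter>j\<in>J. A j) = (\<Prod>j\<in>J. prob (A j))"
    using ind unfolding indep_vars_def2 indep_sets_def by auto
  have "indep_sets ?F (f ` L)"
  proof (rule indep_setsI)
    fix A J assume J: "J \<noteq> {}" "J \<subseteq> f ` L" "finite J" and A: "\<forall>j\<in>J. A j \<in> ?F j"
    obtain J' where J': "J' \<subseteq> L" "J = f ` J'" using J by (meson subset_imageE)
    have inj': "inj_on f J'" using inj J' by (meson inj_on_subset)
    have fin: "finite J'" using J J' inj' finite_imageD by blast
    have "prob (\<Inter>j\<in>J'. A (f j)) = (\<Prod>j\<in>J'. prob (A (f j)))"
      using J J' A fin by (intro pr) auto
    then show "prob (\<Inter>j\<in>J. A j) = (\<Prod>j\<in>J. prob (A j))"
      using J' inj' by (simp add: prod.reindex)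
  qed (use ev in auto)
  then show ?thesis using rv unfolding indep_vars_def2 by simp
qed

lemma finite_measure_sets_subset:
  "A \<in> finite_measure_sets m \<Longrightarrow> B \<in> sets m \<Longrightarrow> B \<subseteq> A \<Longrightarrow> B \<in> finite_measure_sets m"
  unfolding finite_measure_sets_def
  by (auto intro: le_less_trans[OF emeasure_mono])

lemma finite_measure_sets_UN:
  assumes "finite K" "D ` K \<subseteq> finite_measure_sets m"
  shows "(\<Union>k\<in>K. D k) \<in> finite_measure_sets m"
proof -
  have "emeasure m (\<Union>k\<in>K. D k) \<le> (\<Sum>k\<in>K. emeasure m (D k))"
    using assms by (intro emeasure_subadditive_finite) (auto simp: finite_measure_sets_def)
  also have "\<dots> < \<infinity>" using assms by (auto simp: finite_measure_sets_def)
  finally show ?thesis using assms by (auto simp: finite_measure_sets_def)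
qed

lemma empty_finite_measure_sets [simp]: "{} \<in> finite_measure_sets m"
  by (simp add: finite_measure_sets_def)

lemma disjoint_family_on_reindex:
  "inj_on f L \<Longrightarrow> disjoint_family_on D (f ` L) \<Longrightarrow> disjoint_family_on (\<lambda>i. D (f i)) L"
  unfolding disjoint_family_on_def inj_on_def by (metis imageI)

locale stable_random_measure =
  fixes \<alpha> :: real and W :: "'w measure" and m :: "'b measure" and M :: "'b set \<Rightarrow> 'w \<Rightarrow> real"
  assumes rm: "SaS_random_measure \<alpha> W m M" and \<alpha>_pos: "0 < \<alpha>"
begin

sublocale W: prob_space W using rm by (simp add: SaS_random_measure_def)

lemma law: "A \<in> finite_measure_sets m \<Longrightarrow> has_SaS_law \<alpha> (measure m A powr (1 / \<alpha>)) W (M A)"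
  using rm by (simp add: SaS_random_measure_def)

lemma measurable_M: "A \<in> finite_measure_sets m \<Longrightarrow> M A \<in> borel_measurable W"
  using law by (simp add: has_SaS_law_def)

lemma value_empty: "AE w in W. M {} w = 0"
  using law[of "{}"] by (intro SaS_law_scale_0[where \<alpha>=\<alpha>]) (auto intro: W.prob_space_axioms)

lemma enumerate_family:
  assumes "finite K"
  obtains f and n :: nat where "inj_on f {..<n}" "f ` {..<n} = K"
  using assms by (metis bij_betw_def ex_bij_betw_nat_finite lessThan_atLeast0)

lemma independent_values:
  assumes K: "finite K" and D: "D ` K \<subseteq> finite_measure_sets m" "disjoint_family_on D K"
  shows "W.indep_vars (\<lambda>_. borel) (\<lambda>k. M (D k)) K"
proof -
  obtain f and n :: nat where f: "inj_on f {..<n}" "f ` {..<n} = K" using enumerate_family[OF K] .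
  have "(\<lambda>i. D (f i)) ` {..<n} \<subseteq> finite_measure_sets m" using f D by auto
  moreover have "disjoint_family_on (\<lambda>i. D (f i)) {..<n}"
    using disjoint_family_on_reindex[OF f(1), of D] f(2) D(2) by simp
  ultimately have "W.indep_vars (\<lambda>_. borel) (\<lambda>i. M (D (f i))) {..<n}"
    using rm by (simp add: SaS_random_measure_def)
  from W.indep_vars_image[OF f(1), of borel "\<lambda>k. M (D k)", OF this] show ?thesis using f by simp
qed

text \<open>Pad the finite family with empty sets, whose values vanish almost surely.\<close>

lemma finite_additivity:
  assumes K: "finite K" and D: "D ` K \<subseteq> finite_measure_sets m" "disjoint_family_on D K"
  shows "AE w in W. M (\<Union>k\<in>K. D k) w = (\<Sum>k\<in>K. M (D k) w)"
proof -
  obtain f and n :: nat where f: "inj_on f {..<n}" "f ` {..<n} = K" using enumerate_family[OF K] .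
  define A where "A i = (if i < n then D (f i) else {})" for i
  have UN: "(\<Union>i. A i) = (\<Union>k\<in>K. D k)" unfolding f(2)[symmetric] by (auto simp: A_def split: if_splits)
  have "range A \<subseteq> finite_measure_sets m" using f D by (auto simp: A_def)
  moreover have "disjoint_family A"
    using disjoint_family_on_reindex[OF f(1), of D] f(2) D(2) by (auto simp: A_def disjoint_family_on_def)
  moreover have "(\<Union>i. A i) \<in> finite_measure_sets m" using finite_measure_sets_UN[OF K D(1)] UN by simp
  ultimately have "AE w in W. (\<lambda>i. M (A i) w) sums M (\<Union>i. A i) w"
    using rm by (simp add: SaS_random_measure_def)
  then show ?thesis using value_empty
  proof eventually_elim
    case (elim w)
    have "(\<lambda>i. M (A i) w) sums (\<Sum>i<n. M (A i) w)"
      by (intro sums_finite) (auto simp: A_def elim)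
    then have "M (\<Union>i. A i) w = (\<Sum>i<n. M (A i) w)" using elim(1) sums_unique2 by blast
    also have "\<dots> = (\<Sum>k\<in>K. M (D k) w)"
      unfolding f(2)[symmetric] sum.reindex[OF f(1)] by (simp add: A_def)
    finally show ?case using UN by simp
  qed
qed

text \<open>The integral of a simple function may be computed from any partition on whose cells the
  function is constant: the level sets are unions of cells.\<close>

lemma simple_integral_partition:
  assumes K: "finite K" and D: "D ` K \<subseteq> finite_measure_sets m" "disjoint_family_on D K"
    and const: "\<And>k x. k \<in> K \<Longrightarrow> x \<in> D k \<Longrightarrow> f x = c k"
    and zero: "\<And>x. x \<in> space m \<Longrightarrow> x \<notin> (\<Union>k\<in>K. D k) \<Longrightarrow> f x = 0"
  shows "AE w in W. simple_stable_integral m M f w = (\<Sum>k\<in>K. c k * M (D k) w)"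
proof -
  have sp: "D k \<subseteq> space m" if "k \<in> K" for k
    using D(1) that sets.sets_into_space[of "D k" m] by (auto simp: finite_measure_sets_def image_subset_iff)
  let ?Y = "f ` space m - {0}"
  have "?Y \<subseteq> c ` K"
  proof
    fix y assume "y \<in> ?Y"
    then obtain x where x: "x \<in> space m" "y = f x" "f x \<noteq> 0" by auto
    then obtain k where "k \<in> K" "x \<in> D k" using zero by blast
    then show "y \<in> c ` K" using const x by auto
  qed
  then have Y: "finite ?Y" using K finite_subset by blast
  define Ky where "Ky y = {k \<in> K. c k = y}" for y
  have level: "f -` {y} \<inter> space m = (\<Union>k\<in>Ky y. D k)" if "y \<noteq> 0" for y
    using const zero sp that unfolding Ky_def by fastforce
  have "AE w in W. M (\<Union>k\<in>Ky y. D k) w = (\<Sum>k\<in>Ky y. M (D k) w)" for y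
    using K D by (intro finite_additivity) (auto simp: Ky_def disjoint_family_on_def)
  then have "AE w in W. \<forall>y\<in>?Y. M (\<Union>k\<in>Ky y. D k) w = (\<Sum>k\<in>Ky y. M (D k) w)"
    by (intro AE_finite_allI Y)
  then show ?thesis using value_empty
  proof eventually_elim
    case (elim w)
    have "simple_stable_integral m M f w = (\<Sum>y\<in>?Y. y * M (\<Union>k\<in>Ky y. D k) w)"
      unfolding simple_stable_integral_def by (intro sum.cong refl) (simp add: level)
    also have "\<dots> = (\<Sum>y\<in>?Y. \<Sum>k\<in>Ky y. c k * M (D k) w)"
      using elim(1) by (intro sum.cong refl) (auto simp: sum_distrib_left Ky_def)
    also have "\<dots> = (\<Sum>k\<in>(\<Union>y\<in>?Y. Ky y). c k * M (D k) w)"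
      using Y K by (intro sum.UNION_disjoint[symmetric]) (auto simp: Ky_def)
    also have "\<dots> = (\<Sum>k\<in>K. c k * M (D k) w)"
    proof (intro sum.mono_neutral_left K ballI)
      fix k assume k: "k \<in> K - (\<Union>y\<in>?Y. Ky y)"
      then have "c k = 0 \<or> D k = {}" using const[of k] sp[of k] by (fastforce simp: Ky_def)
      then show "c k * M (D k) w = 0" using elim(2) by auto
    qed (auto simp: Ky_def)
    finally show ?case .
  qed
qed

text \<open>Refining both functions to the common partition by the pair of values, the difference of the
  two integrals is stable with scale the distance in \<open>L\<^sup>\<alpha>\<close>.\<close>

lemma simple_integral_difference_char:
  assumes g: "simple_function m g" "emeasure m {x \<in> space m. g x \<noteq> 0} < \<infinity>"
    and f: "simple_function m f" "emeasure m {x \<in> space m. f x \<noteq> 0} < \<infinity>"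
  obtains I r where "I \<in> borel_measurable W"
    "AE w in W. simple_stable_integral m M g w - simple_stable_integral m M f w = I w"
    "\<And>\<theta>. char (distr W borel I) \<theta> = complex_of_real (exp (- (r * \<bar>\<theta>\<bar> powr \<alpha>)))"
    "0 \<le> r" "(\<integral>\<^sup>+ x. ennreal (\<bar>g x - f x\<bar> powr \<alpha>) \<partial>m) = ennreal r"
proof -
  define K where "K = (\<lambda>x. (g x, f x)) ` space m - {(0, 0)}"
  define D where "D = (\<lambda>(u, v). {x \<in> space m. g x = u \<and> f x = v})"
  have "K \<subseteq> g ` space m \<times> f ` space m" by (auto simp: K_def)
  then have K: "finite K" using f g by (meson finite_SigmaI finite_subset simple_functionD(1))
  have [measurable]: "g \<in> borel_measurable m" "f \<in> borel_measurable m"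
    using f g by (auto intro: borel_measurable_simple_function)
  have gf: "{x \<in> space m. g x \<noteq> 0} \<in> finite_measure_sets m" "{x \<in> space m. f x \<noteq> 0} \<in> finite_measure_sets m"
    using f g by (auto simp: finite_measure_sets_def)
  have D: "D k \<in> finite_measure_sets m" if "k \<in> K" for k
  proof (cases "fst k = 0")
    case True
    then show ?thesis using that by (intro finite_measure_sets_subset[OF gf(2)]) (auto simp: D_def K_def)
  next
    case False
    then show ?thesis using that by (intro finite_measure_sets_subset[OF gf(1)]) (auto simp: D_def K_def)
  qed
  then have DK: "D ` K \<subseteq> finite_measure_sets m" by auto
  have disj: "disjoint_family_on D K" by (auto simp: disjoint_family_on_def D_def)
  have zero: "g x = 0 \<and> f x = 0" if "x \<in> space m" "x \<notin> (\<Union>k\<in>K. D k)" for x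
    using that by (force simp: K_def D_def)
  define I where "I w = (\<Sum>k\<in>K. (fst k - snd k) * M (D k) w)" for w
  define r where "r = (\<Sum>k\<in>K. \<bar>fst k - snd k\<bar> powr \<alpha> * measure m (D k))"
  show ?thesis
  proof
    show "I \<in> borel_measurable W"
      unfolding I_def using D measurable_M by (intro borel_measurable_sum borel_measurable_times) auto
    have "AE w in W. simple_stable_integral m M g w = (\<Sum>k\<in>K. fst k * M (D k) w)"
      using zero by (intro simple_integral_partition K DK disj) (auto simp: D_def)
    moreover have "AE w in W. simple_stable_integral m M f w = (\<Sum>k\<in>K. snd k * M (D k) w)"
      using zero by (intro simple_integral_partition K DK disj) (auto simp: D_def)
    ultimately show "AE w in W. simple_stable_integral m M g w - simple_stable_integral m M f w = I w"
      by eventually_elim (simp add: I_def sum_subtractf left_diff_distrib)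
    show "char (distr W borel I) \<theta> = complex_of_real (exp (- (r * \<bar>\<theta>\<bar> powr \<alpha>)))" for \<theta>
      unfolding I_def r_def
      using SaS_char_indep_sum[OF W.prob_space_axioms independent_values[OF K DK disj] K law[OF D],
          where c="\<lambda>k. fst k - snd k" and \<theta>=\<theta>] \<alpha>_pos
      by (simp add: powr_powr)
    show "0 \<le> r" unfolding r_def by (intro sum_nonneg) auto
    have "(\<integral>\<^sup>+ x. ennreal (\<bar>g x - f x\<bar> powr \<alpha>) \<partial>m) =
      (\<integral>\<^sup>+ x. (\<Sum>k\<in>K. ennreal (\<bar>fst k - snd k\<bar> powr \<alpha>) * indicator (D k) x) \<partial>m)"
    proof (rule nn_integral_cong)
      fix x assume x: "x \<in> space m"
      have "(\<Sum>k\<in>K. ennreal (\<bar>fst k - snd k\<bar> powr \<alpha>) * indicator (D k) x) =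
        (\<Sum>k\<in>K. if k = (g x, f x) then ennreal (\<bar>g x - f x\<bar> powr \<alpha>) else 0)"
        using x by (intro sum.cong refl) (auto simp: D_def split: split_indicator)
      also have "\<dots> = ennreal (\<bar>g x - f x\<bar> powr \<alpha>)"
        using K x by (auto simp: K_def)
      finally show "ennreal (\<bar>g x - f x\<bar> powr \<alpha>) =
        (\<Sum>k\<in>K. ennreal (\<bar>fst k - snd k\<bar> powr \<alpha>) * indicator (D k) x)" ..
    qed
    also have "\<dots> = (\<Sum>k\<in>K. ennreal (\<bar>fst k - snd k\<bar> powr \<alpha>) * emeasure m (D k))"
    proof -
      have Dm: "D k \<in> sets m" if "k \<in> K" for k using D[OF that] by (simp add: finite_measure_sets_def)
      have "(\<integral>\<^sup>+ x. (\<Sum>k\<in>K. ennreal (\<bar>fst k - snd k\<bar> powr \<alpha>) * indicator (D k) x) \<partial>m) =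
        (\<Sum>k\<in>K. \<integral>\<^sup>+ x. ennreal (\<bar>fst k - snd k\<bar> powr \<alpha>) * indicator (D k) x \<partial>m)"
        by (rule nn_integral_sum) (intro borel_measurable_times_ennreal borel_measurable_const borel_measurable_indicator Dm)
      also have "\<dots> = (\<Sum>k\<in>K. ennreal (\<bar>fst k - snd k\<bar> powr \<alpha>) * emeasure m (D k))"
        by (intro sum.cong refl nn_integral_cmult_indicator Dm)
      finally show ?thesis .
    qed
    also have "\<dots> = (\<Sum>k\<in>K. ennreal (\<bar>fst k - snd k\<bar> powr \<alpha> * measure m (D k)))"
    proof (intro sum.cong refl)
      fix k assume "k \<in> K"
      then have "emeasure m (D k) = ennreal (measure m (D k))"
        using D[of k] by (intro emeasure_eq_ennreal_measure) (auto simp: finite_measure_sets_def)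
      then show "ennreal (\<bar>fst k - snd k\<bar> powr \<alpha>) * emeasure m (D k) =
        ennreal (\<bar>fst k - snd k\<bar> powr \<alpha> * measure m (D k))" by (simp add: ennreal_mult)
    qed
    also have "\<dots> = ennreal r"
      unfolding r_def by (rule sum_ennreal) auto
    finally show "(\<integral>\<^sup>+ x. ennreal (\<bar>g x - f x\<bar> powr \<alpha>) \<partial>m) = ennreal r" .
  qed
qed

lemma measurable_simple_stable_integral:
  assumes f: "simple_function m f" "emeasure m {x \<in> space m. f x \<noteq> 0} < \<infinity>"
  shows "simple_stable_integral m M f \<in> borel_measurable W"
  unfolding simple_stable_integral_def
proof (intro borel_measurable_sum borel_measurable_times borel_measurable_const measurable_M)
  fix y assume "y \<in> f ` space m - {0}"
  moreover have "{x \<in> space m. f x \<noteq> 0} \<in> finite_measure_sets m"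
    using f borel_measurable_simple_function[of m f] by (auto simp: finite_measure_sets_def)
  ultimately show "f -` {y} \<inter> space m \<in> finite_measure_sets m"
    using f by (auto elim!: finite_measure_sets_subset intro: simple_functionD)
qed

text \<open>The integrals of the approximating simple functions converge in probability to \<open>Y\<close>. They also
  converge to the elementary integral of \<open>f\<close>, since the differences are stable with scale tending
  to 0.\<close>

lemma stable_integral_of_simple:
  assumes f: "simple_function m f" "emeasure m {x \<in> space m. f x \<noteq> 0} < \<infinity>"
    and Y: "has_stable_integral \<alpha> W m M f Y"
  shows "AE w in W. Y w = simple_stable_integral m M f w"
proof -
  let ?I = "simple_stable_integral m M"
  obtain g where g: "\<And>k. simple_function m (g k)" "\<And>k. emeasure m {x \<in> space m. g k x \<noteq> 0} < \<infinity>"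
    and L: "(\<lambda>k::nat. \<integral>\<^sup>+ x. ennreal (\<bar>g k x - f x\<bar> powr \<alpha>) \<partial>m) \<longlonglongrightarrow> 0"
    and P: "\<And>\<epsilon>. 0 < \<epsilon> \<Longrightarrow> (\<lambda>k. measure W {w \<in> space W. \<epsilon> < \<bar>?I (g k) w - Y w\<bar>}) \<longlonglongrightarrow> 0"
    and Ym [measurable]: "Y \<in> borel_measurable W"
    using Y unfolding has_stable_integral_def by blast
  have [measurable]: "?I (g k) \<in> borel_measurable W" "?I f \<in> borel_measurable W" for k
    using f g by (auto intro: measurable_simple_stable_integral)
  define d where "d k w = ?I (g k) w - ?I f w" for k w
  have [measurable]: "d k \<in> borel_measurable W" for k unfolding d_def by measurable
  have "\<exists>r. (\<forall>\<theta>. char (distr W borel (d k)) \<theta> = complex_of_real (exp (- (r * \<bar>\<theta>\<bar> powr \<alpha>)))) \<and>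
    0 \<le> r \<and> (\<integral>\<^sup>+ x. ennreal (\<bar>g k x - f x\<bar> powr \<alpha>) \<partial>m) = ennreal r" for k
  proof (rule simple_integral_difference_char[OF g(1,2)[of k] f])
    fix I r assume I [measurable]: "I \<in> borel_measurable W" and ae: "AE w in W. ?I (g k) w - ?I f w = I w"
      and *: "\<And>\<theta>. char (distr W borel I) \<theta> = complex_of_real (exp (- (r * \<bar>\<theta>\<bar> powr \<alpha>)))"
        "0 \<le> r" "(\<integral>\<^sup>+ x. ennreal (\<bar>g k x - f x\<bar> powr \<alpha>) \<partial>m) = ennreal r"
    have "distr W borel (d k) = distr W borel I"
      using ae by (intro distr_cong_AE) (auto simp: d_def)
    then show ?thesis using * by auto
  qed
  then obtain r where ch: "\<And>k \<theta>. char (distr W borel (d k)) \<theta> = complex_of_real (exp (- (r k * \<bar>\<theta>\<bar> powr \<alpha>)))"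
    and r: "\<And>k. 0 \<le> r k" "\<And>k. (\<integral>\<^sup>+ x. ennreal (\<bar>g k x - f x\<bar> powr \<alpha>) \<partial>m) = ennreal (r k)"
    by metis
  have "r \<longlonglongrightarrow> 0" using L r by (simp add: ennreal_tendsto_0_iff)
  then have "(\<lambda>k. char (distr W borel (d k)) \<theta>) \<longlonglongrightarrow> 1" for \<theta>
    unfolding ch by (auto intro!: tendsto_eq_intros)
  then have small: "(\<lambda>k. measure W {w \<in> space W. \<epsilon> < \<bar>d k w\<bar>}) \<longlonglongrightarrow> 0" if "0 < \<epsilon>" for \<epsilon>
    using that by (intro char_tendsto_1_imp_small[OF W.prob_space_axioms]) auto
  have "AE w in W. \<not> 1 / real (Suc n) < \<bar>Y w - ?I f w\<bar>" for n
  proof -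
    define \<epsilon> where "\<epsilon> = 1 / real (Suc n) / 2"
    have \<epsilon>: "0 < \<epsilon>" by (simp add: \<epsilon>_def field_simps)
    have "measure W {w \<in> space W. 2 * \<epsilon> < \<bar>Y w - ?I f w\<bar>} \<le>
      measure W {w \<in> space W. \<epsilon> < \<bar>d k w\<bar>} + measure W {w \<in> space W. \<epsilon> < \<bar>?I (g k) w - Y w\<bar>}" for k
    proof -
      have "measure W {w \<in> space W. 2 * \<epsilon> < \<bar>Y w - ?I f w\<bar>} \<le>
        measure W ({w \<in> space W. \<epsilon> < \<bar>d k w\<bar>} \<union> {w \<in> space W. \<epsilon> < \<bar>?I (g k) w - Y w\<bar>})"
        by (rule W.finite_measure_mono) (auto simp: d_def)
      also have "\<dots> \<le> measure W {w \<in> space W. \<epsilon> < \<bar>d k w\<bar>} + measure W {w \<in> space W. \<epsilon> < \<bar>?I (g k) w - Y w\<bar>}"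
        by (intro measure_Un_le) (auto simp: d_def)
      finally show ?thesis .
    qed
    moreover have "(\<lambda>k. measure W {w \<in> space W. \<epsilon> < \<bar>d k w\<bar>} +
      measure W {w \<in> space W. \<epsilon> < \<bar>?I (g k) w - Y w\<bar>}) \<longlonglongrightarrow> 0"
      using tendsto_add[OF small[OF \<epsilon>] P[OF \<epsilon>]] by simp
    ultimately have "measure W {w \<in> space W. 2 * \<epsilon> < \<bar>Y w - ?I f w\<bar>} \<le> 0"
      by (intro LIMSEQ_le_const) auto
    then have "measure W {w \<in> space W. 2 * \<epsilon> < \<bar>Y w - ?I f w\<bar>} = 0"
      using measure_nonneg[of W] by (simp add: antisym)
    then have "AE w in W. \<not> 2 * \<epsilon> < \<bar>Y w - ?I f w\<bar>" by (subst (asm) W.prob_eq_0) auto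
    moreover have "2 * \<epsilon> = 1 / real (Suc n)" by (simp add: \<epsilon>_def field_simps)
    ultimately show ?thesis by simp
  qed
  then have "AE w in W. \<forall>n. \<not> 1 / real (Suc n) < \<bar>Y w - ?I f w\<bar>" by (simp add: AE_all_countable)
  then show ?thesis
  proof eventually_elim
    case (elim w)
    then show ?case using nat_approx_posE[of "\<bar>Y w - ?I f w\<bar>"] by fastforce
  qed
qed

lemma simple_function_has_integral:
  assumes f: "simple_function m f" "emeasure m {x \<in> space m. f x \<noteq> 0} < \<infinity>"
    and f': "in_Lp \<alpha> m f'" "AE x in m. f' x = f x"
  shows "has_stable_integral \<alpha> W m M f' (simple_stable_integral m M f)"
proof -
  have "(\<integral>\<^sup>+ x. ennreal (\<bar>f x - f' x\<bar> powr \<alpha>) \<partial>m) = (\<integral>\<^sup>+ x. 0 \<partial>m)"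
    using f'(2) \<alpha>_pos by (intro nn_integral_cong_AE) (auto elim!: eventually_mono)
  then show ?thesis unfolding has_stable_integral_def
    using f f' measurable_simple_stable_integral[OF f]
    by (intro conjI exI[of _ "\<lambda>_. f"]) auto
qed

end

section \<open>Transport and joint laws of random measures\<close>

context stable_random_measure
begin

lemma countable_additivity:
  "range A \<subseteq> finite_measure_sets m \<Longrightarrow> disjoint_family A \<Longrightarrow> (\<Union>i::nat. A i) \<in> finite_measure_sets m \<Longrightarrow>
    AE w in W. (\<lambda>i. M (A i) w) sums M (\<Union>i. A i) w"
  using rm unfolding SaS_random_measure_def by blast

text \<open>This is how a flow on an image of the control space of the noise inherits a stable random measure.\<close>

lemma pullback:
  assumes G [measurable]: "G \<in> measurable m N" and sf: "sigma_finite_measure (distr m N G)"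
  shows "SaS_random_measure \<alpha> W (distr m N G) (\<lambda>B. M (G -` B \<inter> space m))"
proof -
  let ?V = "\<lambda>B. G -` B \<inter> space m"
  have V: "?V B \<in> finite_measure_sets m" if "B \<in> finite_measure_sets (distr m N G)" for B
    using that by (auto simp: finite_measure_sets_def emeasure_distr)
  show ?thesis
    unfolding SaS_random_measure_def
  proof (intro conjI allI impI ballI sf W.prob_space_axioms)
    fix B assume B: "B \<in> finite_measure_sets (distr m N G)"
    then have "measure (distr m N G) B = measure m (?V B)"
      by (intro measure_distr) (auto simp: finite_measure_sets_def)
    then show "has_SaS_law \<alpha> (measure (distr m N G) B powr (1 / \<alpha>)) W (M (?V B))"
      using law[OF V[OF B]] by simp
  next
    fix B :: "nat \<Rightarrow> _"
    assume B: "range B \<subseteq> finite_measure_sets (distr m N G) \<and> disjoint_family B \<and>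
      (\<Union>i. B i) \<in> finite_measure_sets (distr m N G)"
    have UN: "?V (\<Union>i. B i) = (\<Union>i. ?V (B i))" by auto
    have "disjoint_family (\<lambda>i. ?V (B i))"
      using B unfolding disjoint_family_on_def by blast
    moreover have "?V (B i) \<in> finite_measure_sets m" for i using B by (intro V) auto
    moreover have "(\<Union>i. ?V (B i)) \<in> finite_measure_sets m" unfolding UN[symmetric] using B by (intro V) auto
    ultimately show "AE w in W. (\<lambda>i. M (?V (B i)) w) sums M (?V (\<Union>i. B i)) w"
      unfolding UN by (intro countable_additivity) auto
  next
    fix n :: nat and B
    assume B: "B ` {..<n} \<subseteq> finite_measure_sets (distr m N G) \<and> disjoint_family_on B {..<n}"
    then have "disjoint_family_on (\<lambda>i. ?V (B i)) {..<n}" unfolding disjoint_family_on_def by blast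
    then show "W.indep_vars (\<lambda>_. borel) (\<lambda>i. M (?V (B i))) {..<n}"
      using V B by (intro independent_values) auto
  qed
qed

text \<open>Only the laws of the values matter, so the random measure may be moved to the space of its
  paths. Values on sets of infinite measure are replaced by 0 to make the path map measurable.\<close>

lemma on_path_space:
  obtains W' :: "('b set \<Rightarrow> real) measure" where "SaS_random_measure \<alpha> W' m (\<lambda>B p. p B)"
proof
  define X where "X w = (\<lambda>B. if B \<in> finite_measure_sets m then M B w else 0)" for w
  let ?N = "\<Pi>\<^sub>M B\<in>(UNIV::'b set set). (borel :: real measure)"
  have X [measurable]: "X \<in> measurable W ?N"
  proof (rule measurable_PiM_single')
    fix B show "(\<lambda>w. X w B) \<in> borel_measurable W"
      using measurable_M by (cases "B \<in> finite_measure_sets m") (auto simp: X_def)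
  qed (auto simp: space_PiM)
  define W' where "W' = distr W ?N X"
  interpret W': prob_space W' unfolding W'_def by (rule W.prob_space_distr) measurable
  have [measurable_cong]: "sets W' = sets ?N" by (simp add: W'_def)
  have coord [measurable]: "(\<lambda>p. p B) \<in> borel_measurable ?N" for B
    using measurable_component_singleton[of B UNIV] by simp
  have coord': "(\<lambda>p. p B) \<in> borel_measurable W'" for B
    by measurable
  have distr_coord: "distr W' borel (\<lambda>p. p B) = distr W borel (M B)" if "B \<in> finite_measure_sets m" for B
    unfolding W'_def using that by (subst distr_distr) (auto simp: o_def X_def intro!: distr_cong)
  show "SaS_random_measure \<alpha> W' m (\<lambda>B p. p B)"
    unfolding SaS_random_measure_def
  proof (intro conjI allI impI ballI W'.prob_space_axioms)
    show "sigma_finite_measure m" using rm by (simp add: SaS_random_measure_def)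
  next
    fix B assume B: "B \<in> finite_measure_sets m"
    show "has_SaS_law \<alpha> (measure m B powr (1 / \<alpha>)) W' (\<lambda>p. p B)"
      using law[OF B] coord' distr_coord[OF B] by (simp add: has_SaS_law_def)
  next
    fix B :: "nat \<Rightarrow> _"
    assume B: "range B \<subseteq> finite_measure_sets m \<and> disjoint_family B \<and> (\<Union>i. B i) \<in> finite_measure_sets m"
    then have "AE w in W. (\<lambda>i. M (B i) w) sums M (\<Union>i. B i) w"
      using rm by (simp add: SaS_random_measure_def)
    then have ae: "AE w in W. (\<lambda>i. X w (B i)) sums X w (\<Union>i. B i)"
    proof eventually_elim
      case (elim w)
      have "B i \<in> finite_measure_sets m" for i using B by auto
      then show ?case using B elim by (simp add: X_def)
    qed
    have "Measurable.pred ?N (\<lambda>p. (\<lambda>n. (\<Sum>i<n. p (B i))) \<longlonglongrightarrow> p (\<Union>i. B i))"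
    proof -
      have *: "(\<lambda>n. (\<Sum>i<n. p (B i))) \<longlonglongrightarrow> p (\<Union>i. B i) \<longleftrightarrow>
        limsup (\<lambda>n. ereal \<bar>(\<Sum>i<n. p (B i)) - p (\<Union>i. B i)\<bar>) \<le> 0" for p :: "'b set \<Rightarrow> real"
      proof -
        have "(\<lambda>n. (\<Sum>i<n. p (B i))) \<longlonglongrightarrow> p (\<Union>i. B i) \<longleftrightarrow>
          (\<lambda>n. \<bar>(\<Sum>i<n. p (B i)) - p (\<Union>i. B i)\<bar>) \<longlonglongrightarrow> 0"
          by (subst LIM_zero_iff[symmetric]) (simp add: tendsto_rabs_zero_iff)
        also have "\<dots> \<longleftrightarrow> limsup (\<lambda>n. ereal \<bar>(\<Sum>i<n. p (B i)) - p (\<Union>i. B i)\<bar>) \<le> 0"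
        proof
          assume "limsup (\<lambda>n. ereal \<bar>(\<Sum>i<n. p (B i)) - p (\<Union>i. B i)\<bar>) \<le> 0"
          moreover have "0 \<le> liminf (\<lambda>n. ereal \<bar>(\<Sum>i<n. p (B i)) - p (\<Union>i. B i)\<bar>)"
            by (intro Liminf_bounded) auto
          ultimately show "(\<lambda>n. \<bar>(\<Sum>i<n. p (B i)) - p (\<Union>i. B i)\<bar>) \<longlonglongrightarrow> 0"
            by (intro limsup_le_liminf_real) (auto simp: zero_ereal_def)
        next
          assume "(\<lambda>n. \<bar>(\<Sum>i<n. p (B i)) - p (\<Union>i. B i)\<bar>) \<longlonglongrightarrow> 0"
          then have "(\<lambda>n. ereal \<bar>(\<Sum>i<n. p (B i)) - p (\<Union>i. B i)\<bar>) \<longlonglongrightarrow> ereal 0" by simp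
          from lim_imp_Limsup[OF _ this]
          show "limsup (\<lambda>n. ereal \<bar>(\<Sum>i<n. p (B i)) - p (\<Union>i. B i)\<bar>) \<le> 0"
            by (simp add: zero_ereal_def)
        qed
        finally show ?thesis .
      qed
      show ?thesis unfolding * by measurable
    qed
    then have "{p \<in> space ?N. (\<lambda>i. p (B i)) sums p (\<Union>i. B i)} \<in> sets ?N"
      unfolding sums_def pred_def .
    then show "AE p in W'. (\<lambda>i. p (B i)) sums p (\<Union>i. B i)"
      unfolding W'_def using ae by (subst AE_distr_iff) auto
  next
    fix n :: nat and B
    assume B: "B ` {..<n} \<subseteq> finite_measure_sets m \<and> disjoint_family_on B {..<n}"
    show "W'.indep_vars (\<lambda>_. borel) (\<lambda>i p. p (B i)) {..<n}"
    proof (cases "n = 0")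
      case True
      then show ?thesis by (simp add: W'.indep_vars_def2 W'.indep_sets_def)
    next
      case False
      then have ne: "{..<n} \<noteq> {}" by auto
      have fin: "B i \<in> finite_measure_sets m" if "i \<in> {..<n}" for i using B that by auto
      have "W.indep_vars (\<lambda>_. borel) (\<lambda>i. M (B i)) {..<n}"
        using B by (intro independent_values) auto
      then have *: "distr W (\<Pi>\<^sub>M i\<in>{..<n}. borel) (\<lambda>w. \<lambda>i\<in>{..<n}. M (B i) w) =
        (\<Pi>\<^sub>M i\<in>{..<n}. distr W borel (M (B i)))"
        by (subst (asm) W.indep_vars_iff_distr_eq_PiM'[OF ne]) (use fin measurable_M in auto)
      have "distr W' (\<Pi>\<^sub>M i\<in>{..<n}. borel) (\<lambda>p. \<lambda>i\<in>{..<n}. p (B i)) =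
        distr W (\<Pi>\<^sub>M i\<in>{..<n}. borel) (\<lambda>w. \<lambda>i\<in>{..<n}. M (B i) w)"
        unfolding W'_def
        by (subst distr_distr) (use fin in \<open>auto simp: o_def X_def fun_eq_iff intro!: distr_cong measurable_restrict\<close>)
      also have "\<dots> = (\<Pi>\<^sub>M i\<in>{..<n}. distr W' borel (\<lambda>p. p (B i)))"
        unfolding * using fin by (intro PiM_cong refl) (simp add: distr_coord)
      finally show ?thesis
        by (subst W'.indep_vars_iff_distr_eq_PiM'[OF ne]) (use coord' in auto)
    qed
  qed
qed

end

text \<open>Both sides are product measures: the values are independent, the scale of each is a function of the
  measure of the set, and a stable law of given scale is symmetric.\<close>

lemma disjoint_values_same_law:
  assumes M1: "stable_random_measure \<alpha> W1 m1 M1" and M2: "stable_random_measure \<alpha> W2 m2 M2"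
    and K: "finite K"
    and D1: "D1 ` K \<subseteq> finite_measure_sets m1" "disjoint_family_on D1 K"
    and D2: "D2 ` K \<subseteq> finite_measure_sets m2" "disjoint_family_on D2 K"
    and eq: "\<And>k. k \<in> K \<Longrightarrow> measure m1 (D1 k) = measure m2 (D2 k)"
    and s: "\<And>k. k \<in> K \<Longrightarrow> \<bar>s k :: real\<bar> = 1"
  shows "distr W1 (\<Pi>\<^sub>M k\<in>K. borel) (\<lambda>w. \<lambda>k\<in>K. M1 (D1 k) w) =
    distr W2 (\<Pi>\<^sub>M k\<in>K. borel) (\<lambda>w. \<lambda>k\<in>K. s k * M2 (D2 k) w)"
proof -
  interpret M1: stable_random_measure \<alpha> W1 m1 M1 by fact
  interpret M2: stable_random_measure \<alpha> W2 m2 M2 by fact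
  show ?thesis
  proof (cases "K = {}")
    case True
    then show ?thesis by (simp add: restrict_def space_PiM M1.W.distr_const M2.W.distr_const)
  next
    case False
    have m1: "M1 (D1 k) \<in> borel_measurable W1" if "k \<in> K" for k
      using D1 that by (intro M1.measurable_M) auto
    have m2: "(\<lambda>w. s k * M2 (D2 k) w) \<in> borel_measurable W2" if "k \<in> K" for k
      using D2 that by (intro borel_measurable_times borel_measurable_const M2.measurable_M) auto
    have 1: "distr W1 (\<Pi>\<^sub>M k\<in>K. borel) (\<lambda>w. \<lambda>k\<in>K. M1 (D1 k) w) = (\<Pi>\<^sub>M k\<in>K. distr W1 borel (M1 (D1 k)))"
      using M1.independent_values[OF K D1]
      by (subst (asm) M1.W.indep_vars_iff_distr_eq_PiM'[OF False m1]) auto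
    have "M2.W.indep_vars (\<lambda>_. borel) (\<lambda>k w. s k * M2 (D2 k) w) K"
      by (rule M2.W.indep_vars_compose2[OF M2.independent_values[OF K D2]]) auto
    then have 2: "distr W2 (\<Pi>\<^sub>M k\<in>K. borel) (\<lambda>w. \<lambda>k\<in>K. s k * M2 (D2 k) w) =
      (\<Pi>\<^sub>M k\<in>K. distr W2 borel (\<lambda>w. s k * M2 (D2 k) w))"
      by (subst (asm) M2.W.indep_vars_iff_distr_eq_PiM'[OF False m2]) auto
    have "distr W1 borel (M1 (D1 k)) = distr W2 borel (\<lambda>w. s k * M2 (D2 k) w)" if k: "k \<in> K" for k
    proof (rule SaS_law_unique[OF M1.W.prob_space_axioms M2.W.prob_space_axioms])
      show "has_SaS_law \<alpha> (measure m1 (D1 k) powr (1 / \<alpha>)) W1 (M1 (D1 k))"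
        using D1 k by (intro M1.law) auto
      show "has_SaS_law \<alpha> (measure m1 (D1 k) powr (1 / \<alpha>)) W2 (\<lambda>w. s k * M2 (D2 k) w)"
        using D2 k s[OF k] unfolding eq[OF k]
        by (intro SaS_law_uminus M2.law M2.W.prob_space_axioms) auto
    qed
    then show ?thesis unfolding 1 2 by (intro PiM_cong refl) simp
  qed
qed

text \<open>Both vectors of integrals are the same linear image of the values on the cells.\<close>

lemma simple_integrals_same_law:
  assumes M1: "stable_random_measure \<alpha> W1 m1 M1" and M2: "stable_random_measure \<alpha> W2 m2 M2"
    and K: "finite K"
    and D1: "D1 ` K \<subseteq> finite_measure_sets m1" "disjoint_family_on D1 K"
    and D2: "D2 ` K \<subseteq> finite_measure_sets m2" "disjoint_family_on D2 K"
    and eq: "\<And>k. k \<in> K \<Longrightarrow> measure m1 (D1 k) = measure m2 (D2 k)"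
    and s: "\<And>k. k \<in> K \<Longrightarrow> \<bar>s k :: real\<bar> = 1"
    and J: "finite J"
    and f: "\<And>n k x. n \<in> J \<Longrightarrow> k \<in> K \<Longrightarrow> x \<in> D1 k \<Longrightarrow> f n x = c n k"
      "\<And>n x. n \<in> J \<Longrightarrow> x \<in> space m1 \<Longrightarrow> x \<notin> (\<Union>k\<in>K. D1 k) \<Longrightarrow> f n x = 0"
    and g: "\<And>n k x. n \<in> J \<Longrightarrow> k \<in> K \<Longrightarrow> x \<in> D2 k \<Longrightarrow> g n x = s k * c n k"
      "\<And>n x. n \<in> J \<Longrightarrow> x \<in> space m2 \<Longrightarrow> x \<notin> (\<Union>k\<in>K. D2 k) \<Longrightarrow> g n x = 0"
    and X: "\<And>n. n \<in> J \<Longrightarrow> X n \<in> borel_measurable W1"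
      "\<And>n. n \<in> J \<Longrightarrow> AE w in W1. X n w = simple_stable_integral m1 M1 (f n) w"
    and Y: "\<And>n. n \<in> J \<Longrightarrow> Y n \<in> borel_measurable W2"
      "\<And>n. n \<in> J \<Longrightarrow> AE w in W2. Y n w = simple_stable_integral m2 M2 (g n) w"
  shows "distr W1 (\<Pi>\<^sub>M n\<in>J. borel) (\<lambda>w. \<lambda>n\<in>J. X n w) = distr W2 (\<Pi>\<^sub>M n\<in>J. borel) (\<lambda>w. \<lambda>n\<in>J. Y n w)"
proof -
  interpret M1: stable_random_measure \<alpha> W1 m1 M1 by fact
  interpret M2: stable_random_measure \<alpha> W2 m2 M2 by fact
  define \<Psi> where "\<Psi> v = (\<lambda>n\<in>J. \<Sum>k\<in>K. c n k * v k)" for v :: "_ \<Rightarrow> real"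
  have \<Psi> [measurable]: "\<Psi> \<in> measurable (\<Pi>\<^sub>M k\<in>K. borel) (\<Pi>\<^sub>M n\<in>J. borel)"
    unfolding \<Psi>_def by (intro measurable_restrict borel_measurable_sum borel_measurable_times
      borel_measurable_const measurable_component_singleton)
  have m1: "(\<lambda>w. \<lambda>k\<in>K. M1 (D1 k) w) \<in> measurable W1 (\<Pi>\<^sub>M k\<in>K. borel)"
    using D1 by (intro measurable_restrict M1.measurable_M) auto
  have m2: "(\<lambda>w. \<lambda>k\<in>K. s k * M2 (D2 k) w) \<in> measurable W2 (\<Pi>\<^sub>M k\<in>K. borel)"
    using D2 by (intro measurable_restrict borel_measurable_times borel_measurable_const M2.measurable_M) auto
  have "AE w in W1. \<forall>n\<in>J. X n w = (\<Sum>k\<in>K. c n k * M1 (D1 k) w)"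
  proof (intro AE_finite_allI J)
    fix n assume n: "n \<in> J"
    have "AE w in W1. simple_stable_integral m1 M1 (f n) w = (\<Sum>k\<in>K. c n k * M1 (D1 k) w)"
      by (rule M1.simple_integral_partition[OF K D1]) (use f n in auto)
    then show "AE w in W1. X n w = (\<Sum>k\<in>K. c n k * M1 (D1 k) w)" using X(2)[OF n] by eventually_elim simp
  qed
  then have "distr W1 (\<Pi>\<^sub>M n\<in>J. borel) (\<lambda>w. \<lambda>n\<in>J. X n w) =
    distr W1 (\<Pi>\<^sub>M n\<in>J. borel) (\<Psi> \<circ> (\<lambda>w. \<lambda>k\<in>K. M1 (D1 k) w))"
    using X(1) m1 by (intro distr_cong_AE refl measurable_restrict measurable_comp[OF m1 \<Psi>])
      (auto elim!: eventually_mono simp: \<Psi>_def fun_eq_iff)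
  also have "\<dots> = distr (distr W1 (\<Pi>\<^sub>M k\<in>K. borel) (\<lambda>w. \<lambda>k\<in>K. M1 (D1 k) w)) (\<Pi>\<^sub>M n\<in>J. borel) \<Psi>"
    by (rule distr_distr[OF \<Psi> m1, symmetric])
  also have "\<dots> = distr (distr W2 (\<Pi>\<^sub>M k\<in>K. borel) (\<lambda>w. \<lambda>k\<in>K. s k * M2 (D2 k) w)) (\<Pi>\<^sub>M n\<in>J. borel) \<Psi>"
    by (simp only: disjoint_values_same_law[OF M1 M2 K D1 D2 eq s])
  also have "\<dots> = distr W2 (\<Pi>\<^sub>M n\<in>J. borel) (\<Psi> \<circ> (\<lambda>w. \<lambda>k\<in>K. s k * M2 (D2 k) w))"
    by (rule distr_distr[OF \<Psi> m2])
  also have "\<dots> = distr W2 (\<Pi>\<^sub>M n\<in>J. borel) (\<lambda>w. \<lambda>n\<in>J. Y n w)"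
  proof -
    have "AE w in W2. \<forall>n\<in>J. Y n w = (\<Sum>k\<in>K. c n k * (s k * M2 (D2 k) w))"
    proof (intro AE_finite_allI J)
      fix n assume n: "n \<in> J"
      have "AE w in W2. simple_stable_integral m2 M2 (g n) w = (\<Sum>k\<in>K. (s k * c n k) * M2 (D2 k) w)"
        by (rule M2.simple_integral_partition[OF K D2]) (use g n in auto)
      then show "AE w in W2. Y n w = (\<Sum>k\<in>K. c n k * (s k * M2 (D2 k) w))"
        using Y(2)[OF n] by eventually_elim (simp add: mult_ac)
    qed
    then show ?thesis
      using Y(1) m2 by (intro distr_cong_AE refl measurable_restrict measurable_comp[OF m2 \<Psi>])
        (auto elim!: eventually_mono simp: \<Psi>_def fun_eq_iff)
  qed
  finally show ?thesis .
qed

section \<open>Measure preserving flows\<close>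

locale measure_preserving_flow = sigma_finite_measure m for m :: "'e measure" +
  fixes \<phi> :: "int \<Rightarrow> 'e \<Rightarrow> 'e"
  assumes measurable_flow [measurable]: "\<And>n. \<phi> n \<in> measurable m m"
    and flow_add: "\<And>n k x. x \<in> space m \<Longrightarrow> \<phi> (n + k) x = \<phi> n (\<phi> k x)"
    and flow_0: "\<And>x. x \<in> space m \<Longrightarrow> \<phi> 0 x = x"
    and preserves: "\<And>n. distr m m (\<phi> n) = m"
begin

lemma flow_space: "x \<in> space m \<Longrightarrow> \<phi> n x \<in> space m"
  using measurable_flow measurable_space by metis

lemma flow_inverse: "x \<in> space m \<Longrightarrow> \<phi> (- n) (\<phi> n x) = x" "x \<in> space m \<Longrightarrow> \<phi> n (\<phi> (- n) x) = x"
  using flow_add[of x "- n" n] flow_add[of x n "- n"] flow_0 by auto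

lemma flow_image: "B \<subseteq> space m \<Longrightarrow> \<phi> n ` B = \<phi> (- n) -` B \<inter> space m"
  using flow_inverse[of _ n] flow_space[of _ n] flow_space[of _ "- n"]
  by (auto simp: image_iff) (metis subsetD)+

lemma emeasure_preimage: "B \<in> sets m \<Longrightarrow> emeasure m (\<phi> n -` B \<inter> space m) = emeasure m B"
  using emeasure_distr[OF measurable_flow, of B n] preserves[of n] by simp

lemma nonsingular: "nonsingular_flow m \<phi>"
  unfolding nonsingular_flow_def
proof (intro conjI allI ballI)
  fix n show "\<phi> n ` space m = space m"
    using flow_image[of "space m" n] flow_space[of _ "- n"] by auto
qed (auto simp: preserves flow_add flow_0 absolutely_continuous_def intro: sigma_finite_measure_axioms)

lemma flow_kernel_trivial_cocycle:
  "AE x in m. flow_kernel \<alpha> m \<phi> (\<lambda>_ _. 1) f0 n x = f0 (\<phi> n x)"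
proof -
  have "AE x in m. (\<lambda>_. 1) x = RN_deriv m m x"
    by (intro RN_deriv_unique) (auto simp: density_1)
  then show ?thesis by eventually_elim (simp add: flow_kernel_def preserves)
qed

text \<open>The visits of a wandering set to a set \<open>R\<close> of finite measure happen at essentially disjoint
  places of \<open>R\<close>, so the expected number of visits is finite; under infinite recurrence to \<open>R\<close> the
  wandering set must be null.\<close>

lemma conservative_if_recurrent:
  assumes R [measurable]: "R \<in> sets m" and fin: "emeasure m R < \<infinity>"
    and rec: "AE x in m. infinite {n::nat. \<phi> (int n) x \<in> R}"
  shows "conservative_flow m \<phi>"
proof -
  have null: "B \<in> null_sets m" if "wandering m \<phi> B" for B
  proof -
    have B [measurable]: "B \<in> sets m"
      and disj: "\<And>i j. i \<noteq> j \<Longrightarrow> \<phi> i ` B \<inter> \<phi> j ` B \<in> null_sets m"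
      using that by (auto simp: wandering_def)
    have Bs: "B \<subseteq> space m" using B sets.sets_into_space by blast
    have img [measurable]: "\<phi> n ` B \<in> sets m" for n unfolding flow_image[OF Bs] by measurable
    have "AE x in m. \<forall>p::nat \<times> nat. fst p \<noteq> snd p \<longrightarrow> x \<notin> \<phi> (int (fst p)) ` B \<inter> \<phi> (int (snd p)) ` B"
      unfolding AE_all_countable
    proof
      fix p :: "nat \<times> nat"
      show "AE x in m. fst p \<noteq> snd p \<longrightarrow> x \<notin> \<phi> (int (fst p)) ` B \<inter> \<phi> (int (snd p)) ` B"
        using AE_not_in[OF disj[of "int (fst p)" "int (snd p)"]] by (cases "fst p = snd p") auto
    qed
    then have le: "AE x in m. (\<Sum>n. indicator (\<phi> (int n) ` B \<inter> R) x) \<le> (indicator R x :: ennreal)"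
    proof eventually_elim
      case (elim x)
      show ?case
      proof (cases "\<exists>n. x \<in> \<phi> (int n) ` B \<inter> R")
        case True
        then obtain n where n: "x \<in> \<phi> (int n) ` B \<inter> R" by blast
        have other: "x \<notin> \<phi> (int k) ` B" if "k \<noteq> n" for k
          using elim[rule_format, of "(k, n)"] that n by auto
        have "(\<Sum>k. indicator (\<phi> (int k) ` B \<inter> R) x :: ennreal) = (\<Sum>k\<in>{n}. indicator (\<phi> (int k) ` B \<inter> R) x)"
          using other by (intro suminf_finite) auto
        then show ?thesis using n by simp
      next
        case False
        then have "(\<lambda>n. indicator (\<phi> (int n) ` B \<inter> R) x :: ennreal) = (\<lambda>n. 0)"
          by (auto simp: fun_eq_iff split: split_indicator)
        then show ?thesis by simp
      qed
    qed
    have visit: "emeasure m (B \<inter> \<phi> (int n) -` R \<inter> space m) = emeasure m (\<phi> (int n) ` B \<inter> R)" for n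
    proof -
      have "\<phi> (int n) -` (\<phi> (int n) ` B \<inter> R) \<inter> space m = B \<inter> \<phi> (int n) -` R \<inter> space m"
        using Bs by (auto simp: flow_image[OF Bs] flow_inverse flow_space)
      then show ?thesis using emeasure_preimage[of "\<phi> (int n) ` B \<inter> R" "int n"] by simp
    qed
    have "(\<integral>\<^sup>+x. (\<Sum>n. indicator (B \<inter> \<phi> (int n) -` R \<inter> space m) x) \<partial>m) =
      (\<Sum>n. emeasure m (B \<inter> \<phi> (int n) -` R \<inter> space m))"
      by (subst nn_integral_suminf) auto
    also have "\<dots> = (\<integral>\<^sup>+x. (\<Sum>n. indicator (\<phi> (int n) ` B \<inter> R) x) \<partial>m)"
      unfolding visit by (subst nn_integral_suminf) auto
    also have "\<dots> \<le> (\<integral>\<^sup>+x. indicator R x \<partial>m)" by (rule nn_integral_mono_AE[OF le])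
    also have "\<dots> < \<infinity>" using fin by simp
    finally have "AE x in m. (\<Sum>n. indicator (B \<inter> \<phi> (int n) -` R \<inter> space m) x :: ennreal) \<noteq> \<infinity>"
      by (intro nn_integral_PInf_AE) auto
    then have "AE x in m. x \<notin> B"
      using rec
    proof (rule AE_mp[OF AE_conjI], intro AE_I2 impI notI)
      fix x assume fin_inf: "(\<Sum>n. indicator (B \<inter> \<phi> (int n) -` R \<inter> space m) x :: ennreal) \<noteq> \<infinity> \<and>
          infinite {n::nat. \<phi> (int n) x \<in> R}" and x: "x \<in> B"
      then have fin: "(\<Sum>n. indicator (B \<inter> \<phi> (int n) -` R \<inter> space m) x :: ennreal) \<noteq> \<infinity>"
        and inf: "infinite {n::nat. \<phi> (int n) x \<in> R}" by auto
      define S where "S = (\<Sum>n. indicator (B \<inter> \<phi> (int n) -` R \<inter> space m) x :: ennreal)"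
      have "of_nat N \<le> S" for N
      proof -
        obtain T where T: "T \<subseteq> {n::nat. \<phi> (int n) x \<in> R}" "finite T" "card T = N"
          using infinite_arbitrarily_large[OF inf] by blast
        have "(of_nat N :: ennreal) = (\<Sum>n\<in>T. indicator (B \<inter> \<phi> (int n) -` R \<inter> space m) x)"
          using T x subsetD[OF Bs x] by (subst sum.cong[OF refl, where h="\<lambda>_. 1"]) (auto simp: subset_iff)
        also have "\<dots> \<le> S" unfolding S_def using T by (intro sum_le_suminf) auto
        finally show ?thesis .
      qed
      then have "S = \<infinity>"
        by (metis ennreal_Ex_less_of_nat infinity_ennreal_def leD top.not_eq_extremum)
      then show False using fin by (simp add: S_def)
    qed
    then show ?thesis using B by (simp add: AE_iff_null_sets)
  qed
  have "flow_decomposition m (wandering m \<phi>) (space m) {}"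
    unfolding flow_decomposition_def measurable_union_def using null by auto
  then show ?thesis unfolding conservative_flow_def by (intro exI[of _ "space m"] exI[of _ "{}"]) simp
qed

text \<open>If the overlap of a set with its translates tends to 0, choose times whose gaps grow so fast
  that all overlaps together are small; removing them leaves a weakly wandering set.\<close>

lemma weakly_wandering_subset:
  assumes B [measurable]: "B \<in> sets m"
    and mixing: "(\<lambda>n::nat. emeasure m (B \<inter> \<phi> (int n) -` B \<inter> space m)) \<longlonglongrightarrow> 0" and "0 < \<epsilon>"
  obtains B' where "B' \<subseteq> B" "weakly_wandering m \<phi> B'" "emeasure m (B - B') \<le> ennreal \<epsilon>"
proof -
  let ?c = "\<lambda>n::nat. emeasure m (B \<inter> \<phi> (int n) -` B \<inter> space m)"
  \<comment> \<open>There are \<open>k\<close> overlaps with earlier times at stage \<open>k\<close>; together they get the share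
    \<open>\<epsilon> (1/2) ^ Suc k\<close>.\<close>
  define \<delta> where "\<delta> k = \<epsilon> * (1/2) ^ Suc k / real (Suc k)" for k
  have \<delta>: "0 < \<delta> k" for k using \<open>0 < \<epsilon>\<close> by (simp add: \<delta>_def)
  have "\<exists>N. \<forall>n\<ge>N. ?c n < ennreal (\<delta> k)" for k
    using order_tendstoD(2)[OF mixing, of "ennreal (\<delta> k)"] \<delta> by (auto simp: eventually_sequentially)
  then obtain N where N: "\<And>k n. N k \<le> n \<Longrightarrow> ?c n < ennreal (\<delta> k)" by metis
  \<comment> \<open>The last gap before \<open>s k\<close> already exceeds \<open>N k\<close>, hence so does every difference \<open>s k - s i\<close>.
    The summand 1 makes the times distinct.\<close>
  define s where "s k = (\<Sum>j<k. N (Suc j) + 1)" for k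
  have gap: "N k \<le> s k - s i \<and> s i < s k" if "i < k" for i k
  proof -
    obtain k' where k': "k = Suc k'" using \<open>i < k\<close> by (cases k) auto
    have "s i \<le> s k'" unfolding s_def using that k' by (intro sum_mono2) auto
    then show ?thesis by (simp add: k' s_def)
  qed
  define bad where "bad k = (\<Union>i<k. B \<inter> \<phi> (int (s k - s i)) -` B \<inter> space m)" for k
  have bad [measurable]: "bad k \<in> sets m" for k unfolding bad_def by measurable
  have bad_le: "emeasure m (bad k) \<le> ennreal (\<epsilon> * (1/2) ^ Suc k)" for k
  proof -
    have "emeasure m (bad k) \<le> (\<Sum>i<k. ?c (s k - s i))"
      unfolding bad_def by (intro emeasure_subadditive_finite) auto
    also have "\<dots> \<le> (\<Sum>i<k. ennreal (\<delta> k))"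
      using N gap by (intro sum_mono less_imp_le) auto
    also have "\<dots> = ennreal (real k * \<delta> k)"
      using \<delta>[of k] by (simp add: ennreal_mult'' ennreal_of_nat_eq_real_of_nat less_imp_le)
    also have "\<dots> \<le> ennreal (\<epsilon> * (1/2) ^ Suc k)"
    proof (rule ennreal_leI)
      have "real k * \<delta> k \<le> real (Suc k) * \<delta> k" using \<delta>[of k] by (intro mult_right_mono) auto
      also have "\<dots> = \<epsilon> * (1/2) ^ Suc k"
        unfolding \<delta>_def by (simp del: of_nat_Suc power_Suc)
      finally show "real k * \<delta> k \<le> \<epsilon> * (1/2) ^ Suc k" .
    qed
    finally show ?thesis .
  qed
  define B' where "B' = B - (\<Union>k. bad k)"
  have Bs: "B \<subseteq> space m" using B sets.sets_into_space by blast
  \<comment> \<open>If two translates of \<open>B'\<close> meet, the point over the later time has returned to \<open>B\<close> after the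
    difference of the times, so it was removed.\<close>
  have avoid: False if x: "x \<in> B'" and x': "x' \<in> B'" and eq: "\<phi> (int (s i)) x = \<phi> (int (s j)) x'"
    and ij: "j < i" for x x' i j
  proof -
    have sp: "x \<in> space m" "x' \<in> space m" using x x' Bs by (auto simp: B'_def)
    have "int (s i - s j) = - int (s j) + int (s i)" using gap[OF ij] by simp
    then have "\<phi> (int (s i - s j)) x = \<phi> (- int (s j)) (\<phi> (int (s i)) x)" using flow_add sp by metis
    also have "\<dots> = x'" unfolding eq using flow_inverse sp by simp
    finally have "x \<in> bad i" using x x' sp ij by (auto simp: bad_def B'_def)
    then show False using x by (auto simp: B'_def)
  qed
  have "weakly_wandering m \<phi> B'"
    unfolding weakly_wandering_def
  proof (intro conjI exI allI impI)
    show "inj (\<lambda>k. int (s k))"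
      using gap by (intro linorder_injI) (metis of_nat_eq_iff less_irrefl)
    show "int (s 0) = 0" by (simp add: s_def)
    fix i j :: nat assume "i \<noteq> j"
    have "\<phi> (int (s i)) ` B' \<inter> \<phi> (int (s j)) ` B' = {}"
    proof (intro equals0I, elim IntE imageE)
      fix y x x' assume x: "x \<in> B'" "x' \<in> B'" and y: "y = \<phi> (int (s i)) x" "y = \<phi> (int (s j)) x'"
      have eq: "\<phi> (int (s i)) x = \<phi> (int (s j)) x'" using y by simp
      consider "j < i" | "i < j" using \<open>i \<noteq> j\<close> by linarith
      then show False using avoid[OF x eq] avoid[OF x(2,1) eq[symmetric]] by cases
    qed
    then show "\<phi> (int (s i)) ` B' \<inter> \<phi> (int (s j)) ` B' \<in> null_sets m" by simp
  qed (simp add: B'_def)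
  moreover have "emeasure m (B - B') \<le> ennreal \<epsilon>"
  proof -
    have "emeasure m (B - B') \<le> emeasure m (\<Union>k. bad k)"
      by (intro emeasure_mono) (auto simp: B'_def)
    also have "\<dots> \<le> (\<Sum>k. emeasure m (bad k))"
      by (intro emeasure_subadditive_countably) auto
    also have "\<dots> \<le> (\<Sum>k. ennreal (\<epsilon> * (1/2) ^ Suc k))"
      by (intro suminf_le bad_le) auto
    also have "\<dots> = ennreal \<epsilon>"
      using sums_mult[OF power_half_series, of \<epsilon>] \<open>0 < \<epsilon>\<close> by (intro suminf_ennreal_eq) auto
    finally show ?thesis .
  qed
  ultimately show ?thesis using that[of B'] by (auto simp: B'_def)
qed

text \<open>The space is covered, up to null sets, by the weakly wandering subsets that exhaust each \<open>B k\<close>.\<close>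

lemma null_if_mixing:
  fixes B :: "nat \<Rightarrow> 'e set"
  assumes B [measurable]: "\<And>k. B k \<in> sets m" and cover: "(\<Union>k. B k) = space m"
    and mixing: "\<And>k. (\<lambda>n::nat. emeasure m (B k \<inter> \<phi> (int n) -` B k \<inter> space m)) \<longlonglongrightarrow> 0"
  shows "null_flow m \<phi>"
proof -
  have "space m - U \<in> null_sets m"
    if U [measurable]: "U \<in> sets m" and all: "\<And>B. weakly_wandering m \<phi> B \<Longrightarrow> B - U \<in> null_sets m" for U
  proof -
    have le: "emeasure m (B k - U) \<le> 0 + ennreal \<epsilon>" if "0 < \<epsilon>" for \<epsilon> k
    proof -
      obtain B' where B': "B' \<subseteq> B k" "weakly_wandering m \<phi> B'" "emeasure m (B k - B') \<le> ennreal \<epsilon>"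
        using weakly_wandering_subset[OF B mixing \<open>0 < \<epsilon>\<close>] .
      have [measurable]: "B' \<in> sets m" using B' by (simp add: weakly_wandering_def)
      have "emeasure m (B k - U) \<le> emeasure m ((B' - U) \<union> (B k - B'))"
        by (intro emeasure_mono) auto
      also have "\<dots> \<le> emeasure m (B' - U) + emeasure m (B k - B')"
        by (intro emeasure_subadditive) auto
      also have "\<dots> \<le> 0 + ennreal \<epsilon>" using all[OF B'(2)] B'(3) by (auto simp: null_sets_def)
      finally show ?thesis .
    qed
    have "emeasure m (B k - U) \<le> 0" for k by (rule ennreal_le_epsilon) (rule le)
    then have "B k - U \<in> null_sets m" for k by (simp add: null_sets_def)
    then have "(\<Union>k. B k - U) \<in> null_sets m" by (rule null_sets_UN)
    moreover have "(\<Union>k. B k - U) = space m - U" using cover by auto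
    ultimately show ?thesis by simp
  qed
  moreover have "B - space m \<in> null_sets m" if "weakly_wandering m \<phi> B" for B
  proof -
    have "B - space m = {}"
      using that sets.sets_into_space[of B m] by (auto simp: weakly_wandering_def)
    then show ?thesis by (simp only: null_sets.empty_sets)
  qed
  ultimately have "flow_decomposition m (weakly_wandering m \<phi>) {} (space m)"
    unfolding flow_decomposition_def measurable_union_def by auto
  then show ?thesis unfolding null_flow_def by (intro exI[of _ "{}"] exI[of _ "space m"]) simp
qed

end

section \<open>The shift on translated paths\<close>

lemma process_law_eqI:
  fixes X :: "'i \<Rightarrow> 'w \<Rightarrow> real" and Y :: "'i \<Rightarrow> 'v \<Rightarrow> real"
  assumes W: "prob_space W" and X: "\<And>i. X i \<in> borel_measurable W" and Y: "\<And>i. Y i \<in> borel_measurable V"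
    and eq: "\<And>J. finite J \<Longrightarrow> distr W (\<Pi>\<^sub>M j\<in>J. borel) (\<lambda>w. \<lambda>j\<in>J. X j w) =
      distr V (\<Pi>\<^sub>M j\<in>J. borel) (\<lambda>v. \<lambda>j\<in>J. Y j v)"
  shows "distr W (\<Pi>\<^sub>M i\<in>UNIV. borel) (\<lambda>w i. X i w) = distr V (\<Pi>\<^sub>M i\<in>UNIV. borel) (\<lambda>v i. Y i v)"
proof (rule measure_eqI_PiM_infinite)
  have mX: "(\<lambda>w i. X i w) \<in> measurable W (\<Pi>\<^sub>M i\<in>UNIV. borel)"
    by (rule measurable_PiM_single') (auto simp: X space_PiM)
  have mY: "(\<lambda>w i. Y i w) \<in> measurable V (\<Pi>\<^sub>M i\<in>UNIV. borel)"
    by (rule measurable_PiM_single') (auto simp: Y space_PiM)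
  show "finite_measure (distr W (\<Pi>\<^sub>M i\<in>UNIV. borel) (\<lambda>w i. X i w))"
    using prob_space.prob_space_distr[OF W mX] by (simp add: prob_space_def)
  fix A :: "'i \<Rightarrow> real set" and J :: "'i set"
  assume J: "finite J" and A: "\<And>i. i \<in> J \<Longrightarrow> A i \<in> sets borel"
  have r: "(\<lambda>p. restrict p J) \<in> measurable (\<Pi>\<^sub>M i\<in>UNIV. borel) (\<Pi>\<^sub>M j\<in>J. (borel :: real measure))"
    by (intro measurable_restrict_subset) simp
  have box: "Pi\<^sub>E J A \<in> sets (\<Pi>\<^sub>M j\<in>J. borel)" using J A by (intro sets_PiM_I_finite) auto
  have *: "emeasure N (prod_emb UNIV (\<lambda>_. borel) J (Pi\<^sub>E J A)) =
      emeasure (distr N (\<Pi>\<^sub>M j\<in>J. borel) (\<lambda>p. restrict p J)) (Pi\<^sub>E J A)"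
    if N: "sets N = sets (\<Pi>\<^sub>M i\<in>UNIV. (borel :: real measure))" for N :: "('i \<Rightarrow> real) measure"
  proof -
    have "(\<lambda>p. restrict p J) \<in> measurable N (\<Pi>\<^sub>M j\<in>J. (borel :: real measure))"
      using r N by (simp cong: measurable_cong_sets)
    moreover have "space N = UNIV" using sets_eq_imp_space_eq[OF N] by (simp add: space_PiM)
    ultimately show ?thesis using box
      by (subst emeasure_distr) (auto simp: prod_emb_def space_PiM)
  qed
  show "emeasure (distr W (\<Pi>\<^sub>M i\<in>UNIV. borel) (\<lambda>w i. X i w)) (prod_emb UNIV (\<lambda>_. borel) J (Pi\<^sub>E J A)) =
    emeasure (distr V (\<Pi>\<^sub>M i\<in>UNIV. borel) (\<lambda>w i. Y i w)) (prod_emb UNIV (\<lambda>_. borel) J (Pi\<^sub>E J A))"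
    by (subst (1 2) *) (simp_all add: distr_distr[OF r mX] distr_distr[OF r mY] o_def eq[OF J])
qed auto

text \<open>Integrating over the whole line removes a random origin: Lebesgue measure is invariant under
  the translation by \<open>u w\<close>, for every \<open>w\<close>. Hence only the law of the increments matters.\<close>

lemma translated_law_cong:
  fixes p :: "'i \<Rightarrow> 'w \<Rightarrow> real" and q :: "'i \<Rightarrow> 'w \<Rightarrow> real"
  assumes W: "prob_space W"
    and p: "\<And>i. i \<in> I \<Longrightarrow> p i \<in> borel_measurable W" and q: "\<And>i. i \<in> I \<Longrightarrow> q i \<in> borel_measurable W"
    and u: "u \<in> borel_measurable W" and v: "v \<in> borel_measurable W"
    and eq: "distr W (\<Pi>\<^sub>M i\<in>I. borel) (\<lambda>w. \<lambda>i\<in>I. p i w - u w) =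
      distr W (\<Pi>\<^sub>M i\<in>I. borel) (\<lambda>w. \<lambda>i\<in>I. q i w - v w)"
  shows "distr (W \<Otimes>\<^sub>M lborel) (\<Pi>\<^sub>M i\<in>I. borel) (\<lambda>(w, x). \<lambda>i\<in>I. x - p i w) =
    distr (W \<Otimes>\<^sub>M lborel) (\<Pi>\<^sub>M i\<in>I. borel) (\<lambda>(w, x). \<lambda>i\<in>I. x - q i w)"
proof (rule measure_eqI)
  interpret W: prob_space W by fact
  fix B assume "B \<in> sets (distr (W \<Otimes>\<^sub>M lborel) (\<Pi>\<^sub>M i\<in>I. borel) (\<lambda>(w, x). \<lambda>i\<in>I. x - p i w))"
  then have B [measurable]: "B \<in> sets (\<Pi>\<^sub>M i\<in>I. borel)" by simp
  have "emeasure (distr (W \<Otimes>\<^sub>M lborel) (\<Pi>\<^sub>M i\<in>I. borel) (\<lambda>(w, x). \<lambda>i\<in>I. x - p i w)) B =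
    (\<integral>\<^sup>+ s. (\<integral>\<^sup>+ x. indicator B (\<lambda>i\<in>I. x - s i) \<partial>lborel) \<partial>distr W (\<Pi>\<^sub>M i\<in>I. borel) (\<lambda>w. \<lambda>i\<in>I. p i w - u w))"
    if p: "\<And>i. i \<in> I \<Longrightarrow> p i \<in> borel_measurable W" and u [measurable]: "u \<in> borel_measurable W"
    for p :: "'i \<Rightarrow> 'w \<Rightarrow> real" and u
  proof -
    have p' [measurable]: "(\<lambda>(w, x). \<lambda>i\<in>I. x - p i w) \<in> measurable (W \<Otimes>\<^sub>M lborel) (\<Pi>\<^sub>M i\<in>I. borel)"
      unfolding split_beta
      by (intro measurable_restrict borel_measurable_diff measurable_compose[OF measurable_fst p])
        measurable
    have pu [measurable]: "(\<lambda>w. \<lambda>i\<in>I. p i w - u w) \<in> measurable W (\<Pi>\<^sub>M i\<in>I. borel)"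
      by (intro measurable_restrict borel_measurable_diff p u)
    have sub: "(\<lambda>(s, x). \<lambda>i\<in>I. x - s i) \<in> measurable ((\<Pi>\<^sub>M i\<in>I. borel) \<Otimes>\<^sub>M lborel) (\<Pi>\<^sub>M i\<in>I. (borel::real measure))"
      unfolding split_beta
      by (intro measurable_restrict borel_measurable_diff
          measurable_compose[OF measurable_fst measurable_component_singleton]) measurable
    have ind: "(\<lambda>s. \<integral>\<^sup>+ x. indicator B (\<lambda>i\<in>I. x - s i) \<partial>lborel) \<in> borel_measurable (\<Pi>\<^sub>M i\<in>I. (borel::real measure))"
      using measurable_compose[OF sub borel_measurable_indicator[OF B]]
      by (intro lborel.borel_measurable_nn_integral) (simp add: split_beta')
    have "emeasure (distr (W \<Otimes>\<^sub>M lborel) (\<Pi>\<^sub>M i\<in>I. borel) (\<lambda>(w, x). \<lambda>i\<in>I. x - p i w)) B =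
      (\<integral>\<^sup>+ z. indicator B (case z of (w, x) \<Rightarrow> \<lambda>i\<in>I. x - p i w) \<partial>(W \<Otimes>\<^sub>M lborel))"
      by (subst nn_integral_distr[OF p', symmetric]) auto
    also have "\<dots> = (\<integral>\<^sup>+ w. (\<integral>\<^sup>+ x. indicator B (\<lambda>i\<in>I. x - p i w) \<partial>lborel) \<partial>W)"
      by (subst lborel.nn_integral_fst[symmetric]) auto
    also have "\<dots> = (\<integral>\<^sup>+ w. (\<integral>\<^sup>+ x. indicator B (\<lambda>i\<in>I. x - (p i w - u w)) \<partial>lborel) \<partial>W)"
    proof (rule nn_integral_cong)
      fix w assume w: "w \<in> space W"
      have m: "(\<lambda>x. indicator B (\<lambda>i\<in>I. x - p i w) :: ennreal) \<in> borel_measurable borel"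
      proof -
        have "(\<lambda>x. \<lambda>i\<in>I. x - p i w) \<in> measurable borel (\<Pi>\<^sub>M i\<in>I. borel)"
          by (intro measurable_restrict) measurable
        then show ?thesis by measurable
      qed
      show "(\<integral>\<^sup>+ x. indicator B (\<lambda>i\<in>I. x - p i w) \<partial>lborel) =
        (\<integral>\<^sup>+ x. indicator B (\<lambda>i\<in>I. x - (p i w - u w)) \<partial>lborel)"
        by (subst nn_integral_real_affine[OF m, of 1 "u w"]) (simp_all add: algebra_simps)
    qed
    also have "\<dots> = (\<integral>\<^sup>+ w. (\<integral>\<^sup>+ x. indicator B (\<lambda>i\<in>I. x - (\<lambda>i\<in>I. p i w - u w) i) \<partial>lborel) \<partial>W)"
      by (simp cong: restrict_cong)
    also have "\<dots> = (\<integral>\<^sup>+ s. (\<integral>\<^sup>+ x. indicator B (\<lambda>i\<in>I. x - s i) \<partial>lborel) \<partial>distr W (\<Pi>\<^sub>M i\<in>I. borel) (\<lambda>w. \<lambda>i\<in>I. p i w - u w))"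
      using ind by (subst nn_integral_distr[OF pu]) auto
    finally show ?thesis .
  qed
  from this[OF p u] this[OF q v] eq
  show "emeasure (distr (W \<Otimes>\<^sub>M lborel) (\<Pi>\<^sub>M i\<in>I. borel) (\<lambda>(w, x). \<lambda>i\<in>I. x - p i w)) B =
    emeasure (distr (W \<Otimes>\<^sub>M lborel) (\<Pi>\<^sub>M i\<in>I. borel) (\<lambda>(w, x). \<lambda>i\<in>I. x - q i w)) B" by simp
qed simp

type_synonym path = "(int \<Rightarrow> real) \<times> real"

abbreviation path_algebra :: "path measure" where
  "path_algebra \<equiv> (\<Pi>\<^sub>M i\<in>UNIV. borel) \<Otimes>\<^sub>M borel"

text \<open>The second coordinate is constantly 0 under the measures considered below; the flow keeps it.\<close>

definition shift_flow :: "int \<Rightarrow> path \<Rightarrow> path" where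
  "shift_flow n z = (\<lambda>k. fst z (k + n), snd z)"

text \<open>For \<open>p = (\<lambda>t. x - A t)\<close> this is \<open>1 {x \<le> A (n + 1)} - 1 {x \<le> A n}\<close>, which is the integrand of the noise up
  to a sign.\<close>

definition level_crossing :: "(int \<Rightarrow> real) \<Rightarrow> int \<Rightarrow> real" where
  "level_crossing p n = of_bool (p (n + 1) \<le> 0) - of_bool (p n \<le> 0)"

lemma space_path_algebra [simp]: "space path_algebra = UNIV"
  by (simp add: space_pair_measure space_PiM)

lemma measurable_path_coordinate [measurable]: "(\<lambda>z. fst z (k::int)) \<in> borel_measurable path_algebra"
  using measurable_compose[OF measurable_fst measurable_component_singleton[of k UNIV "\<lambda>_. borel"]] by simp

lemma measurable_shift_flow [measurable]: "shift_flow n \<in> measurable path_algebra path_algebra"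
proof -
  have "(\<lambda>z k. fst z (k + n)) \<in> measurable path_algebra (\<Pi>\<^sub>M i\<in>(UNIV::int set). borel)"
    by (rule measurable_PiM_single') (auto simp: space_PiM)
  then show ?thesis unfolding shift_flow_def by measurable
qed

lemma measurable_level_crossing [measurable]: "(\<lambda>z. level_crossing (fst z) n) \<in> borel_measurable path_algebra"
  unfolding level_crossing_def by measurable

lemma level_crossing_shift: "level_crossing (fst (shift_flow n z)) k = level_crossing (fst z) (k + n)"
  by (simp add: level_crossing_def shift_flow_def add_ac)

lemma level_crossing_values: "level_crossing p n \<in> {-1, 0, 1}"
  by (simp add: level_crossing_def of_bool_def)

lemma level_crossing_powr: "\<bar>level_crossing p n\<bar> powr \<alpha> = indicator {p. level_crossing p n \<noteq> 0} p"
  by (simp add: level_crossing_def of_bool_def indicator_def)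

locale stationary_increment_path = prob_space W for W :: "'w measure" +
  fixes a :: "int \<Rightarrow> 'w \<Rightarrow> real"
  assumes measurable_path [measurable]: "\<And>k. a k \<in> borel_measurable W"
    and increments: "\<And>n. distr W (\<Pi>\<^sub>M i\<in>UNIV. borel) (\<lambda>w i. a (i + n) w - a n w) =
      distr W (\<Pi>\<^sub>M i\<in>UNIV. borel) (\<lambda>w i. a i w - a 0 w)"
begin

definition translate :: "'w \<times> real \<Rightarrow> path" where
  "translate z = (\<lambda>k. snd z - a k (fst z), 0)"

text \<open>The law of \<open>x - a\<close> when the path \<open>a\<close> is random and the level \<open>x\<close> is distributed by Lebesgue measure. It
  is infinite, and in these coordinates the flow is simply the shift.\<close>

definition path_measure :: "path measure" where
  "path_measure = distr (W \<Otimes>\<^sub>M lborel) path_algebra translate"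

lemma sets_path_measure [simp, measurable_cong]: "sets path_measure = sets path_algebra"
  by (simp add: path_measure_def)

lemma space_path_measure [simp]: "space path_measure = UNIV"
  by (simp add: path_measure_def)

lemma measurable_translate [measurable]: "translate \<in> measurable (W \<Otimes>\<^sub>M lborel) path_algebra"
proof -
  have "(\<lambda>z k. snd z - a k (fst z)) \<in> measurable (W \<Otimes>\<^sub>M lborel) (\<Pi>\<^sub>M i\<in>(UNIV::int set). borel)"
    by (rule measurable_PiM_single') (auto simp: space_PiM)
  then show ?thesis unfolding translate_def by measurable
qed

lemma emeasure_path_measure:
  assumes B: "B \<in> sets path_algebra"
  shows "emeasure path_measure B = (\<integral>\<^sup>+ w. emeasure lborel {x. translate (w, x) \<in> B} \<partial>W)"
proof -
  have "emeasure path_measure B = emeasure (W \<Otimes>\<^sub>M lborel) (translate -` B \<inter> space (W \<Otimes>\<^sub>M lborel))"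
    unfolding path_measure_def using B by (intro emeasure_distr) auto
  also have "\<dots> = (\<integral>\<^sup>+ w. emeasure lborel (Pair w -` (translate -` B \<inter> space (W \<Otimes>\<^sub>M lborel))) \<partial>W)"
    using B by (intro lborel.emeasure_pair_measure_alt measurable_sets[OF measurable_translate])
  also have "\<dots> = (\<integral>\<^sup>+ w. emeasure lborel {x. translate (w, x) \<in> B} \<partial>W)"
    by (intro nn_integral_cong arg_cong[where f="emeasure lborel"]) (auto simp: space_pair_measure)
  finally show ?thesis .
qed

definition slab :: "nat \<Rightarrow> path set" where
  "slab K = {z. \<bar>fst z 0\<bar> \<le> real K}"

lemma slab_sets [measurable]: "slab K \<in> sets path_algebra"
proof -
  have "{z \<in> space path_algebra. \<bar>fst z 0\<bar> \<le> real K} \<in> sets path_algebra" by measurable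
  then show ?thesis by (simp add: slab_def)
qed

lemma emeasure_slab: "emeasure path_measure (slab K) = ennreal (2 * real K)"
proof -
  have "{x. translate (w, x) \<in> slab K} = {a 0 w - real K .. a 0 w + real K}" for w
    by (auto simp: translate_def slab_def)
  then show ?thesis by (simp add: emeasure_path_measure emeasure_space_1)
qed

lemma UN_slab: "(\<Union>K. slab K) = UNIV"
  by (auto simp: slab_def intro: real_arch_simple)

text \<open>Shifting a path with stationary increments changes its law only by a random translation, which
  Lebesgue measure absorbs.\<close>

lemma shift_preserves: "distr path_measure path_measure (shift_flow n) = path_measure"
proof -
  have m: "(\<lambda>(w, x). \<lambda>i\<in>UNIV. x - a (i + k) w) \<in> measurable (W \<Otimes>\<^sub>M lborel) (\<Pi>\<^sub>M i\<in>(UNIV::int set). borel)" for k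
    unfolding split_beta by (intro measurable_restrict) measurable
  have emb: "(\<lambda>y. (y, 0)) \<in> measurable (\<Pi>\<^sub>M i\<in>(UNIV::int set). borel) path_algebra" by measurable
  have image: "distr (W \<Otimes>\<^sub>M lborel) path_algebra (shift_flow k \<circ> translate) =
    distr (distr (W \<Otimes>\<^sub>M lborel) (\<Pi>\<^sub>M i\<in>UNIV. borel) (\<lambda>(w, x). \<lambda>i\<in>UNIV. x - a (i + k) w)) path_algebra (\<lambda>y. (y, 0))" for k
    by (subst distr_distr[OF emb m]) (auto intro!: distr_cong simp: shift_flow_def translate_def fun_eq_iff)
  have "distr path_measure path_measure (shift_flow n) = distr path_measure path_algebra (shift_flow n)"
    by (intro distr_cong) auto
  also have "\<dots> = distr (W \<Otimes>\<^sub>M lborel) path_algebra (shift_flow n \<circ> translate)"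
    unfolding path_measure_def by (intro distr_distr) auto
  also have "\<dots> = distr (W \<Otimes>\<^sub>M lborel) path_algebra (shift_flow 0 \<circ> translate)"
    unfolding image
    by (subst translated_law_cong[where p="\<lambda>i. a (i + n)" and q="\<lambda>i. a (i + 0)" and u="a n" and v="a 0"])
      (use increments[of n] prob_space_axioms in \<open>auto simp: restrict_def\<close>)
  also have "\<dots> = path_measure"
    unfolding path_measure_def by (intro distr_cong) (auto simp: shift_flow_def)
  finally show ?thesis .
qed

sublocale flow: measure_preserving_flow path_measure shift_flow
proof (rule measure_preserving_flow.intro)
  show "sigma_finite_measure path_measure"
  proof (intro sigma_finite_measure.intro exI[of _ "range slab"] conjI ballI)
    show "\<Union> (range slab) = space path_measure" using UN_slab by simp
  qed (auto simp: emeasure_slab)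
  show "measure_preserving_flow_axioms path_measure shift_flow"
  proof
    show "shift_flow n \<in> measurable path_measure path_measure" for n by measurable
    show "distr path_measure path_measure (shift_flow n) = path_measure" for n by (rule shift_preserves)
  qed (simp_all add: shift_flow_def add_ac)
qed

text \<open>A translated path visits the slab at both times 0 and n only if its increment is bounded.\<close>

lemma null_if_increments_diverge:
  assumes "\<And>K::real. (\<lambda>n::nat. measure W {w \<in> space W. \<bar>a (int n) w - a 0 w\<bar> \<le> K}) \<longlonglongrightarrow> 0"
  shows "null_flow path_measure shift_flow"
proof (rule flow.null_if_mixing)
  fix K
  let ?C = "\<lambda>n::nat. slab K \<inter> shift_flow (int n) -` slab K \<inter> space path_measure"
  let ?P = "\<lambda>n::nat. measure W {w \<in> space W. \<bar>a (int n) w - a 0 w\<bar> \<le> 2 * real K}"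
  have le: "emeasure path_measure (?C n) \<le> ennreal (2 * real K * ?P n)" for n
  proof -
    have C: "?C n \<in> sets path_algebra" using measurable_sets[OF measurable_shift_flow slab_sets] by auto
    have "emeasure path_measure (?C n) = (\<integral>\<^sup>+ w. emeasure lborel {x. translate (w, x) \<in> ?C n} \<partial>W)"
      by (rule emeasure_path_measure[OF C])
    also have "\<dots> \<le> (\<integral>\<^sup>+ w. ennreal (2 * real K) * indicator {w \<in> space W. \<bar>a (int n) w - a 0 w\<bar> \<le> 2 * real K} w \<partial>W)"
    proof (rule nn_integral_mono)
      fix w assume w: "w \<in> space W"
      show "emeasure lborel {x. translate (w, x) \<in> ?C n} \<le>
        ennreal (2 * real K) * indicator {w \<in> space W. \<bar>a (int n) w - a 0 w\<bar> \<le> 2 * real K} w"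
      proof (cases "\<bar>a (int n) w - a 0 w\<bar> \<le> 2 * real K")
        case True
        have "emeasure lborel {x. translate (w, x) \<in> ?C n} \<le> emeasure lborel {a 0 w - real K .. a 0 w + real K}"
          by (intro emeasure_mono) (auto simp: translate_def slab_def)
        then show ?thesis using True w by simp
      next
        case False
        then have empty: "{x. translate (w, x) \<in> ?C n} = {}" by (auto simp: translate_def slab_def shift_flow_def)
        show ?thesis unfolding empty by simp
      qed
    qed
    also have "\<dots> = ennreal (2 * real K) * emeasure W {w \<in> space W. \<bar>a (int n) w - a 0 w\<bar> \<le> 2 * real K}"
      by (intro nn_integral_cmult_indicator) measurable
    also have "\<dots> = ennreal (2 * real K * ?P n)"
      by (simp add: emeasure_eq_measure ennreal_mult)
    finally show ?thesis .
  qed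
  have "(\<lambda>n. ennreal (2 * real K * ?P n)) \<longlonglongrightarrow> ennreal (2 * real K * 0)"
    by (intro tendsto_ennrealI tendsto_mult tendsto_const assms)
  then have lim: "(\<lambda>n. ennreal (2 * real K * ?P n)) \<longlonglongrightarrow> 0" by (simp only: mult_zero_right ennreal_0)
  show "(\<lambda>n. emeasure path_measure (?C n)) \<longlonglongrightarrow> 0"
    by (rule tendsto_sandwich[OF _ _ tendsto_const lim]) (intro always_eventually allI zero_le le)+
qed (use UN_slab in auto)

lemma unbounded_beyond:
  fixes b :: "nat \<Rightarrow> real"
  assumes "\<And>K::nat. \<exists>n. real K < b n"
  shows "\<exists>n\<ge>N. c < b n"
proof -
  obtain K :: nat where "max c (Max (insert 0 (b ` {..<N}))) \<le> real K" using real_arch_simple by blast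
  then have K: "c \<le> real K" "Max (insert 0 (b ` {..<N})) \<le> real K" by (simp_all only: max.bounded_iff)
  obtain n where n: "real K < b n" using assms by blast
  have "N \<le> n"
  proof (rule ccontr)
    assume "\<not> N \<le> n"
    then have "b n \<le> Max (insert 0 (b ` {..<N}))" by (intro Max_ge) auto
    then show False using n K(2) by linarith
  qed
  then show ?thesis using n K by (intro exI[of _ n]) auto
qed

text \<open>Without further crossings of the level \<open>x\<close> the sequence would stay on one side of it.\<close>

lemma oscillation_crosses_infinitely_often:
  fixes b :: "nat \<Rightarrow> real"
  assumes up: "\<And>K::nat. \<exists>n. real K < b n" and down: "\<And>K::nat. \<exists>n. b n < - real K"
  shows "infinite {n. (x \<le> b (Suc n)) \<noteq> (x \<le> b n)}"
proof
  assume "finite {n. (x \<le> b (Suc n)) \<noteq> (x \<le> b n)}"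
  then obtain M where M: "\<forall>n\<in>{n. (x \<le> b (Suc n)) \<noteq> (x \<le> b n)}. n \<le> M"
    unfolding finite_nat_set_iff_bounded_le by blast
  define N where "N = Suc M"
  have N: "(x \<le> b (Suc n)) = (x \<le> b n)" if "N \<le> n" for n
    using M[rule_format, of n] that by (auto simp: N_def)
  have const: "(x \<le> b n) = (x \<le> b N)" if "N \<le> n" for n
    using that by (induction rule: dec_induct) (auto simp: N)
  obtain n where n: "N \<le> n" "x < b n" using unbounded_beyond[of b, OF up] by blast
  have "\<exists>n. real K < - b n" for K using down[of K] less_minus_iff by metis
  then have "\<exists>n\<ge>N. - x < - b n" by (rule unbounded_beyond)
  then obtain n' where n': "N \<le> n'" "b n' < x" by auto
  show False using const[OF n(1)] const[OF n'(1)] n n' by auto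
qed

lemma AE_crossings_infinite:
  assumes osc: "AE w in W. (\<forall>K::nat. \<exists>n::nat. real K < a (int n) w) \<and> (\<forall>K::nat. \<exists>n::nat. a (int n) w < - real K)"
  shows "AE z in path_measure. infinite {n::nat. level_crossing (fst z) (int n) \<noteq> 0}"
proof -
  let ?Q = "\<lambda>z. infinite {n::nat. level_crossing (fst z) (int n) \<noteq> 0}"
  have Q: "{z \<in> space path_algebra. ?Q z} \<in> sets path_algebra"
    unfolding infinite_nat_iff_unbounded_le mem_Collect_eq by measurable
  interpret P: pair_sigma_finite W lborel ..
  have "AE z in W \<Otimes>\<^sub>M lborel. ?Q (translate z)"
  proof (rule P.AE_pair_measure)
    have "{z \<in> space (W \<Otimes>\<^sub>M lborel). ?Q (translate z)} = translate -` {z \<in> space path_algebra. ?Q z} \<inter> space (W \<Otimes>\<^sub>M lborel)"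
      by auto
    then show "{z \<in> space (W \<Otimes>\<^sub>M lborel). ?Q (translate z)} \<in> sets (W \<Otimes>\<^sub>M lborel)"
      using measurable_sets[OF measurable_translate Q] by simp
    show "AE w in W. AE x in lborel. ?Q (translate (w, x))"
      using osc
    proof eventually_elim
      case (elim w)
      have "level_crossing (fst (translate (w, x))) (int n) \<noteq> 0 \<longleftrightarrow>
        (x \<le> a (int (Suc n)) w) \<noteq> (x \<le> a (int n) w)" for n x
        by (simp add: level_crossing_def translate_def add.commute of_bool_def)
      then have "?Q (translate (w, x))" for x
        using oscillation_crosses_infinitely_often[of "\<lambda>n. a (int n) w" x] elim by simp
      then show ?case by simp
    qed
  qed
  then show ?thesis
    unfolding path_measure_def using Q by (subst AE_distr_iff) auto
qed

end

section \<open>Self-similar stable processes with stationary increments\<close>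

lemma same_fdds_marginal:
  assumes eq: "same_fdds T W X V Y" and t: "t \<in> T"
    and X: "X t \<in> borel_measurable W" and Y: "Y t \<in> borel_measurable V"
  shows "distr W borel (X t) = distr V borel (Y t)"
proof -
  have coord: "(\<lambda>p. p t) \<in> borel_measurable (\<Pi>\<^sub>M j\<in>{t}. (borel :: real measure))"
    by (rule measurable_component_singleton) simp
  have mX: "(\<lambda>w. \<lambda>j\<in>{t}. X j w) \<in> measurable W (\<Pi>\<^sub>M j\<in>{t}. borel)"
    using X by (intro measurable_restrict) auto
  have mY: "(\<lambda>w. \<lambda>j\<in>{t}. Y j w) \<in> measurable V (\<Pi>\<^sub>M j\<in>{t}. borel)"
    using Y by (intro measurable_restrict) auto
  have "distr (distr W (\<Pi>\<^sub>M j\<in>{t}. borel) (\<lambda>w. \<lambda>j\<in>{t}. X j w)) borel (\<lambda>p. p t) =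
    distr (distr V (\<Pi>\<^sub>M j\<in>{t}. borel) (\<lambda>w. \<lambda>j\<in>{t}. Y j w)) borel (\<lambda>p. p t)"
    using eq t by (simp add: same_fdds_def)
  then show ?thesis
    by (simp add: distr_distr[OF coord mX] distr_distr[OF coord mY] o_def)
qed

locale self_similar_stable = prob_space W for W :: "'w measure" +
  fixes A :: "real \<Rightarrow> 'w \<Rightarrow> real" and \<beta> H :: real
  assumes \<beta>: "0 < \<beta>" and H: "0 < H"
    and stable: "SaS_process \<beta> {0..} W A"
    and stationary: "stationary_increments W A"
    and similar: "self_similar H W A"
    and oscillates: "AE w in W. limsup (\<lambda>n::nat. ereal (A (real n) w)) = \<infinity> \<and>
      liminf (\<lambda>n::nat. ereal (A (real n) w)) = - \<infinity>"
begin

lemma measurable_A: "0 \<le> t \<Longrightarrow> A t \<in> borel_measurable W"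
  using stable by (simp add: SaS_process_def random_process_def)

lemma marginal_law: assumes "0 \<le> t" obtains \<sigma> where "has_SaS_law \<beta> \<sigma> W (A t)"
proof -
  have "\<forall>J c. finite J \<and> J \<subseteq> {0..} \<longrightarrow> (\<exists>\<sigma>. has_SaS_law \<beta> \<sigma> W (\<lambda>w. \<Sum>j\<in>J. c j * A j w))"
    using stable by (simp add: SaS_process_def)
  from this[rule_format, of "{t}" "\<lambda>_. 1"] show ?thesis using assms that by auto
qed

lemma scaling: "0 < c \<Longrightarrow> 0 \<le> t \<Longrightarrow> distr W borel (A (c * t)) = distr W borel (\<lambda>w. (c powr H) * A t w)"
  using similar measurable_A by (intro same_fdds_marginal[where T="{0..}"]) (auto simp: self_similar_def)

text \<open>The scale \<open>\<sigma>\<close> of \<open>A 0\<close> satisfies \<open>\<sigma> = 2 powr H * \<sigma>\<close>.\<close>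

lemma A_0: "AE w in W. A 0 w = 0"
proof -
  obtain \<sigma> where \<sigma>: "has_SaS_law \<beta> \<sigma> W (A 0)" using marginal_law[of 0] by auto
  have "char (distr W borel (A 0)) 1 = char (distr W borel (\<lambda>w. (2 powr H) * A 0 w)) 1"
    using scaling[of 2 0] by simp
  then have "complex_of_real (exp (- (\<sigma> powr \<beta>))) = complex_of_real (exp (- ((2 powr H) powr \<beta> * \<sigma> powr \<beta>)))"
    using \<sigma> SaS_law_char_scale[OF prob_space_axioms \<sigma>, of "2 powr H" 1] by (simp add: has_SaS_law_def)
  then have "\<sigma> powr \<beta> = (2 powr H) powr \<beta> * \<sigma> powr \<beta>" by (simp only: of_real_eq_iff exp_inj_iff neg_equal_iff_equal)
  moreover have "1 < (2::real) powr (H * \<beta>)" using H \<beta> by (intro gr_one_powr) auto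
  ultimately have "\<sigma> = 0" using H \<beta> by (auto simp: powr_powr)
  then show ?thesis using \<sigma> SaS_law_scale_0[OF prob_space_axioms] by blast
qed

lemma unbounded: "AE w in W. (\<forall>K::nat. \<exists>n::nat. real K < A (real n) w) \<and> (\<forall>K::nat. \<exists>n::nat. A (real n) w < - real K)"
  using oscillates
proof eventually_elim
  case (elim w)
  have "\<exists>n::nat. real K < A (real n) w" for K :: nat
  proof (rule ccontr)
    assume "\<not> (\<exists>n::nat. real K < A (real n) w)"
    then have "limsup (\<lambda>n::nat. ereal (A (real n) w)) \<le> ereal (real K)"
      by (intro Limsup_bounded) (auto simp: not_less)
    then show False using elim by simp
  qed
  moreover have "\<exists>n::nat. A (real n) w < - real K" for K :: nat
  proof (rule ccontr)
    assume "\<not> (\<exists>n::nat. A (real n) w < - real K)"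
    then have "ereal (- real K) \<le> liminf (\<lambda>n::nat. ereal (A (real n) w))"
      by (intro Liminf_bounded) (auto simp: not_less)
    then show False using elim by simp
  qed
  ultimately show ?case by blast
qed

text \<open>A stable law of positive scale has no atoms. If the scale were 0, then by self-similarity all
  \<open>A n\<close> would vanish, contrary to the oscillation.\<close>

lemma A_1_atomless: "measure W {w \<in> space W. A 1 w = x} = 0"
proof -
  obtain \<sigma> where \<sigma>: "has_SaS_law \<beta> \<sigma> W (A 1)" using marginal_law[of 1] by auto
  have "\<sigma> \<noteq> 0"
  proof
    assume "\<sigma> = 0"
    then have ch: "char (distr W borel (A 1)) \<theta> = 1" for \<theta> using \<sigma> by (simp add: has_SaS_law_def)
    have "AE w in W. A (real n) w = 0" for n :: nat
    proof (cases "n = 0")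
      case False
      then have "distr W borel (A (real n)) = distr W borel (\<lambda>w. (real n powr H) * A 1 w)"
        using scaling[of "real n" 1] by simp
      then have "char (distr W borel (A (real n))) \<theta> = 1" for \<theta>
        using SaS_law_char_scale[OF prob_space_axioms \<sigma>] \<open>\<sigma> = 0\<close> by simp
      then show ?thesis using measurable_A[of "real n"] by (intro char_1_imp_AE_zero prob_space_axioms) auto
    qed (use A_0 in simp)
    then have "AE w in W. \<forall>n::nat. A (real n) w = 0" by (simp add: AE_all_countable)
    then have "AE w in W. False" using unbounded by eventually_elim auto
    then show False by simp
  qed
  then have "0 < \<sigma>" using \<sigma> by (simp add: has_SaS_law_def)
  then show ?thesis by (intro SaS_law_atomless[OF prob_space_axioms \<sigma>] \<beta>)
qed

text \<open>By self-similarity \<open>A n\<close> has the law of \<open>n powr H * A 1\<close>, and \<open>A 1\<close> has no atom at 0.\<close>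

lemma diverges_in_probability:
  "(\<lambda>n::nat. measure W {w \<in> space W. \<bar>A (real n) w - A 0 w\<bar> \<le> K}) \<longlonglongrightarrow> 0"
proof -
  have [measurable]: "A (real n) \<in> borel_measurable W" "A 0 \<in> borel_measurable W" "A 1 \<in> borel_measurable W" for n
    using measurable_A by auto
  let ?S = "\<lambda>n::nat. {w \<in> space W. \<bar>(real n powr H) * A 1 w\<bar> \<le> K}"
  have eq: "measure W {w \<in> space W. \<bar>A (real n) w - A 0 w\<bar> \<le> K} = (\<integral>w. indicator (?S n) w \<partial>W)" if "0 < n" for n
  proof -
    have "measure W {w \<in> space W. \<bar>A (real n) w - A 0 w\<bar> \<le> K} = measure W {w \<in> space W. \<bar>A (real n) w\<bar> \<le> K}"
      using A_0 by (intro measure_eq_AE) (auto elim!: eventually_mono)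
    also have "\<dots> = measure (distr W borel (A (real n))) {x. \<bar>x\<bar> \<le> K}"
      by (subst measure_distr) (auto intro!: arg_cong[where f="measure W"])
    also have "\<dots> = measure (distr W borel (\<lambda>w. (real n powr H) * A 1 w)) {x. \<bar>x\<bar> \<le> K}"
      using scaling[of "real n" 1] that by simp
    also have "\<dots> = measure W (?S n)"
      by (subst measure_distr) (auto intro!: arg_cong[where f="measure W"])
    finally show ?thesis by simp
  qed
  have "(\<lambda>n. \<integral>w. indicator (?S n) w \<partial>W) \<longlonglongrightarrow> (\<integral>w. (0::real) \<partial>W)"
  proof (rule integral_dominated_convergence[where w="\<lambda>_. 1"])
    have "AE w in W. A 1 w \<noteq> 0" using A_1_atomless[of 0] by (subst (asm) prob_eq_0) auto
    then show "AE w in W. (\<lambda>n. indicator (?S n) w :: real) \<longlonglongrightarrow> 0"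
    proof eventually_elim
      case (elim w)
      have "filterlim (\<lambda>n::nat. (real n powr H) * \<bar>A 1 w\<bar>) at_top sequentially"
        using elim by (intro filterlim_at_top_mult_tendsto_pos[OF tendsto_const]
          filterlim_compose[OF powr_at_top[OF H] filterlim_real_sequentially]) auto
      then have "eventually (\<lambda>n::nat. K < (real n powr H) * \<bar>A 1 w\<bar>) sequentially"
        by (simp add: filterlim_at_top_dense)
      then show ?case
        by (intro tendsto_eventually) (auto elim!: eventually_mono simp: abs_mult)
    qed
  qed (auto intro!: AE_I2 split: split_indicator)
  then have "(\<lambda>n. \<integral>w. indicator (?S n) w \<partial>W) \<longlonglongrightarrow> (0::real)" by simp
  then show ?thesis
    by (rule Lim_transform_eventually) (rule eventually_mono[OF eventually_gt_at_top[of 0]], simp only: eq)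
qed

text \<open>The increments stay stationary under negative shifts too: seen from a late enough time, both
  families of increments are increments of \<open>A\<close>.\<close>

lemma two_sided_version:
  obtains a where "stationary_increment_path W a"
    "\<And>J h. finite J \<Longrightarrow> 0 \<le> h \<Longrightarrow> (\<And>j. j \<in> J \<Longrightarrow> 0 \<le> j + h) \<Longrightarrow>
       distr W (\<Pi>\<^sub>M j\<in>J. borel) (\<lambda>w. \<lambda>j\<in>J. a j w) = increment_law W A J h"
proof -
  have A1: "A 1 \<in> borel_measurable W" by (rule measurable_A) simp
  obtain a :: "int \<Rightarrow> 'w \<Rightarrow> real" where a: "\<And>j. a j \<in> borel_measurable W"
    and law: "\<And>J h. finite J \<Longrightarrow> 0 \<le> h \<Longrightarrow> (\<And>j. j \<in> J \<Longrightarrow> 0 \<le> j + h) \<Longrightarrow>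
       distr W (\<Pi>\<^sub>M j\<in>J. borel) (\<lambda>w. \<lambda>j\<in>J. a j w) = increment_law W A J h"
    using two_sided_process[OF prob_space_axioms measurable_A stationary A1 A_1_atomless] by blast
  have incr: "distr W (\<Pi>\<^sub>M j\<in>J. borel) (\<lambda>w. \<lambda>j\<in>J. a (j + n) w - a n w) = increment_law W A J (n + h)"
    if J: "finite J" and h: "0 \<le> h" "0 \<le> n + h" "\<And>j. j \<in> J \<Longrightarrow> 0 \<le> j + n + h" for J n h
  proof -
    define T where "T = insert n ((\<lambda>j. j + n) ` J)"
    have T: "finite T" "n \<in> T" "\<And>j. j \<in> J \<Longrightarrow> j + n \<in> T" "\<And>t. t \<in> T \<Longrightarrow> 0 \<le> t + h"
      using J h by (auto simp: T_def)
    define \<Psi> where "\<Psi> p = (\<lambda>j\<in>J. p (j + n) - p n)" for p :: "int \<Rightarrow> real"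
    have \<Psi>: "\<Psi> \<in> measurable (\<Pi>\<^sub>M t\<in>T. borel) (\<Pi>\<^sub>M j\<in>J. borel)"
      unfolding \<Psi>_def by (intro measurable_restrict borel_measurable_diff measurable_component_singleton T)
    have m1: "(\<lambda>w. \<lambda>t\<in>T. a t w) \<in> measurable W (\<Pi>\<^sub>M t\<in>T. borel)" by (intro measurable_restrict a)
    have m2: "(\<lambda>w. \<lambda>t\<in>T. A (real_of_int (t + h)) w - A (real_of_int h) w) \<in> measurable W (\<Pi>\<^sub>M t\<in>T. borel)"
      using T(4) h by (intro measurable_restrict borel_measurable_diff measurable_A) (auto simp del: of_int_add)
    have "distr W (\<Pi>\<^sub>M j\<in>J. borel) (\<lambda>w. \<lambda>j\<in>J. a (j + n) w - a n w) =
      distr (distr W (\<Pi>\<^sub>M t\<in>T. borel) (\<lambda>w. \<lambda>t\<in>T. a t w)) (\<Pi>\<^sub>M j\<in>J. borel) \<Psi>"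
      using T by (subst distr_distr[OF \<Psi> m1]) (auto intro!: distr_cong simp: \<Psi>_def fun_eq_iff)
    also have "\<dots> = distr (increment_law W A T h) (\<Pi>\<^sub>M j\<in>J. borel) \<Psi>"
      by (simp only: law[OF T(1) h(1) T(4)])
    also have "\<dots> = increment_law W A J (n + h)"
      unfolding increment_law_def using T
      by (subst distr_distr[OF \<Psi> m2]) (auto intro!: distr_cong simp: \<Psi>_def fun_eq_iff add_ac)
    finally show ?thesis .
  qed
  have path: "stationary_increment_path W a"
  proof (intro stationary_increment_path.intro stationary_increment_path_axioms.intro prob_space_axioms a)
    fix n
    show "distr W (\<Pi>\<^sub>M i\<in>UNIV. borel) (\<lambda>w i. a (i + n) w - a n w) =
      distr W (\<Pi>\<^sub>M i\<in>UNIV. borel) (\<lambda>w i. a i w - a 0 w)"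
    proof (rule process_law_eqI[OF prob_space_axioms])
      fix J :: "int set" assume J: "finite J"
      define h where "h = \<bar>n\<bar> + (\<Sum>j\<in>J. \<bar>j\<bar>)"
      have sum: "0 \<le> (\<Sum>j\<in>J. \<bar>j\<bar>)" by (intro sum_nonneg) auto
      have late: "0 \<le> j + (\<Sum>j\<in>J. \<bar>j\<bar>)" if "j \<in> J" for j
        using member_le_sum[of j J abs] that J by simp
      have h: "0 \<le> h" "0 \<le> n + h" "\<And>j. j \<in> J \<Longrightarrow> 0 \<le> j + n + h"
        unfolding h_def using sum late abs_ge_minus_self[of n] by (linarith, linarith, smt (verit))
      show "distr W (\<Pi>\<^sub>M j\<in>J. borel) (\<lambda>w. \<lambda>j\<in>J. a (j + n) w - a n w) =
        distr W (\<Pi>\<^sub>M j\<in>J. borel) (\<lambda>w. \<lambda>j\<in>J. a j w - a 0 w)"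
        using incr[OF J h] incr[OF J, of "n + h" 0] h by (simp add: add_ac)
    qed (intro borel_measurable_diff a)+
  qed
  show ?thesis by (rule that[OF path law])
qed

lemma two_sided_law_on_naturals:
  assumes a: "stationary_increment_path W a"
    and law: "\<And>J h. finite J \<Longrightarrow> 0 \<le> h \<Longrightarrow> (\<And>j. j \<in> J \<Longrightarrow> 0 \<le> j + h) \<Longrightarrow>
       distr W (\<Pi>\<^sub>M j\<in>J. borel) (\<lambda>w. \<lambda>j\<in>J. a j w) = increment_law W A J h"
  shows "distr W (\<Pi>\<^sub>M n\<in>UNIV. borel) (\<lambda>w n. a (int n) w) =
    distr W (\<Pi>\<^sub>M n\<in>UNIV. borel) (\<lambda>w n. A (real n) w - A 0 w)"
proof (rule process_law_eqI[OF prob_space_axioms])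
  interpret stationary_increment_path W a by fact
  fix J :: "nat set" assume J: "finite J"
  define \<Psi> where "\<Psi> p = (\<lambda>n\<in>J. p (int n))" for p :: "int \<Rightarrow> real"
  have \<Psi>: "\<Psi> \<in> measurable (\<Pi>\<^sub>M t\<in>int ` J. borel) (\<Pi>\<^sub>M j\<in>J. borel)"
    unfolding \<Psi>_def by (intro measurable_restrict measurable_component_singleton) auto
  have m1: "(\<lambda>w. \<lambda>t\<in>int ` J. a t w) \<in> measurable W (\<Pi>\<^sub>M t\<in>int ` J. borel)"
    by (intro measurable_restrict measurable_path)
  have m2: "(\<lambda>w. \<lambda>t\<in>int ` J. A (real_of_int (t + 0)) w - A (real_of_int 0) w) \<in> measurable W (\<Pi>\<^sub>M t\<in>int ` J. borel)"
    by (intro measurable_restrict borel_measurable_diff measurable_A) auto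
  have "distr W (\<Pi>\<^sub>M n\<in>J. borel) (\<lambda>w. \<lambda>n\<in>J. a (int n) w) =
    distr (distr W (\<Pi>\<^sub>M t\<in>int ` J. borel) (\<lambda>w. \<lambda>t\<in>int ` J. a t w)) (\<Pi>\<^sub>M n\<in>J. borel) \<Psi>"
    by (subst distr_distr[OF \<Psi> m1]) (auto intro!: distr_cong simp: \<Psi>_def fun_eq_iff)
  also have "\<dots> = distr (increment_law W A (int ` J) 0) (\<Pi>\<^sub>M n\<in>J. borel) \<Psi>"
    using J by (subst law[of "int ` J" 0]) auto
  also have "\<dots> = distr W (\<Pi>\<^sub>M n\<in>J. borel) (\<lambda>w. \<lambda>n\<in>J. A (real n) w - A 0 w)"
    unfolding increment_law_def
    by (subst distr_distr[OF \<Psi> m2]) (auto intro!: distr_cong simp: \<Psi>_def fun_eq_iff)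
  finally show "distr W (\<Pi>\<^sub>M n\<in>J. borel) (\<lambda>w. \<lambda>n\<in>J. a (int n) w) =
    distr W (\<Pi>\<^sub>M n\<in>J. borel) (\<lambda>w. \<lambda>n\<in>J. A (real n) w - A 0 w)" .
qed (use stationary_increment_path.measurable_path[OF a] measurable_A in \<open>auto intro!: borel_measurable_diff\<close>)

end

section \<open>The noise as a process generated by the shift\<close>

text \<open>A function in \<open>L\<^sup>\<alpha>\<close> with values in \<open>{-1, 0, 1}\<close> has support of finite measure, so it is a simple
  function and its integral is elementary.\<close>

lemma (in stable_random_measure) integral_of_ternary:
  assumes int: "has_stable_integral \<alpha> W m M f Y"
    and G [measurable]: "G \<in> borel_measurable m" and ternary: "G ` space m \<subseteq> {-1, 0, 1}"
    and eq: "AE x in m. f x = G x"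
  shows "emeasure m {x \<in> space m. G x \<noteq> 0} < \<infinity>" "AE w in W. Y w = simple_stable_integral m M G w"
proof -
  have f: "in_Lp \<alpha> m f" using int by (simp add: has_stable_integral_def)
  have "emeasure m {x \<in> space m. G x \<noteq> 0} = (\<integral>\<^sup>+ x. indicator {x \<in> space m. G x \<noteq> 0} x \<partial>m)" by simp
  also have "\<dots> = (\<integral>\<^sup>+ x. ennreal (\<bar>f x\<bar> powr \<alpha>) \<partial>m)"
  proof (rule nn_integral_cong_AE)
    show "AE x in m. indicator {x \<in> space m. G x \<noteq> 0} x = ennreal (\<bar>f x\<bar> powr \<alpha>)"
      using eq AE_space
    proof eventually_elim
      case (elim x)
      then have "G x \<in> {-1, 0, 1}" using ternary by blast
      then show ?case using elim by auto
    qed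
  qed
  also have "\<dots> < \<infinity>" using f by (simp add: in_Lp_def)
  finally show fin: "emeasure m {x \<in> space m. G x \<noteq> 0} < \<infinity>" .
  have simple: "simple_function m G"
    using ternary by (intro simple_function_borel_measurable G) (auto intro: finite_subset)
  have "in_Lp \<alpha> m G"
  proof -
    have "(\<integral>\<^sup>+ x. ennreal (\<bar>G x\<bar> powr \<alpha>) \<partial>m) = (\<integral>\<^sup>+ x. ennreal (\<bar>f x\<bar> powr \<alpha>) \<partial>m)"
      using eq by (intro nn_integral_cong_AE) (auto elim!: eventually_mono)
    then show ?thesis using f by (simp add: in_Lp_def)
  qed
  moreover have "(\<integral>\<^sup>+ x. ennreal (\<bar>g x - G x\<bar> powr \<alpha>) \<partial>m) = (\<integral>\<^sup>+ x. ennreal (\<bar>g x - f x\<bar> powr \<alpha>) \<partial>m)"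
    for g :: "'b \<Rightarrow> real"
    using eq by (intro nn_integral_cong_AE) (auto elim!: eventually_mono)
  ultimately have "has_stable_integral \<alpha> W m M G Y"
    using int unfolding has_stable_integral_def by simp
  then show "AE w in W. Y w = simple_stable_integral m M G w"
    by (rule stable_integral_of_simple[OF simple fin])
qed

context stationary_increment_path
begin

lemma emeasure_path_event:
  assumes q: "\<And>t. t \<in> T \<Longrightarrow> q t \<in> borel_measurable W"
    and law: "distr (W \<Otimes>\<^sub>M lborel) (\<Pi>\<^sub>M t\<in>T. borel) (\<lambda>(w, x). \<lambda>t\<in>T. x - a t w) =
      distr (W \<Otimes>\<^sub>M lborel) (\<Pi>\<^sub>M t\<in>T. borel) (\<lambda>(w, x). \<lambda>t\<in>T. x - q t w)"
    and S: "S \<in> sets (\<Pi>\<^sub>M t\<in>T. borel)"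
  shows "{z. restrict (fst z) T \<in> S} \<in> sets path_algebra"
    "{z \<in> space (W \<Otimes>\<^sub>M lborel). (\<lambda>t\<in>T. snd z - q t (fst z)) \<in> S} \<in> sets (W \<Otimes>\<^sub>M lborel)"
    "emeasure path_measure {z. restrict (fst z) T \<in> S} =
      emeasure (W \<Otimes>\<^sub>M lborel) {z \<in> space (W \<Otimes>\<^sub>M lborel). (\<lambda>t\<in>T. snd z - q t (fst z)) \<in> S}"
proof -
  have r: "(\<lambda>z. restrict (fst z) T) \<in> measurable path_algebra (\<Pi>\<^sub>M t\<in>T. borel)"
    by (intro measurable_restrict measurable_path_coordinate)
  have mq: "(\<lambda>(w, x). \<lambda>t\<in>T. x - q t w) \<in> measurable (W \<Otimes>\<^sub>M lborel) (\<Pi>\<^sub>M t\<in>T. borel)"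
    if "\<And>t. t \<in> T \<Longrightarrow> q t \<in> borel_measurable W" for q
    unfolding split_beta
    by (intro measurable_restrict borel_measurable_diff measurable_compose[OF measurable_fst that]) measurable
  show S1: "{z. restrict (fst z) T \<in> S} \<in> sets path_algebra"
    using measurable_sets[OF r S] by (simp add: vimage_def)
  show "{z \<in> space (W \<Otimes>\<^sub>M lborel). (\<lambda>t\<in>T. snd z - q t (fst z)) \<in> S} \<in> sets (W \<Otimes>\<^sub>M lborel)"
    using measurable_sets[OF mq[OF q] S] by (simp add: vimage_def split_beta Int_def conj_commute)
  have event: "emeasure (distr (W \<Otimes>\<^sub>M lborel) (\<Pi>\<^sub>M t\<in>T. borel) (\<lambda>(w, x). \<lambda>t\<in>T. x - q t w)) S =
      emeasure (W \<Otimes>\<^sub>M lborel) {z \<in> space (W \<Otimes>\<^sub>M lborel). (\<lambda>t\<in>T. snd z - q t (fst z)) \<in> S}"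
    if "\<And>t. t \<in> T \<Longrightarrow> q t \<in> borel_measurable W" for q
    using S mq[OF that] by (subst emeasure_distr) (auto intro!: arg_cong[where f="emeasure (W \<Otimes>\<^sub>M lborel)"])
  have "emeasure path_measure {z. restrict (fst z) T \<in> S} =
    emeasure (W \<Otimes>\<^sub>M lborel) {z \<in> space (W \<Otimes>\<^sub>M lborel). (\<lambda>t\<in>T. snd z - a t (fst z)) \<in> S}"
    unfolding path_measure_def using S1
    by (subst emeasure_distr) (auto simp: translate_def intro!: arg_cong[where f="emeasure (W \<Otimes>\<^sub>M lborel)"])
  then show "emeasure path_measure {z. restrict (fst z) T \<in> S} =
      emeasure (W \<Otimes>\<^sub>M lborel) {z \<in> space (W \<Otimes>\<^sub>M lborel). (\<lambda>t\<in>T. snd z - q t (fst z)) \<in> S}"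
    using event[of a] event[OF q] law by simp
qed

lemma level_crossing_cong: "p n = p' n \<Longrightarrow> p (n + 1) = p' (n + 1) \<Longrightarrow> level_crossing p n = level_crossing p' n"
  by (simp add: level_crossing_def)

text \<open>Partition both spaces by the values of all the kernels and by the sign of the path at time \<open>e\<close>. The
  two families of kernels take the same values on cells of equal measure, up to a sign which
  is constant on each cell.\<close>

lemma crossing_integrals_same_law:
  assumes M1: "stable_random_measure \<alpha> W1 path_measure M1"
    and M2: "stable_random_measure \<alpha> W2 (W \<Otimes>\<^sub>M lborel) M2"
    and J: "finite J" and T: "\<And>n. n \<in> J \<Longrightarrow> n \<in> T" "\<And>n. n \<in> J \<Longrightarrow> n + 1 \<in> T" "e \<in> T"
    and q: "\<And>t. t \<in> T \<Longrightarrow> q t \<in> borel_measurable W"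
    and law: "distr (W \<Otimes>\<^sub>M lborel) (\<Pi>\<^sub>M t\<in>T. borel) (\<lambda>(w, x). \<lambda>t\<in>T. x - a t w) =
      distr (W \<Otimes>\<^sub>M lborel) (\<Pi>\<^sub>M t\<in>T. borel) (\<lambda>(w, x). \<lambda>t\<in>T. x - q t w)"
    and fin: "\<And>n. n \<in> J \<Longrightarrow> emeasure path_measure {z. level_crossing (fst z) n \<noteq> 0} < \<infinity>"
    and X: "\<And>n. n \<in> J \<Longrightarrow> X n \<in> borel_measurable W1"
      "\<And>n. n \<in> J \<Longrightarrow> AE w in W1. X n w = simple_stable_integral path_measure M1 (\<lambda>z. level_crossing (fst z) n) w"
    and Y: "\<And>n. n \<in> J \<Longrightarrow> Y n \<in> borel_measurable W2"
      "\<And>n. n \<in> J \<Longrightarrow> AE w in W2. Y n w = simple_stable_integral (W \<Otimes>\<^sub>M lborel) M2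
        (\<lambda>z. (if 0 < snd z - q e (fst z) then 1 else - 1) * level_crossing (\<lambda>t. snd z - q t (fst z)) n) w"
  shows "distr W1 (\<Pi>\<^sub>M n\<in>J. borel) (\<lambda>w. \<lambda>n\<in>J. X n w) = distr W2 (\<Pi>\<^sub>M n\<in>J. borel) (\<lambda>w. \<lambda>n\<in>J. Y n w)"
proof -
  \<comment> \<open>The cell on which all kernels vanish is left out: it has infinite measure.\<close>
  define K where "K = ((\<Pi>\<^sub>E n\<in>J. {-1, 0, 1 :: real}) - {\<lambda>n\<in>J. 0}) \<times> (UNIV :: bool set)"
  define S where "S k = {p \<in> space (\<Pi>\<^sub>M t\<in>T. borel). (\<forall>n\<in>J. level_crossing p n = fst k n) \<and> (0 < p e) = snd k}"
    for k :: "(int \<Rightarrow> real) \<times> bool"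
  have K: "finite K" unfolding K_def using J by (intro finite_cartesian_product finite_Diff finite_PiE) auto
  have coord [measurable]: "(\<lambda>p. p t) \<in> borel_measurable (\<Pi>\<^sub>M t\<in>T. (borel :: real measure))" if "t \<in> T" for t
    using that by (rule measurable_component_singleton)
  have lc: "(\<lambda>p. level_crossing p n) \<in> borel_measurable (\<Pi>\<^sub>M t\<in>T. (borel :: real measure))" if "n \<in> J" for n
  proof -
    have [measurable]: "(\<lambda>p. p n) \<in> borel_measurable (\<Pi>\<^sub>M t\<in>T. (borel :: real measure))"
      "(\<lambda>p. p (n + 1)) \<in> borel_measurable (\<Pi>\<^sub>M t\<in>T. (borel :: real measure))"
      using T that coord by blast+
    show ?thesis unfolding level_crossing_def by measurable
  qed
  have S: "S k \<in> sets (\<Pi>\<^sub>M t\<in>T. borel)" for k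
  proof -
    let ?N = "\<Pi>\<^sub>M t\<in>T. (borel :: real measure)"
    have "{p \<in> space ?N. \<forall>n\<in>J. level_crossing p n = fst k n} \<in> sets ?N"
    proof (rule sets.sets_Collect_finite_All[OF _ J])
      fix n assume "n \<in> J"
      note lc[OF this, measurable]
      show "{p \<in> space ?N. level_crossing p n = fst k n} \<in> sets ?N" by measurable
    qed
    moreover have "{p \<in> space ?N. (0 < p e) = snd k} \<in> sets ?N"
    proof -
      note coord[OF T(3), measurable]
      show ?thesis by measurable
    qed
    ultimately have "{p \<in> space ?N. \<forall>n\<in>J. level_crossing p n = fst k n} \<inter> {p \<in> space ?N. (0 < p e) = snd k} \<in> sets ?N"
      by (rule sets.Int)
    also have "{p \<in> space ?N. \<forall>n\<in>J. level_crossing p n = fst k n} \<inter> {p \<in> space ?N. (0 < p e) = snd k} = S k"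
      by (auto simp: S_def)
    finally show ?thesis .
  qed
  define D1 where "D1 k = {z::path. restrict (fst z) T \<in> S k}" for k
  define D2 where "D2 k = {z \<in> space (W \<Otimes>\<^sub>M lborel). (\<lambda>t\<in>T. snd z - q t (fst z)) \<in> S k}" for k
  have D: "D1 k \<in> sets path_algebra" "D2 k \<in> sets (W \<Otimes>\<^sub>M lborel)"
      "emeasure path_measure (D1 k) = emeasure (W \<Otimes>\<^sub>M lborel) (D2 k)" for k
    unfolding D1_def D2_def using emeasure_path_event[OF q law S] by auto
  have lc1: "level_crossing (restrict p T) n = level_crossing p n" if "n \<in> J" for p n
    using T that by (intro level_crossing_cong) auto
  have D1_iff: "z \<in> D1 k \<longleftrightarrow> (\<forall>n\<in>J. level_crossing (fst z) n = fst k n) \<and> (0 < fst z e) = snd k" for z k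
    using T(3) by (simp add: D1_def S_def lc1 space_PiM)
  have D2_iff: "z \<in> D2 k \<longleftrightarrow> z \<in> space (W \<Otimes>\<^sub>M lborel) \<and>
      (\<forall>n\<in>J. level_crossing (\<lambda>t. snd z - q t (fst z)) n = fst k n) \<and> (0 < snd z - q e (fst z)) = snd k" for z k
    using T(3) by (simp add: D2_def S_def lc1 space_PiM)
  have ext: "k = k'" if "k \<in> K" "k' \<in> K" "\<forall>n\<in>J. fst k n = fst k' n" "snd k = snd k'" for k k'
  proof (rule prod_eqI)
    have "fst k \<in> (\<Pi>\<^sub>E n\<in>J. {-1, 0, 1})" "fst k' \<in> (\<Pi>\<^sub>E n\<in>J. {-1, 0, 1})"
      using that(1,2) by (simp_all add: K_def mem_Times_iff)
    then show "fst k = fst k'" using that(3) by (intro PiE_ext) auto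
  qed (rule that(4))
  have fin1: "emeasure path_measure (D1 k) < \<infinity>" if "k \<in> K" for k
  proof -
    have "\<exists>n\<in>J. fst k n \<noteq> 0"
    proof (rule ccontr)
      assume "\<not> (\<exists>n\<in>J. fst k n \<noteq> 0)"
      then have "fst k = (\<lambda>n\<in>J. 0)" using that by (auto simp: K_def PiE_def extensional_def fun_eq_iff)
      then show False using that by (auto simp: K_def)
    qed
    then obtain n where n: "n \<in> J" "fst k n \<noteq> 0" by blast
    have "{z \<in> space path_algebra. level_crossing (fst z) n \<noteq> 0} \<in> sets path_algebra" by measurable
    then have "emeasure path_measure (D1 k) \<le> emeasure path_measure {z. level_crossing (fst z) n \<noteq> 0}"
      using n by (intro emeasure_mono) (auto simp: D1_iff)
    then show ?thesis using fin[OF n(1)] by (rule le_less_trans)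
  qed
  have cover: "\<exists>k\<in>K. (\<forall>n\<in>J. level_crossing p n = fst k n) \<and> b = snd k"
    if "n \<in> J" "level_crossing p n \<noteq> 0" for p n b
  proof (intro bexI[of _ "(\<lambda>n\<in>J. level_crossing p n, b)"])
    have "(\<lambda>n\<in>J. level_crossing p n) \<noteq> (\<lambda>n\<in>J. 0)" using that by (metis restrict_apply')
    then show "(\<lambda>n\<in>J. level_crossing p n, b) \<in> K" using level_crossing_values[of p] by (auto simp: K_def)
  qed auto
  show ?thesis
  proof (rule simple_integrals_same_law[OF M1 M2 K, where ?D1.0=D1 and ?D2.0=D2 and c="\<lambda>n k. fst k n"
        and s="\<lambda>k. if snd k then 1 else - 1" and f="\<lambda>n z. level_crossing (fst z) n"
        and g="\<lambda>n z. (if 0 < snd z - q e (fst z) then 1 else - 1) * level_crossing (\<lambda>t. snd z - q t (fst z)) n"])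
    show "D1 ` K \<subseteq> finite_measure_sets path_measure" using D fin1 by (auto simp: finite_measure_sets_def)
    show "D2 ` K \<subseteq> finite_measure_sets (W \<Otimes>\<^sub>M lborel)"
      using D fin1 unfolding finite_measure_sets_def by auto
    show "disjoint_family_on D1 K" "disjoint_family_on D2 K"
      unfolding disjoint_family_on_def using ext by (auto simp: D1_iff D2_iff)
    show "measure path_measure (D1 k) = measure (W \<Otimes>\<^sub>M lborel) (D2 k)" for k
      using D(3)[of k] by (simp add: measure_def)
    show "level_crossing (fst z) n = 0" if "n \<in> J" "z \<notin> (\<Union>k\<in>K. D1 k)" for n z
      using cover[of n "fst z" "0 < fst z e"] that by (auto simp: D1_iff)
    show "(if 0 < snd z - q e (fst z) then 1 else - 1) * level_crossing (\<lambda>t. snd z - q t (fst z)) n = 0"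
      if "n \<in> J" "z \<in> space (W \<Otimes>\<^sub>M lborel)" "z \<notin> (\<Union>k\<in>K. D2 k)" for n z
    proof -
      have "level_crossing (\<lambda>t. snd z - q t (fst z)) n = 0"
        using cover[of n "\<lambda>t. snd z - q t (fst z)" "0 < snd z - q e (fst z)"] that by (auto simp: D2_iff)
      then show ?thesis by simp
    qed
  qed (use X Y J in \<open>auto simp: D1_iff D2_iff\<close>)
qed

end

context self_similar_stable
begin

text \<open>The indicator of the interval between 0 and \<open>c\<close> at \<open>x\<close> is \<open>1 {x \<le> c}\<close> to the right of the origin, and
  \<open>1 - 1 {x \<le> c}\<close> to its left except at the end points. The constant cancels in the difference and a sign
  remains.\<close>

lemma noise_kernel_sign_form:
  assumes n: "1 \<le> n"
  shows "AE z in W \<Otimes>\<^sub>M lborel. noise_kernel A n z = (if 0 < snd z - A 0 (fst z) then 1 else - 1) *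
    (of_bool (snd z - A (real n) (fst z) \<le> 0) - of_bool (snd z - A (real n - 1) (fst z) \<le> 0))"
proof -
  interpret P: pair_sigma_finite W lborel ..
  have [measurable]: "A (real n) \<in> borel_measurable W" "A (real n - 1) \<in> borel_measurable W" "A 0 \<in> borel_measurable W"
    using n measurable_A by auto
  have "AE z in W \<Otimes>\<^sub>M lborel. A 0 (fst z) = 0 \<and> snd z \<noteq> 0 \<and> snd z \<noteq> A (real n) (fst z) \<and> snd z \<noteq> A (real n - 1) (fst z)"
  proof (rule P.AE_pair_measure)
    show "AE w in W. AE x in lborel. A 0 (fst (w, x)) = 0 \<and> snd (w, x) \<noteq> 0 \<and>
        snd (w, x) \<noteq> A (real n) (fst (w, x)) \<and> snd (w, x) \<noteq> A (real n - 1) (fst (w, x))"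
      using A_0
    proof eventually_elim
      case (elim w)
      show ?case
        using AE_lborel_singleton[of 0] AE_lborel_singleton[of "A (real n) w"] AE_lborel_singleton[of "A (real n - 1) w"]
        by eventually_elim (use elim in simp)
    qed
  qed measurable
  then show ?thesis
  proof eventually_elim
    case (elim z)
    have ivl: "indicator (unordered_ivl 0 c) x = (if 0 < x then of_bool (x \<le> c) else 1 - of_bool (x \<le> c) :: real)"
      if "x \<noteq> 0" "x \<noteq> c" for x c
      using that by (auto simp: unordered_ivl_def indicator_def)
    show ?case using elim ivl by (cases "0 < snd z") (auto simp: noise_kernel_def split_beta)
  qed
qed

end

lemma same_fdds_reindex:
  assumes eq: "same_fdds T W X V Y" and J: "finite J" "r ` J \<subseteq> T"
    and X: "\<And>t. t \<in> T \<Longrightarrow> X t \<in> borel_measurable W" and Y: "\<And>t. t \<in> T \<Longrightarrow> Y t \<in> borel_measurable V"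
  shows "distr W (\<Pi>\<^sub>M j\<in>J. borel) (\<lambda>w. \<lambda>j\<in>J. X (r j) w) = distr V (\<Pi>\<^sub>M j\<in>J. borel) (\<lambda>v. \<lambda>j\<in>J. Y (r j) v)"
proof -
  define \<Psi> where "\<Psi> p = (\<lambda>j\<in>J. p (r j))" for p :: "_ \<Rightarrow> real"
  have \<Psi>: "\<Psi> \<in> measurable (\<Pi>\<^sub>M t\<in>r ` J. borel) (\<Pi>\<^sub>M j\<in>J. borel)"
    unfolding \<Psi>_def by (intro measurable_restrict measurable_component_singleton) auto
  have mX: "(\<lambda>w. \<lambda>t\<in>r ` J. X t w) \<in> measurable W (\<Pi>\<^sub>M t\<in>r ` J. borel)"
    using X J by (intro measurable_restrict) auto
  have mY: "(\<lambda>w. \<lambda>t\<in>r ` J. Y t w) \<in> measurable V (\<Pi>\<^sub>M t\<in>r ` J. borel)"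
    using Y J by (intro measurable_restrict) auto
  have "distr (distr W (\<Pi>\<^sub>M t\<in>r ` J. borel) (\<lambda>w. \<lambda>t\<in>r ` J. X t w)) (\<Pi>\<^sub>M j\<in>J. borel) \<Psi> =
    distr (distr V (\<Pi>\<^sub>M t\<in>r ` J. borel) (\<lambda>w. \<lambda>t\<in>r ` J. Y t w)) (\<Pi>\<^sub>M j\<in>J. borel) \<Psi>"
    using eq J by (simp add: same_fdds_def)
  moreover have "\<Psi> \<circ> (\<lambda>w. \<lambda>t\<in>r ` J. X t w) = (\<lambda>w. \<lambda>j\<in>J. X (r j) w)"
    "\<Psi> \<circ> (\<lambda>w. \<lambda>t\<in>r ` J. Y t w) = (\<lambda>w. \<lambda>j\<in>J. Y (r j) w)"
    by (auto simp: \<Psi>_def fun_eq_iff)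
  ultimately show ?thesis by (simp add: distr_distr[OF \<Psi> mX] distr_distr[OF \<Psi> mY])
qed

context self_similar_stable
begin

text \<open>The two-sided path and the piece of \<open>A\<close> after time \<open>h\<close> have the same increments in law, and the starting
  value is absorbed by the random level.\<close>

lemma translated_copy_law:
  assumes a: "stationary_increment_path W a"
    and law: "\<And>J h. finite J \<Longrightarrow> 0 \<le> h \<Longrightarrow> (\<And>j. j \<in> J \<Longrightarrow> 0 \<le> j + h) \<Longrightarrow>
       distr W (\<Pi>\<^sub>M j\<in>J. borel) (\<lambda>w. \<lambda>j\<in>J. a j w) = increment_law W A J h"
    and T: "finite T" "0 \<le> h" "\<And>t. t \<in> T \<Longrightarrow> 0 \<le> t + h"
  shows "distr (W \<Otimes>\<^sub>M lborel) (\<Pi>\<^sub>M t\<in>T. borel) (\<lambda>(w, x). \<lambda>t\<in>T. x - a t w) =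
      distr (W \<Otimes>\<^sub>M lborel) (\<Pi>\<^sub>M t\<in>T. borel) (\<lambda>(w, x). \<lambda>t\<in>T. x - A (real_of_int (t + h)) w)"
proof (rule translated_law_cong[OF prob_space_axioms, where u="\<lambda>_. 0" and v="A (real_of_int h)"])
  show "distr W (\<Pi>\<^sub>M t\<in>T. borel) (\<lambda>w. \<lambda>t\<in>T. a t w - 0) =
    distr W (\<Pi>\<^sub>M t\<in>T. borel) (\<lambda>w. \<lambda>t\<in>T. A (real_of_int (t + h)) w - A (real_of_int h) w)"
    using law[OF T] by (simp add: increment_law_def)
qed (use stationary_increment_path.measurable_path[OF a] measurable_A T in \<open>auto simp del: of_int_add\<close>)

lemma two_sided_oscillates:
  assumes a: "stationary_increment_path W a"
    and law: "distr W (\<Pi>\<^sub>M n\<in>UNIV. borel) (\<lambda>w n. a (int n) w) =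
      distr W (\<Pi>\<^sub>M n\<in>UNIV. borel) (\<lambda>w n. A (real n) w - A 0 w)"
  shows "AE w in W. (\<forall>K::nat. \<exists>n::nat. real K < a (int n) w) \<and> (\<forall>K::nat. \<exists>n::nat. a (int n) w < - real K)"
proof -
  interpret stationary_increment_path W a by fact
  let ?N = "\<Pi>\<^sub>M n\<in>(UNIV::nat set). (borel :: real measure)"
  let ?P = "\<lambda>p::nat \<Rightarrow> real. (\<forall>K::nat. \<exists>n. real K < p n) \<and> (\<forall>K::nat. \<exists>n. p n < - real K)"
  have P: "{p \<in> space ?N. ?P p} \<in> sets ?N" by measurable
  have m1: "(\<lambda>w n. a (int n) w) \<in> measurable W ?N"
    by (rule measurable_PiM_single') (auto simp: space_PiM)
  have m2: "(\<lambda>w n. A (real n) w - A 0 w) \<in> measurable W ?N"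
    by (rule measurable_PiM_single') (auto simp: space_PiM intro!: borel_measurable_diff measurable_A)
  have "AE w in W. ?P (\<lambda>n. A (real n) w - A 0 w)"
    using unbounded A_0 by eventually_elim simp
  then have "AE p in distr W ?N (\<lambda>w n. a (int n) w). ?P p"
    unfolding law by (subst AE_distr_iff[OF m2 P])
  then show ?thesis by (subst (asm) AE_distr_iff[OF m1 P])
qed

lemma two_sided_diverges:
  assumes a: "stationary_increment_path W a"
    and law: "distr W (\<Pi>\<^sub>M n\<in>UNIV. borel) (\<lambda>w n. a (int n) w) =
      distr W (\<Pi>\<^sub>M n\<in>UNIV. borel) (\<lambda>w n. A (real n) w - A 0 w)"
  shows "(\<lambda>n::nat. measure W {w \<in> space W. \<bar>a (int n) w - a 0 w\<bar> \<le> K}) \<longlonglongrightarrow> 0"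
proof -
  interpret stationary_increment_path W a by fact
  let ?N = "\<Pi>\<^sub>M n\<in>(UNIV::nat set). (borel :: real measure)"
  have m1: "(\<lambda>w n. a (int n) w) \<in> measurable W ?N"
    by (rule measurable_PiM_single') (auto simp: space_PiM)
  have m2: "(\<lambda>w n. A (real n) w - A 0 w) \<in> measurable W ?N"
    by (rule measurable_PiM_single') (auto simp: space_PiM intro!: borel_measurable_diff measurable_A)
  have "measure W {w \<in> space W. \<bar>a (int n) w - a 0 w\<bar> \<le> K} =
    measure W {w \<in> space W. \<bar>A (real n) w - A 0 w\<bar> \<le> K}" for n
  proof -
    let ?S = "{p \<in> space ?N. \<bar>p n - p 0\<bar> \<le> K}"
    have S: "?S \<in> sets ?N" by measurable
    have "measure W {w \<in> space W. \<bar>a (int n) w - a 0 w\<bar> \<le> K} = measure (distr W ?N (\<lambda>w n. a (int n) w)) ?S"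
      using S by (subst measure_distr[OF m1]) (auto simp: space_PiM intro!: arg_cong[where f="measure W"])
    also have "\<dots> = measure W {w \<in> space W. \<bar>A (real n) w - A 0 w\<bar> \<le> K}"
      unfolding law using S
      by (subst measure_distr[OF m2]) (auto simp: space_PiM intro!: arg_cong[where f="measure W"])
    finally show ?thesis .
  qed
  then show ?thesis using diverges_in_probability[of K] by simp
qed

end

theorem theorem4p3:
  fixes \<alpha> \<beta> H' :: real
    and \<Omega>' :: "'w measure" and A :: "real \<Rightarrow> 'w \<Rightarrow> real"
    and \<Omega> :: "'u measure" and M :: "('w \<times> real) set \<Rightarrow> 'u \<Rightarrow> real"
    and V :: "'v measure" and Z :: "int \<Rightarrow> 'v \<Rightarrow> real"
  assumes "0 < \<alpha>" "\<alpha> < 2" "1 < \<beta>" "\<beta> \<le> 2" "0 < H'" "H' < 1"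
    and "prob_space \<Omega>'"
    and "SaS_process \<beta> {0..} \<Omega>' A"
    and "nondegenerate_process \<Omega>' A"
    and "stationary_increments \<Omega>' A"
    and "self_similar H' \<Omega>' A"
    and "prob_space \<Omega>"
    and "SaS_random_measure \<alpha> \<Omega> (\<Omega>' \<Otimes>\<^sub>M lborel) M"
    and "AE \<omega>' in \<Omega>'. limsup (\<lambda>n::nat. ereal (A (real n) \<omega>')) = \<infinity> \<and>
                      liminf (\<lambda>n::nat. ereal (A (real n) \<omega>')) = - \<infinity>"
    and "indicator_fractional_stable_noise \<alpha> \<Omega>' A \<Omega> M V Z"
  shows "\<exists>(E :: ((int \<Rightarrow> real) \<times> real) measure) \<phi>.
           generated_by_flow \<alpha> V Z E \<phi> \<and> conservative_flow E \<phi> \<and> null_flow E \<phi>"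
proof -
  interpret S: self_similar_stable \<Omega>' A \<beta> H'
    using assms by (simp add: self_similar_stable_def self_similar_stable_axioms_def)
  obtain a where a: "stationary_increment_path \<Omega>' a"
    and law: "\<And>J h. finite J \<Longrightarrow> 0 \<le> h \<Longrightarrow> (\<And>j. j \<in> J \<Longrightarrow> 0 \<le> j + h) \<Longrightarrow>
       distr \<Omega>' (\<Pi>\<^sub>M j\<in>J. borel) (\<lambda>w. \<lambda>j\<in>J. a j w) = increment_law \<Omega>' A J h"
    using S.two_sided_version by blast
  have seq: "distr \<Omega>' (\<Pi>\<^sub>M n\<in>UNIV. borel) (\<lambda>w n. a (int n) w) =
      distr \<Omega>' (\<Pi>\<^sub>M n\<in>UNIV. borel) (\<lambda>w n. A (real n) w - A 0 w)"
    by (rule S.two_sided_law_on_naturals[OF a law])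
  interpret stationary_increment_path \<Omega>' a by (rule a)
  interpret R: stable_random_measure \<alpha> \<Omega> "\<Omega>' \<Otimes>\<^sub>M lborel" M
    using assms by (simp add: stable_random_measure_def)

  obtain Y where Y: "\<And>n. 1 \<le> n \<Longrightarrow> has_stable_integral \<alpha> \<Omega> (\<Omega>' \<Otimes>\<^sub>M lborel) M (noise_kernel A n) (Y n)"
    and ZY: "same_fdds {1..} V (\<lambda>n. Z (int n)) \<Omega> Y" and Z: "stationary_process V Z"
    and Zm: "\<And>n. Z n \<in> borel_measurable V"
    using assms(15) unfolding indicator_fractional_stable_noise_def SaS_process_def random_process_def by blast
  define G where "G n z = (if 0 < snd z - A 0 (fst z) then 1 else - 1) *
    (of_bool (snd z - A (real n) (fst z) \<le> 0) - of_bool (snd z - A (real n - 1) (fst z) \<le> 0) :: real)"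
    for n :: nat and z
  have G: "emeasure (\<Omega>' \<Otimes>\<^sub>M lborel) {z \<in> space (\<Omega>' \<Otimes>\<^sub>M lborel). G n z \<noteq> 0} < \<infinity>"
    "AE w in \<Omega>. Y n w = simple_stable_integral (\<Omega>' \<Otimes>\<^sub>M lborel) M (G n) w" if n: "1 \<le> n" for n
  proof -
    have [measurable]: "A (real n) \<in> borel_measurable \<Omega>'" "A (real n - 1) \<in> borel_measurable \<Omega>'"
      "A 0 \<in> borel_measurable \<Omega>'"
      using n S.measurable_A by auto
    have m: "G n \<in> borel_measurable (\<Omega>' \<Otimes>\<^sub>M lborel)" unfolding G_def by measurable
    have "AE z in \<Omega>' \<Otimes>\<^sub>M lborel. noise_kernel A n z = G n z"
      unfolding G_def by (rule S.noise_kernel_sign_form[OF n])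
    moreover have "G n ` space (\<Omega>' \<Otimes>\<^sub>M lborel) \<subseteq> {-1, 0, 1}"
      by (rule image_subsetI) (simp add: G_def of_bool_def)
    ultimately show "emeasure (\<Omega>' \<Otimes>\<^sub>M lborel) {z \<in> space (\<Omega>' \<Otimes>\<^sub>M lborel). G n z \<noteq> 0} < \<infinity>"
      "AE w in \<Omega>. Y n w = simple_stable_integral (\<Omega>' \<Otimes>\<^sub>M lborel) M (G n) w"
      using R.integral_of_ternary[OF Y[OF n] m] by blast+
  qed

  have ev [measurable]: "{z. level_crossing (fst z) n \<noteq> 0} \<in> sets path_algebra" for n
  proof -
    have "{z \<in> space path_algebra. level_crossing (fst z) n \<noteq> 0} \<in> sets path_algebra" by measurable
    then show ?thesis by simp
  qed
  \<comment> \<open>The crossings at time 0 have the mass of the support of the first noise kernel, which is finite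
    because that kernel is integrable.\<close>
  have fin0: "emeasure path_measure {z. level_crossing (fst z) 0 \<noteq> 0} < \<infinity>"
  proof -
    let ?T = "{0, 1::int}" and ?q = "\<lambda>t. A (real_of_int (t + 0))"
    let ?S = "{p \<in> space (\<Pi>\<^sub>M t\<in>?T. (borel :: real measure)). level_crossing p 0 \<noteq> 0}"
    have S: "?S \<in> sets (\<Pi>\<^sub>M t\<in>?T. borel)" unfolding level_crossing_def by measurable
    have "emeasure path_measure {z. restrict (fst z) ?T \<in> ?S} = emeasure (\<Omega>' \<Otimes>\<^sub>M lborel)
        {z \<in> space (\<Omega>' \<Otimes>\<^sub>M lborel). (\<lambda>t\<in>?T. snd z - ?q t (fst z)) \<in> ?S}"
      by (rule emeasure_path_event[OF _ S.translated_copy_law[OF a law] S]) (auto intro: S.measurable_A)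
    also have "{z. restrict (fst z) ?T \<in> ?S} = {z::path. level_crossing (fst z) 0 \<noteq> 0}"
      by (auto simp: space_PiM level_crossing_def)
    also have "{z \<in> space (\<Omega>' \<Otimes>\<^sub>M lborel). (\<lambda>t\<in>?T. snd z - ?q t (fst z)) \<in> ?S} =
      {z \<in> space (\<Omega>' \<Otimes>\<^sub>M lborel). G 1 z \<noteq> 0}"
      by (auto simp: space_PiM level_crossing_def G_def of_bool_def split: if_splits)
    finally show ?thesis using G(1)[of 1] by simp
  qed
  have shift_ev: "shift_flow n -` {z. level_crossing (fst z) 0 \<noteq> 0} \<inter> space path_measure = {z. level_crossing (fst z) n \<noteq> 0}" for n
    by (auto simp: level_crossing_shift)
  have fin: "emeasure path_measure {z. level_crossing (fst z) n \<noteq> 0} < \<infinity>" for n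
    using flow.emeasure_preimage[of "{z. level_crossing (fst z) 0 \<noteq> 0}" n] fin0 shift_ev[of n] by simp

  have infinite: "AE z in path_measure. infinite {n::nat. level_crossing (fst z) (int n) \<noteq> 0}"
    by (rule AE_crossings_infinite[OF S.two_sided_oscillates[OF a seq]])
  have "conservative_flow path_measure shift_flow"
    by (rule flow.conservative_if_recurrent[of "{z. level_crossing (fst z) 0 \<noteq> 0}"])
      (use fin0 infinite in \<open>simp_all add: level_crossing_shift\<close>)
  moreover have "null_flow path_measure shift_flow"
    by (rule null_if_increments_diverge[OF S.two_sided_diverges[OF a seq]])
  moreover have "generated_by_flow \<alpha> V Z path_measure shift_flow"
  proof -
    let ?k = "flow_kernel \<alpha> path_measure shift_flow (\<lambda>_ _. 1) (\<lambda>z. level_crossing (fst z) 0)"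
    have k: "AE z in path_measure. ?k n z = level_crossing (fst z) n" for n
      using flow.flow_kernel_trivial_cocycle[of \<alpha> "\<lambda>z. level_crossing (fst z) 0" n] by (simp add: level_crossing_shift)
    have Lp: "in_Lp \<alpha> path_measure f"
      if f: "f \<in> borel_measurable path_measure" "AE z in path_measure. f z = level_crossing (fst z) n" for f n
    proof -
      have "(\<integral>\<^sup>+ z. ennreal (\<bar>f z\<bar> powr \<alpha>) \<partial>path_measure) = (\<integral>\<^sup>+ z. indicator {z. level_crossing (fst z) n \<noteq> 0} z \<partial>path_measure)"
        using f(2) by (intro nn_integral_cong_AE) (auto elim!: eventually_mono simp: level_crossing_powr split: split_indicator)
      also have "\<dots> < \<infinity>" using fin[of n] by simp
      finally show ?thesis using f by (simp add: in_Lp_def)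
    qed
    have mk: "?k n \<in> borel_measurable path_measure" for n
      unfolding flow_kernel_def level_crossing_shift by measurable
    have simple: "simple_function path_measure (\<lambda>z. level_crossing (fst z) n)" for n
      using level_crossing_values
      by (intro simple_function_borel_measurable) (auto intro!: finite_subset[of _ "{-1, 0, 1}"])
    interpret E: stable_random_measure \<alpha> \<Omega> path_measure "\<lambda>B. M (translate -` B \<inter> space (\<Omega>' \<Otimes>\<^sub>M lborel))"
      using R.pullback[OF measurable_translate] flow.sigma_finite_measure_axioms assms(1)
      by (simp add: stable_random_measure_def path_measure_def)
    obtain W :: "(path set \<Rightarrow> real) measure" where W: "SaS_random_measure \<alpha> W path_measure (\<lambda>B p. p B)"
      by (rule E.on_path_space)
    interpret F: stable_random_measure \<alpha> W path_measure "\<lambda>B p. p B"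
      using W assms(1) by (simp add: stable_random_measure_def)
    let ?I = "\<lambda>n. simple_stable_integral path_measure (\<lambda>B p. p B) (\<lambda>z. level_crossing (fst z) n)"
    have sfin: "emeasure path_measure {z \<in> space path_measure. level_crossing (fst z) n \<noteq> 0} < \<infinity>" for n
      using fin[of n] by simp
    have "has_stable_integral \<alpha> W path_measure (\<lambda>B p. p B) (?k n) (?I n)" for n
      by (rule F.simple_function_has_integral[OF simple sfin Lp[OF mk k] k])
    moreover have "same_fdds UNIV V Z W ?I"
      unfolding same_fdds_def
    proof (intro allI impI)
      fix J :: "int set" assume "finite J \<and> J \<subseteq> UNIV"
      then have J: "finite J" by simp
      \<comment> \<open>By stationarity of \<open>Z\<close> the times may be moved by \<open>h + 1\<close>, so that all of them are positive.
        The time \<open>- h\<close> is observed as well, since it corresponds to \<open>A 0\<close>, which decides the sign.\<close>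
      define h where "h = (\<Sum>j\<in>J. \<bar>j\<bar>)"
      have h: "0 \<le> h" "\<And>j. j \<in> J \<Longrightarrow> 0 \<le> j + h"
      proof -
        show "0 \<le> h" by (simp add: h_def sum_nonneg)
        show "0 \<le> j + h" if "j \<in> J" for j
          using member_le_sum[of j J abs] that J by (simp add: h_def)
      qed
      define N where "N j = nat (j + h + 1)" for j
      have N: "1 \<le> N j" "int (N j) = j + (h + 1)" "real (N j) = real_of_int (j + 1 + h)"
        "real (N j) - 1 = real_of_int (j + h)" if "j \<in> J" for j
        using h(2)[OF that] by (auto simp: N_def)
      define T where "T = insert (- h) (J \<union> (\<lambda>j. j + 1) ` J)"
      have T: "finite T" "\<And>j. j \<in> J \<Longrightarrow> j \<in> T" "\<And>j. j \<in> J \<Longrightarrow> j + 1 \<in> T" "- h \<in> T"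
        "\<And>t. t \<in> T \<Longrightarrow> 0 \<le> t + h"
        using J h by (auto simp: T_def) (smt (verit) h(2))
      have Ym: "Y n \<in> borel_measurable \<Omega>" if "1 \<le> n" for n
        using Y[OF that] by (simp add: has_stable_integral_def)
      have "distr W (\<Pi>\<^sub>M j\<in>J. borel) (\<lambda>p. \<lambda>j\<in>J. ?I j p) = distr \<Omega> (\<Pi>\<^sub>M j\<in>J. borel) (\<lambda>w. \<lambda>j\<in>J. Y (N j) w)"
      proof (rule crossing_integrals_same_law[OF F.stable_random_measure_axioms R.stable_random_measure_axioms
            J T(2,3,4) _ S.translated_copy_law[OF a law T(1) h(1) T(5)] fin])
        show "A (real_of_int (t + h)) \<in> borel_measurable \<Omega>'" if "t \<in> T" for t
          using T(5)[OF that] by (intro S.measurable_A) simp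
        show "?I n \<in> borel_measurable W" for n by (rule F.measurable_simple_stable_integral[OF simple sfin])
        show "Y (N n) \<in> borel_measurable \<Omega>" if "n \<in> J" for n by (rule Ym[OF N(1)[OF that]])
        show "AE w in \<Omega>. Y (N n) w = simple_stable_integral (\<Omega>' \<Otimes>\<^sub>M lborel) M
          (\<lambda>z. (if 0 < snd z - A (real_of_int (- h + h)) (fst z) then 1 else - 1) *
            level_crossing (\<lambda>t. snd z - A (real_of_int (t + h)) (fst z)) n) w" if "n \<in> J" for n
        proof -
          have "G (N n) = (\<lambda>z. (if 0 < snd z - A (real_of_int (- h + h)) (fst z) then 1 else - 1) *
            level_crossing (\<lambda>t. snd z - A (real_of_int (t + h)) (fst z)) n)"
            unfolding G_def level_crossing_def N(3,4)[OF that] by simp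
          then show ?thesis using G(2)[OF N(1)[OF that]] by simp
        qed
      qed auto
      also have "\<dots> = distr V (\<Pi>\<^sub>M j\<in>J. borel) (\<lambda>v. \<lambda>j\<in>J. Z (int (N j)) v)"
        using Ym Zm N(1) by (intro same_fdds_reindex[OF ZY J, symmetric]) auto
      also have "\<dots> = distr V (\<Pi>\<^sub>M j\<in>J. borel) (\<lambda>v. \<lambda>j\<in>J. Z (j + (h + 1)) v)"
        by (intro distr_cong) (auto simp: N fun_eq_iff)
      also have "\<dots> = distr V (\<Pi>\<^sub>M j\<in>J. borel) (\<lambda>v. \<lambda>j\<in>J. Z j v)"
        using Z J unfolding stationary_process_def same_fdds_def by blast
      finally show "distr V (\<Pi>\<^sub>M j\<in>J. borel) (\<lambda>v. \<lambda>j\<in>J. Z j v) = distr W (\<Pi>\<^sub>M j\<in>J. borel) (\<lambda>p. \<lambda>j\<in>J. ?I j p)" ..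
    qed
    moreover have "AE z in path_measure. \<exists>n. ?k n z \<noteq> 0"
    proof -
      have "AE z in path_measure. \<forall>n. ?k n z = level_crossing (fst z) n" using k by (simp add: AE_all_countable)
      then show ?thesis using infinite
      proof eventually_elim
        case (elim z)
        then obtain n :: nat where "level_crossing (fst z) (int n) \<noteq> 0"
          using not_finite_existsD by blast
        then show ?case using elim(1) by (intro exI[of _ "int n"]) simp
      qed
    qed
    moreover have "sign_cocycle path_measure shift_flow (\<lambda>_ _. 1)" by (auto simp: sign_cocycle_def)
    moreover have "in_Lp \<alpha> path_measure (\<lambda>z. level_crossing (fst z) 0)" by (rule Lp[of _ 0]) auto
    ultimately show ?thesis
      unfolding generated_by_flow_def using flow.nonsingular W
      by (intro conjI allI exI[of _ "\<lambda>_ _. 1"] exI[of _ "\<lambda>z. level_crossing (fst z) 0"] exI[of _ W]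
          exI[of _ "\<lambda>B p. p B"] exI[of _ ?I]) simp_all
  qed
  ultimately show ?thesis by blast
qed

end
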